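(* Let $M$ be a closed oriented smooth 3-manifold, let $\mathcal D$ be a transversely oriented plane field on $M$ which is integrable (tangent to a foliation), let $T$ be a smooth vector field transverse to $\mathcal D$, and let $\omega$ be the 1-form with $\ker\omega=\mathcal D$ and $\omega(T)=1$. Then: (a) the pair $(\mathcal D,T)$ is critical for the functional $\mathrm{gv}$ if and only if $(\mathcal L_T)^3\omega=0$, where $\mathcal L_T$ is the Lie derivative along $T$; (b) there are no two-dimensional foliations of $M$ which are extremal for $\mathrm{gv}$; that is, no pair $(\mathcal D,T)$ with $\mathcal D$ integrable is a local extremum of $\mathrm{gv}$.
   Context: For a plane field $\mathcal D$ and a vector field $T$ transverse to it, let $\omega$ be the unique 1-form with $\ker\omega=\mathcal D$, $\omega(T)=1$, and put $\eta=\iota_T\,d\omega$ and $\mathrm{gv}(\mathcal D,T)=\int_M\eta\wedge d\eta$. Variations of $(\mathcal D,T)$ are smooth families $(\omega_t,T_t)$, $|t|<\varepsilon$, of 1-forms and vector fields with $\omega_t(T_t)\equiv1$, $(\omega_0,T_0)=(\omega,T)$, and $\mathcal D_t=\ker\omega_t$ (the planes $\mathcal D_t$, $t\ne0$, need not be integrable). The pair $(\mathcal D,T)$ is critical if $\frac{d}{dt}\mathrm{gv}(\mathcal D_t,T_t)|_{t=0}=0$ for every variation. It is a local extremum if either for every variation $t\mapsto\mathrm{gv}(\mathcal D_t,T_t)$ has a local minimum at $t=0$, or for every variation it has a local maximum at $t=0$. *)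

theory Defs
  imports "HOL-Analysis.Analysis"
begin

text \<open>Smoothness is only meant for open sets, where the derivative at a point only
  depends on the values on the set.\<close>

primrec Ck_on ::
  "nat \<Rightarrow> ('a::real_normed_vector \<Rightarrow> 'b::real_normed_vector) \<Rightarrow> 'a set \<Rightarrow> bool" where
  "Ck_on 0 f S \<longleftrightarrow> continuous_on S f"
| "Ck_on (Suc k) f S \<longleftrightarrow>
     (\<forall>x\<in>S. f differentiable (at x)) \<and> (\<forall>v. Ck_on k (\<lambda>x. frechet_derivative f (at x) v) S)"

definition smooth_on :: "('a::real_normed_vector \<Rightarrow> 'b::real_normed_vector) \<Rightarrow> 'a set \<Rightarrow> bool" where
  "smooth_on f S \<longleftrightarrow> (\<forall>k. Ck_on k f S)"

definition diffeo_on :: "('a::real_normed_vector \<Rightarrow> 'b::real_normed_vector) \<Rightarrow> 'a set \<Rightarrow> bool" where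
  "diffeo_on f S \<longleftrightarrow> open S \<and> inj_on f S \<and> open (f ` S)
     \<and> smooth_on f S \<and> smooth_on (inv_into S f) (f ` S)"

text \<open>The underlying space is the whole of a Hausdorff type. A chart is a pair of its domain
  and the coordinate map; the values of the map outside the domain are irrelevant.\<close>

type_synonym 'a chart = "'a set \<times> ('a \<Rightarrow> real^3)"

definition chart_img :: "'a chart \<Rightarrow> (real^3) set" where
  "chart_img c = snd c ` fst c"

definition chart_inv :: "'a chart \<Rightarrow> real^3 \<Rightarrow> 'a" where
  "chart_inv c = inv_into (fst c) (snd c)"

definition is_chart :: "'a::topological_space chart \<Rightarrow> bool" where
  "is_chart c \<longleftrightarrow> open (fst c) \<and> open (chart_img c)
     \<and> homeomorphism (fst c) (chart_img c) (snd c) (chart_inv c)"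

definition overlap :: "'a chart \<Rightarrow> 'a chart \<Rightarrow> (real^3) set" where
  "overlap c d = snd c ` (fst c \<inter> fst d)"

definition transition :: "'a chart \<Rightarrow> 'a chart \<Rightarrow> real^3 \<Rightarrow> real^3" where
  "transition c d = snd d \<circ> chart_inv c"

abbreviation Dtransition :: "'a chart \<Rightarrow> 'a chart \<Rightarrow> real^3 \<Rightarrow> real^3 \<Rightarrow> real^3" where
  "Dtransition c d x \<equiv> frechet_derivative (transition c d) (at x)"

text \<open>The smooth structure and the orientation are given by an atlas whose transition maps are
  smooth with positive Jacobian determinant. Second countability follows from compactness.\<close>

definition closed_oriented_3manifold :: "'a::t2_space chart set \<Rightarrow> bool" where
  "closed_oriented_3manifold A \<longleftrightarrow>
     compact (UNIV :: 'a set)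
     \<and> (\<forall>c\<in>A. is_chart c)
     \<and> (\<Union>c\<in>A. fst c) = UNIV
     \<and> (\<forall>c\<in>A. \<forall>d\<in>A. smooth_on (transition c d) (overlap c d)
           \<and> (\<forall>x\<in>overlap c d. det (matrix (Dtransition c d x)) > 0))"

definition smooth_function :: "'a chart set \<Rightarrow> ('a \<Rightarrow> real) \<Rightarrow> bool" where
  "smooth_function A g \<longleftrightarrow> (\<forall>c\<in>A. smooth_on (g \<circ> chart_inv c) (chart_img c))"

text \<open>A tensor field is the family of its local representatives: \<open>F c x\<close> is its value at
  the point with coordinates \<open>x\<close>, expressed in the chart \<open>c\<close>. The representatives are
  related by the transformation law of the tensor type, and only their values at \<open>c \<in> A\<close> and
  \<open>x \<in> chart_img c\<close> matter. A covector is given by its vector of components, so that it acts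
  on tangent vectors by the inner product of \<open>real^3\<close>.\<close>

type_synonym 'a field = "'a chart \<Rightarrow> real^3 \<Rightarrow> real^3"
type_synonym 'a planes = "'a chart \<Rightarrow> real^3 \<Rightarrow> (real^3) set"

definition vector_field :: "'a chart set \<Rightarrow> 'a field \<Rightarrow> bool" where
  "vector_field A X \<longleftrightarrow>
     (\<forall>c\<in>A. smooth_on (X c) (chart_img c))
     \<and> (\<forall>c\<in>A. \<forall>d\<in>A. \<forall>x\<in>overlap c d. X d (transition c d x) = Dtransition c d x (X c x))"

definition one_form :: "'a chart set \<Rightarrow> 'a field \<Rightarrow> bool" where
  "one_form A \<omega> \<longleftrightarrow>
     (\<forall>c\<in>A. smooth_on (\<omega> c) (chart_img c))
     \<and> (\<forall>c\<in>A. \<forall>d\<in>A. \<forall>x\<in>overlap c d. \<forall>v.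
           \<omega> c x \<bullet> v = \<omega> d (transition c d x) \<bullet> Dtransition c d x v)"

definition ker_form :: "'a field \<Rightarrow> 'a planes" where
  "ker_form \<omega> c x = {v. \<omega> c x \<bullet> v = 0}"

text \<open>A smooth field of planes is locally the kernel of a smooth nowhere vanishing 1-form.\<close>

definition plane_field :: "'a chart set \<Rightarrow> 'a planes \<Rightarrow> bool" where
  "plane_field A D \<longleftrightarrow>
     (\<forall>c\<in>A. \<forall>x\<in>chart_img c. \<exists>V a. open V \<and> x \<in> V \<and> V \<subseteq> chart_img c \<and> smooth_on a V
        \<and> (\<forall>y\<in>V. a y \<noteq> 0 \<and> D c y = {v. a y \<bullet> v = 0}))
     \<and> (\<forall>c\<in>A. \<forall>d\<in>A. \<forall>x\<in>overlap c d. D d (transition c d x) = Dtransition c d x ` D c x)"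

text \<open>A transverse orientation of \<open>D\<close> is a continuous choice \<open>P\<close> of the positive one of the two
  open half-spaces bounded by the plane in each tangent space.\<close>

definition transverse_orientation :: "'a chart set \<Rightarrow> 'a planes \<Rightarrow> 'a planes \<Rightarrow> bool" where
  "transverse_orientation A D P \<longleftrightarrow>
     (\<forall>c\<in>A. \<forall>x\<in>chart_img c. \<exists>V a. open V \<and> x \<in> V \<and> V \<subseteq> chart_img c \<and> continuous_on V a
        \<and> (\<forall>y\<in>V. a y \<noteq> 0 \<and> D c y = {v. a y \<bullet> v = 0} \<and> P c y = {v. a y \<bullet> v > 0}))
     \<and> (\<forall>c\<in>A. \<forall>d\<in>A. \<forall>x\<in>overlap c d. P d (transition c d x) = Dtransition c d x ` P c x)"

text \<open>A plane field is tangent to a foliation if around each point there is a foliated chart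
  \<open>\<psi>\<close>, straightening the planes to the horizontal ones (the plaques being the level
  sets of the third coordinate).\<close>

definition integrable_planes :: "'a chart set \<Rightarrow> 'a planes \<Rightarrow> bool" where
  "integrable_planes A D \<longleftrightarrow>
     (\<forall>c\<in>A. \<forall>x\<in>chart_img c. \<exists>V (\<psi> :: real^3 \<Rightarrow> real^3).
        x \<in> V \<and> V \<subseteq> chart_img c \<and> diffeo_on \<psi> V
        \<and> (\<forall>y\<in>V. D c y = {v. frechet_derivative \<psi> (at y) v $ 3 = 0}))"

definition transverse :: "'a chart set \<Rightarrow> 'a field \<Rightarrow> 'a planes \<Rightarrow> bool" where
  "transverse A T D \<longleftrightarrow> (\<forall>c\<in>A. \<forall>x\<in>chart_img c. T c x \<notin> D c x)"

text \<open>The 1-form with kernel \<open>D\<close> and value 1 on \<open>T\<close>; it is determined pointwise.\<close>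

definition dual_form :: "'a planes \<Rightarrow> 'a field \<Rightarrow> 'a field" where
  "dual_form D T c x = (THE a. {v. a \<bullet> v = 0} = D c x \<and> a \<bullet> T c x = 1)"

type_synonym 'a two_form = "'a chart \<Rightarrow> real^3 \<Rightarrow> real^3 \<Rightarrow> real^3 \<Rightarrow> real"
type_synonym 'a three_form = "'a chart \<Rightarrow> real^3 \<Rightarrow> real^3 \<Rightarrow> real^3 \<Rightarrow> real^3 \<Rightarrow> real"

text \<open>In coordinates, the coefficient of the exterior derivative on the basis vectors
  \<open>i\<close>, \<open>j\<close> is \<open>\<partial>\<^sub>i \<omega>\<^sub>j - \<partial>\<^sub>j \<omega>\<^sub>i\<close> (no factor 1/2).\<close>

definition ext_deriv :: "'a field \<Rightarrow> 'a two_form" where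
  "ext_deriv \<omega> c x u v =
     frechet_derivative (\<omega> c) (at x) u \<bullet> v - frechet_derivative (\<omega> c) (at x) v \<bullet> u"

definition interior_product :: "'a field \<Rightarrow> 'a two_form \<Rightarrow> 'a field" where
  "interior_product X \<beta> c x = (\<chi> i. \<beta> c x (X c x) (axis i 1))"

definition wedge :: "'a field \<Rightarrow> 'a two_form \<Rightarrow> 'a three_form" where
  "wedge \<alpha> \<beta> c x u v w =
     (\<alpha> c x \<bullet> u) * \<beta> c x v w - (\<alpha> c x \<bullet> v) * \<beta> c x u w + (\<alpha> c x \<bullet> w) * \<beta> c x u v"

definition lie_bracket :: "(real^3 \<Rightarrow> real^3) \<Rightarrow> (real^3 \<Rightarrow> real^3) \<Rightarrow> real^3 \<Rightarrow> real^3" where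
  "lie_bracket X Y x =
     frechet_derivative Y (at x) (X x) - frechet_derivative X (at x) (Y x)"

text \<open>The Leibniz formula \<open>(L\<^sub>X \<omega>)(Y) = X(\<omega>(Y)) - \<omega>([X, Y])\<close>, evaluated on the
  constant coordinate fields \<open>Y\<close> of the chart; the components are thus
  \<open>X\<^sup>j \<partial>\<^sub>j \<omega>\<^sub>i + \<omega>\<^sub>j \<partial>\<^sub>i X\<^sup>j\<close>.\<close>

definition lie_derivative :: "'a field \<Rightarrow> 'a field \<Rightarrow> 'a field" where
  "lie_derivative X \<omega> c x =
     (\<chi> i. frechet_derivative (\<lambda>y. \<omega> c y \<bullet> axis i 1) (at x) (X c x)
            - \<omega> c x \<bullet> lie_bracket (X c) (\<lambda>_. axis i 1) x)"

definition partition_of_unity ::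
  "'a::topological_space chart set \<Rightarrow> 'a chart set \<Rightarrow> ('a chart \<Rightarrow> 'a \<Rightarrow> real) \<Rightarrow> bool" where
  "partition_of_unity A C \<rho> \<longleftrightarrow> finite C \<and> C \<subseteq> A
     \<and> (\<forall>c\<in>C. smooth_function A (\<rho> c) \<and> (\<forall>p. 0 \<le> \<rho> c p) \<and> closure {p. \<rho> c p \<noteq> 0} \<subseteq> fst c)
     \<and> (\<forall>p. (\<Sum>c\<in>C. \<rho> c p) = 1)"

text \<open>The value does not depend on the partition of unity that is chosen.\<close>

definition manifold_integral :: "'a::topological_space chart set \<Rightarrow> 'a three_form \<Rightarrow> real" where
  "manifold_integral A \<Omega> =
     (let (C, \<rho>) = (SOME (C, \<rho>). partition_of_unity A C \<rho>)
      in \<Sum>c\<in>C. integral (chart_img c)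
           (\<lambda>x. \<rho> c (chart_inv c x) * \<Omega> c x (axis 1 1) (axis 2 1) (axis 3 1)))"

definition gv :: "'a::topological_space chart set \<Rightarrow> 'a planes \<Rightarrow> 'a field \<Rightarrow> real" where
  "gv A D T =
     (let \<eta> = interior_product T (ext_deriv (dual_form D T))
      in manifold_integral A (wedge \<eta> (ext_deriv \<eta>)))"

definition smooth_family :: "'a chart set \<Rightarrow> real \<Rightarrow> (real \<Rightarrow> 'a field) \<Rightarrow> bool" where
  "smooth_family A \<epsilon> F \<longleftrightarrow>
     (\<forall>c\<in>A. smooth_on (\<lambda>(t, x). F t c x) ({-\<epsilon><..<\<epsilon>} \<times> chart_img c))"

definition variation ::
  "'a chart set \<Rightarrow> 'a planes \<Rightarrow> 'a field \<Rightarrow> real \<Rightarrow> (real \<Rightarrow> 'a field) \<Rightarrow> (real \<Rightarrow> 'a field) \<Rightarrow> bool" where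
  "variation A D T \<epsilon> \<omega>t Tt \<longleftrightarrow> \<epsilon> > 0
     \<and> (\<forall>t. \<bar>t\<bar> < \<epsilon> \<longrightarrow> one_form A (\<omega>t t) \<and> vector_field A (Tt t))
     \<and> smooth_family A \<epsilon> \<omega>t \<and> smooth_family A \<epsilon> Tt
     \<and> (\<forall>t. \<bar>t\<bar> < \<epsilon> \<longrightarrow> (\<forall>c\<in>A. \<forall>x\<in>chart_img c. \<omega>t t c x \<bullet> Tt t c x = 1))
     \<and> (\<forall>c\<in>A. \<forall>x\<in>chart_img c. \<omega>t 0 c x = dual_form D T c x \<and> Tt 0 c x = T c x)"

definition critical :: "'a::topological_space chart set \<Rightarrow> 'a planes \<Rightarrow> 'a field \<Rightarrow> bool" where
  "critical A D T \<longleftrightarrow>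
     (\<forall>\<epsilon> \<omega>t Tt. variation A D T \<epsilon> \<omega>t Tt \<longrightarrow>
        ((\<lambda>t. gv A (ker_form (\<omega>t t)) (Tt t)) has_real_derivative 0) (at 0))"

definition local_min_at :: "(real \<Rightarrow> real) \<Rightarrow> real \<Rightarrow> bool" where
  "local_min_at g a \<longleftrightarrow> (\<forall>\<^sub>F t in nhds a. g a \<le> g t)"

definition local_max_at :: "(real \<Rightarrow> real) \<Rightarrow> real \<Rightarrow> bool" where
  "local_max_at g a \<longleftrightarrow> (\<forall>\<^sub>F t in nhds a. g t \<le> g a)"

definition local_extremum :: "'a::topological_space chart set \<Rightarrow> 'a planes \<Rightarrow> 'a field \<Rightarrow> bool" where
  "local_extremum A D T \<longleftrightarrow>
     (\<forall>\<epsilon> \<omega>t Tt. variation A D T \<epsilon> \<omega>t Tt \<longrightarrow>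
        local_min_at (\<lambda>t. gv A (ker_form (\<omega>t t)) (Tt t)) 0)
   \<or> (\<forall>\<epsilon> \<omega>t Tt. variation A D T \<epsilon> \<omega>t Tt \<longrightarrow>
        local_max_at (\<lambda>t. gv A (ker_form (\<omega>t t)) (Tt t)) 0)"

end

theory Submission
  imports Defs
begin

text \<open>Put \<open>\<eta> = \<iota>\<^sub>T d\<omega> = L\<^sub>T \<omega>\<close> and \<open>\<zeta> = \<iota>\<^sub>T d\<eta> = L\<^sub>T\<^sup>2 \<omega>\<close>. Integrability gives
  \<open>d\<omega> = \<omega> \<and> \<eta>\<close>, and \<open>d d = 0\<close> then gives \<open>d\<eta> = \<omega> \<and> \<zeta>\<close>. For a variation with
  velocity \<open>\<alpha>\<close> of \<open>\<omega>\<close>, the derivative of \<open>\<eta> \<and> d\<eta>\<close> equals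
  \<open>- 2 \<alpha> \<and> \<omega> \<and> L\<^sub>T\<^sup>3 \<omega>\<close> up to an exact form, whatever the velocity of \<open>T\<close> is; by the theorem of
  Stokes this is the first variation, and its vanishing for all \<open>\<alpha>\<close> means \<open>L\<^sub>T\<^sup>3 \<omega> = 0\<close>, since
  both \<open>\<omega>(T) = 1\<close> and \<open>(L\<^sub>T\<^sup>3 \<omega>)(T) = 0\<close>.

  Along \<open>\<omega> + t \<beta>\<close> with \<open>\<beta>(T) = 0\<close> and \<open>T\<close> fixed, \<open>gv\<close> is a quadratic polynomial in \<open>t\<close>
  with leading coefficient \<open>Q(\<beta>) = \<integral> L\<^sub>T \<beta> \<and> d L\<^sub>T \<beta>\<close>, so it suffices to find \<open>\<beta>\<close> with \<open>Q(\<beta>)\<close>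
  of either sign. Take local forms \<open>cos (N k x + \<theta>) \<mu> + sin (N k x + \<theta>) \<nu>\<close> whose direction
  rotates along \<open>T\<close>: the sum of their values \<open>Q\<close> for \<open>\<theta> = 0\<close> and \<open>\<theta> = pi / 2\<close> is a cubic
  polynomial in \<open>N\<close> with nonzero leading coefficient.\<close>

section \<open>Smooth maps\<close>

text \<open>The quadratic form \<open>Q\<close> is of Chern-Simons type. A wave with covector
  \<open>N k\<close> gains a factor \<open>N\<close> from each of its three derivatives, one in each
  \<open>L_T\<close> and one in \<open>d\<close>; this is the source of the cubic, and because the
  power is odd the sign of \<open>N\<close> selects the sign of \<open>Q\<close>. A wave of fixed
  direction contributes nothing at that order: the leading term is a multiple of k \<and> \<mu>
  \<and> \<nu>, hence the rotation. Since two phases a quarter turn apart cancel the oscillation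
  exactly, no estimate of oscillatory integrals enters.

  Two obstacles shape the rest. The planes of a variation are integrable only at t = 0, so \<omega>
  and T are differentiated as independent families, and the identities of the integrable case are
  applied to their values at t = 0. And \<open>gv\<close> is a sum over an arbitrarily chosen
  partition of unity, so localisation in a chart and the theorem of Stokes must be derived for that
  sum. Exterior calculus is done with the Euclidean cross product, curl and divergence of each
  chart; these are not invariant by themselves, and only combinations with a known transformation
  law are carried from chart to chart.\<close>

abbreviation "fderiv f x \<equiv> frechet_derivative f (at x)"

lemma has_derivative_cong_open:
  assumes "open S" "x \<in> S" "\<And>y. y \<in> S \<Longrightarrow> f y = g y"
  shows "(f has_derivative D) (at x) \<longleftrightarrow> (g has_derivative D) (at x)"
  using assms has_derivative_transform_within_open[of f D x UNIV S g]
    has_derivative_transform_within_open[of g D x UNIV S f] by auto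

lemma frechet_derivative_cong_open:
  assumes "open S" "x \<in> S" "\<And>y. y \<in> S \<Longrightarrow> f y = g y"
  shows "fderiv f x = fderiv g x"
  using has_derivative_cong_open[OF assms] by (simp add: frechet_derivative_def)

lemma differentiable_cong_open:
  assumes "open S" "x \<in> S" "\<And>y. y \<in> S \<Longrightarrow> f y = g y"
  shows "f differentiable (at x) \<longleftrightarrow> g differentiable (at x)"
  using has_derivative_cong_open[OF assms] by (simp add: differentiable_def)

lemma Ck_on_cong:
  assumes "open S" "\<And>y. y \<in> S \<Longrightarrow> f y = g y"
  shows "Ck_on k f S \<longleftrightarrow> Ck_on k g S"
  using assms(2)
proof (induction k arbitrary: f g)
  case 0
  then show ?case by (simp cong: continuous_on_cong)
next
  case (Suc k)
  have "Ck_on k (\<lambda>x. fderiv f x v) S \<longleftrightarrow> Ck_on k (\<lambda>x. fderiv g x v) S" for v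
    using frechet_derivative_cong_open[OF assms(1) _ Suc.prems] by (intro Suc.IH) simp
  moreover have "f differentiable (at x) \<longleftrightarrow> g differentiable (at x)" if "x \<in> S" for x
    using differentiable_cong_open[OF assms(1) that Suc.prems] .
  ultimately show ?case by simp
qed

text \<open>Lets an explicit derivative formula stand in for \<open>frechet_derivative\<close>; the
  closure properties below are inductions that apply it to their product or chain rule.\<close>

lemma Ck_on_SucI:
  assumes "open S" "\<And>x. x \<in> S \<Longrightarrow> (f has_derivative f' x) (at x)" "\<And>v. Ck_on k (\<lambda>x. f' x v) S"
  shows "Ck_on (Suc k) f S"
proof -
  have "fderiv f x = f' x" if "x \<in> S" for x
    using frechet_derivative_at[OF assms(2)[OF that]] by simp
  then have "Ck_on k (\<lambda>x. fderiv f x v) S" for v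
    using Ck_on_cong[OF assms(1), of "\<lambda>x. fderiv f x v" "\<lambda>x. f' x v"] assms(3) by auto
  then show ?thesis using assms(2) by (auto simp: differentiable_def)
qed

lemma Ck_on_has_derivative:
  "Ck_on (Suc k) f S \<Longrightarrow> x \<in> S \<Longrightarrow> (f has_derivative fderiv f x) (at x)"
  by (simp add: frechet_derivative_works)

lemma Ck_on_SucD: "Ck_on (Suc k) f S \<Longrightarrow> Ck_on k f S"
proof (induction k arbitrary: f)
  case 0
  then show ?case
    by (auto intro!: continuous_at_imp_continuous_on differentiable_imp_continuous_within)
qed auto

lemma Ck_on_subset: "Ck_on k f S \<Longrightarrow> T \<subseteq> S \<Longrightarrow> Ck_on k f T"
  by (induction k arbitrary: f) (auto intro: continuous_on_subset)

lemma Ck_on_const: "Ck_on k (\<lambda>x. c) S"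
  by (induction k arbitrary: c) auto

lemma Ck_on_bounded_linear: "bounded_linear f \<Longrightarrow> Ck_on k f S"
proof (cases k)
  case (Suc n)
  assume f: "bounded_linear f"
  then have "fderiv f x = f" for x
    using frechet_derivative_at[OF bounded_linear_imp_has_derivative[OF f]] by simp
  with f Suc show ?thesis
    by (auto simp: Ck_on_const bounded_linear_imp_differentiable)
qed (simp add: linear_continuous_on)

lemma Ck_on_linear_compose:
  assumes "open S" "bounded_linear h" "Ck_on k f S"
  shows "Ck_on k (\<lambda>x. h (f x)) S"
  using assms(3)
proof (induction k arbitrary: f)
  case 0
  then show ?case using assms(2) by (simp add: bounded_linear.continuous_on)
next
  case (Suc k)
  show ?case
  proof (rule Ck_on_SucI[OF assms(1)])
    show "((\<lambda>x. h (f x)) has_derivative (\<lambda>v. h (fderiv f x v))) (at x)" if "x \<in> S" for x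
      using Ck_on_has_derivative[OF Suc.prems that] by (rule bounded_linear.has_derivative[OF assms(2)])
    show "Ck_on k (\<lambda>x. h (fderiv f x v)) S" for v
      using Suc.prems by (intro Suc.IH) simp
  qed
qed

lemma Ck_on_add:
  assumes "open S" "Ck_on k f S" "Ck_on k g S"
  shows "Ck_on k (\<lambda>x. f x + g x) S"
  using assms(2,3)
proof (induction k arbitrary: f g)
  case 0
  then show ?case by (simp add: continuous_on_add)
next
  case (Suc k)
  show ?case
  proof (rule Ck_on_SucI[OF assms(1)])
    show "((\<lambda>x. f x + g x) has_derivative
        (\<lambda>v. fderiv f x v + fderiv g x v)) (at x)" if "x \<in> S" for x
      using Suc.prems[THEN Ck_on_has_derivative, OF that] by (rule has_derivative_add)
    show "Ck_on k (\<lambda>x. fderiv f x v + fderiv g x v) S" for v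
      using Suc.prems by (intro Suc.IH) simp_all
  qed
qed

lemma Ck_on_sum:
  assumes "open S" "\<And>i. i \<in> I \<Longrightarrow> Ck_on k (f i) S"
  shows "Ck_on k (\<lambda>x. \<Sum>i\<in>I. f i x) S"
  using assms(2)
  by (induction I rule: infinite_finite_induct) (auto simp: Ck_on_const Ck_on_add assms(1))

lemma Ck_on_bilinear:
  assumes "open S" "bounded_bilinear h" "Ck_on k f S" "Ck_on k g S"
  shows "Ck_on k (\<lambda>x. h (f x) (g x)) S"
  using assms(3,4)
proof (induction k arbitrary: f g)
  case 0
  then show ?case using bounded_bilinear.continuous_on[OF assms(2)] by simp
next
  case (Suc k)
  show ?case
  proof (rule Ck_on_SucI[OF assms(1)])
    show "((\<lambda>x. h (f x) (g x)) has_derivative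
        (\<lambda>v. h (f x) (fderiv g x v) + h (fderiv f x v) (g x))) (at x)"
      if "x \<in> S" for x
      using Suc.prems[THEN Ck_on_has_derivative, OF that] by (rule bounded_bilinear.FDERIV[OF assms(2)])
    show "Ck_on k (\<lambda>x. h (f x) (fderiv g x v) + h (fderiv f x v) (g x)) S" for v
      using Suc.prems[THEN Ck_on_SucD] Suc.prems by (intro Ck_on_add Suc.IH assms) auto
  qed
qed

lemma Ck_on_compose:
  fixes f :: "'b::euclidean_space \<Rightarrow> 'c::real_normed_vector"
  assumes "open S" "open T" "g ` S \<subseteq> T" "Ck_on k f T" "Ck_on k g S"
  shows "Ck_on k (\<lambda>x. f (g x)) S"
  using assms(4,5)
proof (induction k arbitrary: f)
  case 0
  then show ?case using assms(3) by (simp add: continuous_on_compose2[of T f S g])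
next
  case (Suc k)
  \<comment> \<open>In the plain chain rule the direction \<open>fderiv g x v\<close> varies with
    \<open>x\<close>, whereas \<open>Ck_on\<close> speaks of derivatives in fixed directions.
    Expanding in the basis of the middle space leaves products of functions covered by the
    induction.\<close>
  let ?D = "\<lambda>x v. \<Sum>b\<in>Basis. (fderiv g x v \<bullet> b) *\<^sub>R fderiv f (g x) b"
  show ?case
  proof (rule Ck_on_SucI[OF assms(1)])
    show "((\<lambda>x. f (g x)) has_derivative ?D x) (at x)" if "x \<in> S" for x
    proof -
      have f: "(f has_derivative fderiv f (g x)) (at (g x))"
        using Suc.prems(1) Ck_on_has_derivative assms(3) that by blast
      have g: "(g has_derivative fderiv g x) (at x)"
        using Suc.prems(2) Ck_on_has_derivative that by blast
      have "linear (fderiv f (g x))"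
        using f has_derivative_linear by blast
      then have "?D x v = fderiv f (g x) (\<Sum>b\<in>Basis. (fderiv g x v \<bullet> b) *\<^sub>R b)" for v
        by (simp only: linear_sum linear_scale)
      then have "?D x = (\<lambda>v. fderiv f (g x) (fderiv g x v))"
        unfolding euclidean_representation by (rule ext)
      with has_derivative_compose[OF g f] show ?thesis
        by simp
    qed
    show "Ck_on k (\<lambda>x. ?D x v) S" for v
    proof (rule Ck_on_sum[OF assms(1)], rule Ck_on_bilinear[OF assms(1) bounded_bilinear_scaleR])
      fix b :: 'b
      show "Ck_on k (\<lambda>x. fderiv g x v \<bullet> b) S"
        by (rule Ck_on_linear_compose[OF assms(1) bounded_linear_inner_left]) (use Suc.prems(2) in simp)
      show "Ck_on k (\<lambda>x. fderiv f (g x) b) S"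
        by (rule Suc.IH) (use Suc.prems(1) Ck_on_SucD[OF Suc.prems(2)] in simp_all)
    qed
  qed
qed

lemma Ck_on_inverse: "Ck_on k (inverse :: real \<Rightarrow> real) (- {0})"
proof (induction k)
  case 0
  then show ?case by (auto intro!: continuous_intros)
next
  case (Suc k)
  show ?case
  proof (rule Ck_on_SucI)
    \<comment> \<open>Writing the derivative as a product of two copies of \<open>inverse\<close>
      makes the induction hypothesis applicable to it.\<close>
    show "(inverse has_derivative (\<lambda>v. (- v) * (inverse x * inverse x))) (at x)" if "x \<in> - {0}" for x :: real
      using that by (auto intro!: derivative_eq_intros simp: mult_ac)
    show "Ck_on k (\<lambda>x::real. (- v) * (inverse x * inverse x)) (- {0})" for v
      by (intro Ck_on_bilinear[OF _ bounded_bilinear_mult] Suc Ck_on_const open_Compl closed_singleton)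
  qed (simp add: open_Compl)
qed

text \<open>Differentiation exchanges the two functions, so they share one induction.\<close>

lemma Ck_on_sin_cos: "Ck_on k (sin :: real \<Rightarrow> real) UNIV \<and> Ck_on k (cos :: real \<Rightarrow> real) UNIV"
proof (induction k)
  case 0
  then show ?case by (auto intro!: continuous_intros)
next
  case (Suc k)
  have "Ck_on (Suc k) (sin :: real \<Rightarrow> real) UNIV"
  proof (rule Ck_on_SucI)
    show "(sin has_derivative (\<lambda>v. v * cos x)) (at x)" for x :: real
      by (auto intro!: derivative_eq_intros)
    show "Ck_on k (\<lambda>x::real. v * cos x) UNIV" for v
      using Suc by (intro Ck_on_bilinear[OF _ bounded_bilinear_mult] Ck_on_const) auto
  qed simp
  moreover have "Ck_on (Suc k) (cos :: real \<Rightarrow> real) UNIV"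
  proof (rule Ck_on_SucI)
    show "(cos has_derivative (\<lambda>v. (-v) * sin x)) (at x)" for x :: real
      by (auto intro!: derivative_eq_intros)
    show "Ck_on k (\<lambda>x::real. (-v) * sin x) UNIV" for v
      using Suc by (intro Ck_on_bilinear[OF _ bounded_bilinear_mult] Ck_on_const) auto
  qed simp
  ultimately show ?case by blast
qed

lemma Ck_on_local:
  assumes "open S" "\<And>x. x \<in> S \<Longrightarrow> \<exists>U. open U \<and> x \<in> U \<and> Ck_on k f U"
  shows "Ck_on k f S"
  using assms(2)
proof (induction k arbitrary: f)
  case 0
  show ?case
    unfolding Ck_on.simps continuous_on_eq_continuous_at[OF assms(1)]
    using 0 continuous_on_eq_continuous_at by fastforce
next
  case (Suc k)
  have "f differentiable at x" if "x \<in> S" for x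
    using Suc.prems[OF that] by auto
  moreover have "Ck_on k (\<lambda>x. fderiv f x v) S" for v
    using Suc.prems by (intro Suc.IH) fastforce
  ultimately show ?case by simp
qed

lemma smooth_on_cong:
  "open S \<Longrightarrow> (\<And>y. y \<in> S \<Longrightarrow> f y = g y) \<Longrightarrow> smooth_on f S \<longleftrightarrow> smooth_on g S"
  unfolding smooth_on_def using Ck_on_cong by blast

lemma smooth_on_subset: "smooth_on f S \<Longrightarrow> T \<subseteq> S \<Longrightarrow> smooth_on f T"
  unfolding smooth_on_def using Ck_on_subset by blast

lemma smooth_on_local:
  "open S \<Longrightarrow> (\<And>x. x \<in> S \<Longrightarrow> \<exists>U. open U \<and> x \<in> U \<and> smooth_on f U) \<Longrightarrow> smooth_on f S"
  unfolding smooth_on_def using Ck_on_local by metis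

lemma smooth_on_has_derivative:
  "smooth_on f S \<Longrightarrow> x \<in> S \<Longrightarrow> (f has_derivative fderiv f x) (at x)"
  unfolding smooth_on_def using Ck_on_has_derivative by blast

lemma smooth_on_imp_continuous_on: "smooth_on f S \<Longrightarrow> continuous_on S f"
  unfolding smooth_on_def using Ck_on.simps(1) by blast

lemma smooth_on_frechet: "smooth_on f S \<Longrightarrow> smooth_on (\<lambda>x. fderiv f x v) S"
  unfolding smooth_on_def using Ck_on.simps(2) by blast

lemma smooth_on_linear: "bounded_linear f \<Longrightarrow> smooth_on f S"
  by (simp add: smooth_on_def Ck_on_bounded_linear)

lemma smooth_on_const: "smooth_on (\<lambda>x. c) S"
  by (simp add: smooth_on_def Ck_on_const)

lemma smooth_on_linear_compose: "open S \<Longrightarrow> bounded_linear h \<Longrightarrow> smooth_on f S \<Longrightarrow> smooth_on (\<lambda>x. h (f x)) S"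
  by (simp add: smooth_on_def Ck_on_linear_compose)

lemma smooth_on_add: "open S \<Longrightarrow> smooth_on f S \<Longrightarrow> smooth_on g S \<Longrightarrow> smooth_on (\<lambda>x. f x + g x) S"
  by (simp add: smooth_on_def Ck_on_add)

lemma smooth_on_minus: "open S \<Longrightarrow> smooth_on f S \<Longrightarrow> smooth_on (\<lambda>x. - f x) S"
  by (rule smooth_on_linear_compose[OF _ bounded_linear_minus[OF bounded_linear_ident]])

lemma smooth_on_diff: "open S \<Longrightarrow> smooth_on f S \<Longrightarrow> smooth_on g S \<Longrightarrow> smooth_on (\<lambda>x. f x - g x) S"
  using smooth_on_add[of S f "\<lambda>x. - g x"] smooth_on_minus[of S g] by simp

lemma smooth_on_sum: "open S \<Longrightarrow> (\<And>i. i \<in> I \<Longrightarrow> smooth_on (f i) S) \<Longrightarrow> smooth_on (\<lambda>x. \<Sum>i\<in>I. f i x) S"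
  by (simp add: smooth_on_def Ck_on_sum)

lemma smooth_on_bilinear:
  "open S \<Longrightarrow> bounded_bilinear h \<Longrightarrow> smooth_on f S \<Longrightarrow> smooth_on g S \<Longrightarrow> smooth_on (\<lambda>x. h (f x) (g x)) S"
  by (simp add: smooth_on_def Ck_on_bilinear)

lemmas smooth_on_mult = smooth_on_bilinear[OF _ bounded_bilinear_mult]
lemmas smooth_on_scaleR = smooth_on_bilinear[OF _ bounded_bilinear_scaleR]
lemmas smooth_on_inner = smooth_on_bilinear[OF _ bounded_bilinear_inner]

lemma smooth_on_compose:
  fixes f :: "'b::euclidean_space \<Rightarrow> 'c::real_normed_vector"
  shows "open S \<Longrightarrow> open T \<Longrightarrow> g ` S \<subseteq> T \<Longrightarrow> smooth_on f T \<Longrightarrow> smooth_on g S \<Longrightarrow> smooth_on (\<lambda>x. f (g x)) S"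
  by (simp add: smooth_on_def Ck_on_compose)

lemma smooth_on_divide:
  fixes f g :: "'a::real_normed_vector \<Rightarrow> real"
  assumes "open S" "smooth_on f S" "smooth_on g S" "\<And>x. x \<in> S \<Longrightarrow> g x \<noteq> 0"
  shows "smooth_on (\<lambda>x. f x / g x) S"
proof -
  have "smooth_on (inverse :: real \<Rightarrow> real) (- {0})"
    by (simp add: smooth_on_def Ck_on_inverse)
  then have "smooth_on (\<lambda>x. inverse (g x)) S"
    by (rule smooth_on_compose[OF assms(1) _ _ _ assms(3), rotated -1]) (use assms(4) in auto)
  then show ?thesis
    unfolding divide_inverse using assms by (intro smooth_on_mult)
qed

lemma smooth_on_cos: "open S \<Longrightarrow> smooth_on f S \<Longrightarrow> smooth_on (\<lambda>x. cos (f x) :: real) S"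
  and smooth_on_sin: "open S \<Longrightarrow> smooth_on f S \<Longrightarrow> smooth_on (\<lambda>x. sin (f x) :: real) S"
  using smooth_on_compose[of S UNIV f cos] smooth_on_compose[of S UNIV f sin] Ck_on_sin_cos
  by (auto simp: smooth_on_def)

lemma smooth_on_vec:
  fixes f :: "'a::real_normed_vector \<Rightarrow> real^'n"
  assumes "open S" "\<And>i. smooth_on (\<lambda>x. f x $ i) S"
  shows "smooth_on f S"
proof -
  have "f = (\<lambda>x. \<Sum>i\<in>UNIV. (f x $ i) *\<^sub>R axis i 1)"
    by (auto simp: fun_eq_iff vec_eq_iff axis_def if_distrib cong: if_cong)
  moreover have "smooth_on (\<lambda>x. \<Sum>i\<in>UNIV. (f x $ i) *\<^sub>R axis i (1::real)) S"
    using assms by (intro smooth_on_sum smooth_on_scaleR smooth_on_const)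
  ultimately show ?thesis by simp
qed

lemma smooth_on_Pair:
  assumes "open S" "smooth_on f S" "smooth_on g S"
  shows "smooth_on (\<lambda>x. (f x, g x)) S"
proof -
  have "smooth_on (\<lambda>x. (f x, 0) + (0, g x)) S"
    using assms
    by (intro smooth_on_add smooth_on_linear_compose[of S "\<lambda>y. (y, 0)"] smooth_on_linear_compose[of S "\<lambda>y. (0, y)"])
      (auto intro!: bounded_linear_Pair bounded_linear_ident bounded_linear_zero)
  then show ?thesis by simp
qed

section \<open>Symmetry of second derivatives, bump functions\<close>

lemma smooth_on_directional_DERIV:
  fixes f :: "'a::real_normed_vector \<Rightarrow> real"
  assumes "smooth_on f S" "x + s *\<^sub>R u \<in> S"
  shows "((\<lambda>s. f (x + s *\<^sub>R u)) has_real_derivative fderiv f (x + s *\<^sub>R u) u) (at s)"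
proof -
  let ?D = "fderiv f (x + s *\<^sub>R u)"
  have f: "(f has_derivative ?D) (at (x + s *\<^sub>R u))"
    by (rule smooth_on_has_derivative[OF assms])
  have "((\<lambda>s. x + s *\<^sub>R u) has_derivative (\<lambda>r. r *\<^sub>R u)) (at s)"
    by (auto intro!: derivative_eq_intros)
  from has_derivative_compose[OF this f]
  have "((\<lambda>s. f (x + s *\<^sub>R u)) has_derivative (\<lambda>r. ?D (r *\<^sub>R u))) (at s)" .
  moreover have "(\<lambda>r. ?D (r *\<^sub>R u)) = (*) (?D u)"
    using linear_scale[OF has_derivative_linear[OF f]] by (auto simp: mult.commute)
  ultimately show ?thesis by (simp add: has_field_derivative_def)
qed

text \<open>The second mixed difference quotient of \<open>f\<close> is a value of the second derivative
  at a nearby point, whichever variable is treated first.\<close>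

lemma mixed_difference:
  fixes f :: "'a::real_normed_vector \<Rightarrow> real"
  assumes f: "smooth_on f S" and "h > 0"
    and S: "\<And>s t. 0 \<le> s \<Longrightarrow> s \<le> h \<Longrightarrow> 0 \<le> t \<Longrightarrow> t \<le> h \<Longrightarrow> x + s *\<^sub>R u + t *\<^sub>R v \<in> S"
  obtains s t where "0 < s" "s < h" "0 < t" "t < h"
    "f (x + h *\<^sub>R u + h *\<^sub>R v) - f (x + h *\<^sub>R u) - (f (x + h *\<^sub>R v) - f x)
      = h * h * fderiv (\<lambda>y. fderiv f y u) (x + s *\<^sub>R u + t *\<^sub>R v) v"
proof -
  let ?g = "\<lambda>y. fderiv f y u"
  have "((\<lambda>s. f ((x + h *\<^sub>R v) + s *\<^sub>R u) - f (x + s *\<^sub>R u)) has_real_derivative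
      ?g ((x + h *\<^sub>R v) + s *\<^sub>R u) - ?g (x + s *\<^sub>R u)) (at s)" if "0 \<le> s" "s \<le> h" for s
    using S[OF that, of h] S[OF that, of 0] \<open>h > 0\<close>
    by (intro DERIV_diff smooth_on_directional_DERIV[OF f]) (auto simp: algebra_simps)
  from MVT2[OF \<open>h > 0\<close> this] obtain s where s: "0 < s" "s < h"
    "f (x + h *\<^sub>R v + h *\<^sub>R u) - f (x + h *\<^sub>R u) - (f (x + h *\<^sub>R v) - f x)
      = h * (?g (x + h *\<^sub>R v + s *\<^sub>R u) - ?g (x + s *\<^sub>R u))"
    by auto
  have "((\<lambda>t. ?g ((x + s *\<^sub>R u) + t *\<^sub>R v)) has_real_derivative
      fderiv ?g ((x + s *\<^sub>R u) + t *\<^sub>R v) v) (at t)" if "0 \<le> t" "t \<le> h" for t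
    using S[of s t] that s by (intro smooth_on_directional_DERIV[OF smooth_on_frechet[OF f]]) auto
  from MVT2[OF \<open>h > 0\<close> this] obtain t where "0 < t" "t < h"
    "?g (x + s *\<^sub>R u + h *\<^sub>R v) - ?g (x + s *\<^sub>R u) = h * fderiv ?g (x + s *\<^sub>R u + t *\<^sub>R v) v"
    by auto
  with s show thesis
    by (intro that[of s t]) (auto simp: algebra_simps)
qed

text \<open>One and the same second difference equals \<open>h * h\<close> times either mixed
  derivative, each at some point near \<open>x\<close>; continuity of both derivatives then
  identifies their values at \<open>x\<close>.\<close>

lemma symmetric_second_derivative_real:
  fixes f :: "'a::real_normed_vector \<Rightarrow> real"
  assumes f: "smooth_on f S" and "open S" "x \<in> S"
  shows "fderiv (\<lambda>y. fderiv f y u) x v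
    = fderiv (\<lambda>y. fderiv f y v) x u"
proof -
  define D where "D u v y = fderiv (\<lambda>y. fderiv f y u) y v" for u v y
  have cont: "continuous_on S (D u v)" for u v
    unfolding D_def by (intro smooth_on_imp_continuous_on smooth_on_frechet f)
  have "\<bar>D u v x - D v u x\<bar> \<le> e" if "e > 0" for e
  proof -
    obtain d where "d > 0" and d: "\<And>y. y \<in> S \<Longrightarrow> dist y x < d \<Longrightarrow> \<bar>D u v y - D u v x\<bar> < e / 2"
      using cont[of u v, unfolded continuous_on_iff, rule_format, OF \<open>x \<in> S\<close>, of "e / 2"] \<open>e > 0\<close>
      unfolding dist_real_def by auto
    obtain d' where "d' > 0" and d': "\<And>y. y \<in> S \<Longrightarrow> dist y x < d' \<Longrightarrow> \<bar>D v u y - D v u x\<bar> < e / 2"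
      using cont[of v u, unfolded continuous_on_iff, rule_format, OF \<open>x \<in> S\<close>, of "e / 2"] \<open>e > 0\<close>
      unfolding dist_real_def by auto
    obtain r where "r > 0" and r: "ball x r \<subseteq> S"
      using \<open>open S\<close> \<open>x \<in> S\<close> open_contains_ball by blast
    define m where "m = min r (min d d')"
    \<comment> \<open>Makes every \<open>s *\<^sub>R u + t *\<^sub>R v\<close> with
      \<open>s, t \<le> h\<close> shorter than \<open>m\<close>; the summand 1 keeps the denominator
      positive.\<close>
    define h where "h = m / (norm u + norm v + 1)"
    have "m > 0" using \<open>r > 0\<close> \<open>d > 0\<close> \<open>d' > 0\<close> by (simp add: m_def)
    have den: "norm u + norm v + 1 > 0"
      by (smt (verit) norm_ge_zero)
    then have "h > 0" using \<open>m > 0\<close> by (simp add: h_def)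
    have near: "dist (x + s *\<^sub>R u + t *\<^sub>R v) x < m" if "0 \<le> s" "s \<le> h" "0 \<le> t" "t \<le> h" for s t
    proof -
      have "norm (s *\<^sub>R u + t *\<^sub>R v) \<le> s * norm u + t * norm v"
        using norm_triangle_ineq[of "s *\<^sub>R u" "t *\<^sub>R v"] that by simp
      also have "\<dots> \<le> h * norm u + h * norm v"
        using that by (intro add_mono mult_right_mono) auto
      also have "\<dots> < h * (norm u + norm v + 1)"
        using \<open>h > 0\<close> by (simp add: algebra_simps)
      also have "\<dots> = m" using den by (simp add: h_def)
      finally show ?thesis by (simp add: dist_norm add.assoc)
    qed
    then have S: "x + s *\<^sub>R u + t *\<^sub>R v \<in> S" if "0 \<le> s" "s \<le> h" "0 \<le> t" "t \<le> h" for s t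
      using that r by (force simp: m_def dist_commute)
    obtain s t where st: "0 < s" "s < h" "0 < t" "t < h"
      "f (x + h *\<^sub>R u + h *\<^sub>R v) - f (x + h *\<^sub>R u) - (f (x + h *\<^sub>R v) - f x) = h * h * D u v (x + s *\<^sub>R u + t *\<^sub>R v)"
      using mixed_difference[OF f \<open>h > 0\<close>, where x=x and u=u and v=v] S unfolding D_def by blast
    have S': "x + s *\<^sub>R v + t *\<^sub>R u \<in> S" if "0 \<le> s" "s \<le> h" "0 \<le> t" "t \<le> h" for s t
      using S[OF that(3,4,1,2)] by (simp add: algebra_simps)
    obtain s' t' where st': "0 < s'" "s' < h" "0 < t'" "t' < h"
      "f (x + h *\<^sub>R v + h *\<^sub>R u) - f (x + h *\<^sub>R v) - (f (x + h *\<^sub>R u) - f x) = h * h * D v u (x + s' *\<^sub>R v + t' *\<^sub>R u)"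
      using mixed_difference[OF f \<open>h > 0\<close>, where x=x and u=v and v=u] S' unfolding D_def by blast
    have "h * h * D u v (x + s *\<^sub>R u + t *\<^sub>R v) = h * h * D v u (x + s' *\<^sub>R v + t' *\<^sub>R u)"
      unfolding st(5)[symmetric] st'(5)[symmetric] by (simp add: add_ac)
    then have "D u v (x + s *\<^sub>R u + t *\<^sub>R v) = D v u (x + t' *\<^sub>R u + s' *\<^sub>R v)"
      using \<open>h > 0\<close> by (simp add: add_ac)
    moreover have "\<bar>D u v (x + s *\<^sub>R u + t *\<^sub>R v) - D u v x\<bar> < e / 2"
      using near[of s t] S[of s t] st by (intro d) (auto simp: m_def)
    moreover have "\<bar>D v u (x + t' *\<^sub>R u + s' *\<^sub>R v) - D v u x\<bar> < e / 2"
      using near[of t' s'] S[of t' s'] st' by (intro d') (auto simp: m_def)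
    ultimately show ?thesis by linarith
  qed
  then have "\<bar>D u v x - D v u x\<bar> \<le> 0"
    by (meson dense_ge)
  then show ?thesis by (simp add: D_def)
qed

lemma frechet_derivative_linear_compose:
  assumes "bounded_linear h" "f differentiable (at x)"
  shows "fderiv (\<lambda>y. h (f y)) x v = h (fderiv f x v)"
  using frechet_derivative_at[OF bounded_linear.has_derivative[OF assms(1)
     assms(2)[unfolded frechet_derivative_works]]] by (simp add: fun_eq_iff)

lemma smooth_on_differentiable: "smooth_on f S \<Longrightarrow> x \<in> S \<Longrightarrow> f differentiable (at x)"
  using smooth_on_has_derivative differentiable_def by blast

lemma symmetric_second_derivative:
  fixes f :: "'a::real_normed_vector \<Rightarrow> 'b::euclidean_space"
  assumes f: "smooth_on f S" and S: "open S" "x \<in> S"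
  shows "fderiv (\<lambda>y. fderiv f y u) x v
    = fderiv (\<lambda>y. fderiv f y v) x u"
proof (rule euclidean_eqI)
  fix b :: 'b
  have "fderiv (\<lambda>y. fderiv f y u) x v \<bullet> b
      = fderiv (\<lambda>y. fderiv (\<lambda>y. f y \<bullet> b) y u) x v" for u v
  proof -
    have "fderiv (\<lambda>y. fderiv (\<lambda>y. f y \<bullet> b) y u) x
      = fderiv (\<lambda>y. fderiv f y u \<bullet> b) x"
      by (intro frechet_derivative_cong_open[OF S]
          frechet_derivative_linear_compose[OF bounded_linear_inner_left] smooth_on_differentiable[OF f])
    then show ?thesis
      using frechet_derivative_linear_compose[OF bounded_linear_inner_left
          smooth_on_differentiable[OF smooth_on_frechet[OF f] S(2)]] by metis
  qed
  moreover have "smooth_on (\<lambda>y. f y \<bullet> b) S"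
    by (rule smooth_on_linear_compose[OF S(1) bounded_linear_inner_left f])
  ultimately show "fderiv (\<lambda>y. fderiv f y u) x v \<bullet> b
    = fderiv (\<lambda>y. fderiv f y v) x u \<bullet> b"
    using symmetric_second_derivative_real[OF _ S] by metis
qed

text \<open>Flatness of \<open>exp (- 1 / x)\<close> at \<open>0\<close>: the family below is closed under
  differentiation up to linear combinations.\<close>

definition flat :: "nat \<Rightarrow> real \<Rightarrow> real" where
  "flat n x = (if x > 0 then inverse x ^ n * exp (- inverse x) else 0)"

lemma flat_tendsto_0: "(flat n \<longlongrightarrow> 0) (at 0)"
proof -
  have "((\<lambda>x::real. inverse x ^ n / exp (inverse x)) \<longlongrightarrow> 0) (at_right 0)"
    by (rule filterlim_compose[OF tendsto_power_div_exp_0 filterlim_inverse_at_top_right])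
  moreover have "eventually (\<lambda>x::real. inverse x ^ n / exp (inverse x) = flat n x) (at_right 0)"
    using eventually_at_right_less[of "0::real"] by eventually_elim (simp add: flat_def exp_minus divide_inverse)
  ultimately have "(flat n \<longlongrightarrow> 0) (at_right 0)"
    using Lim_transform_eventually by blast
  moreover have "(flat n \<longlongrightarrow> 0) (at_left 0)"
  proof (rule Lim_transform_eventually[OF tendsto_const])
    show "eventually (\<lambda>x. 0 = flat n x) (at_left 0)"
      using eventually_at_left_real[of "-1" "0::real"] by (auto elim!: eventually_mono simp: flat_def)
  qed
  ultimately show ?thesis using filterlim_split_at by blast
qed

lemma flat_DERIV: "(flat n has_real_derivative flat (n + 2) x - real n * flat (n + 1) x) (at x)"
proof (cases x "0::real" rule: linorder_cases)
  case less
  have "(flat n has_real_derivative 0) (at x)"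
    by (rule has_field_derivative_transform_within_open[where S="{..<0}" and f="\<lambda>_. 0"])
      (use less in \<open>auto simp: flat_def\<close>)
  then show ?thesis using less by (simp add: flat_def)
next
  case equal
  \<comment> \<open>The difference quotient at 0 is the next member of the family, which tends to
    0.\<close>
  have "((\<lambda>h. flat n h / h) \<longlongrightarrow> 0) (at 0)"
  proof (rule Lim_transform_eventually[OF flat_tendsto_0[of "n + 1"]])
    show "eventually (\<lambda>x. flat (n + 1) x = flat n x / x) (at 0)"
      by (rule always_eventually) (auto simp: flat_def divide_inverse mult_ac)
  qed
  then have "(flat n has_real_derivative 0) (at 0)"
    unfolding DERIV_def by (simp add: flat_def)
  then show ?thesis using equal by (simp add: flat_def)
next
  case greater
  have "((\<lambda>x. inverse x ^ n * exp (- inverse x)) has_real_derivative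
      flat (n + 2) x - n * flat (n + 1) x) (at x)"
  proof (rule DERIV_cong)
    have "(inverse has_real_derivative - (inverse x * inverse x)) (at x)"
      using greater by (auto intro!: derivative_eq_intros simp: power2_eq_square)
    note * = this
    show "((\<lambda>x. inverse x ^ n * exp (- inverse x)) has_real_derivative
        (real n * (- (inverse x * inverse x) * inverse x ^ (n - Suc 0))) * exp (- inverse x)
        + (exp (- inverse x) * - (- (inverse x * inverse x))) * inverse x ^ n) (at x)"
      by (intro DERIV_mult DERIV_power DERIV_fun_exp DERIV_minus *)
    show "real n * (- (inverse x * inverse x) * inverse x ^ (n - Suc 0)) * exp (- inverse x)
        + (exp (- inverse x) * - (- (inverse x * inverse x))) * inverse x ^ n
      = flat (n + 2) x - n * flat (n + 1) x"
      using greater by (cases n) (simp_all add: flat_def power_add power2_eq_square algebra_simps)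
  qed
  then show ?thesis
    by (rule has_field_derivative_transform_within_open[where S="{0<..}"]) (use greater in \<open>auto simp: flat_def\<close>)
qed

lemma smooth_on_flat: "smooth_on (flat n) UNIV"
proof -
  have "Ck_on k (flat n) UNIV" for k n
  proof (induction k arbitrary: n)
    case 0
    then show ?case
      using DERIV_isCont[OF flat_DERIV] by (simp add: continuous_at_imp_continuous_on)
  next
    case (Suc k)
    show ?case
    proof (rule Ck_on_SucI)
      show "(flat n has_derivative (\<lambda>v. v * (flat (n + 2) x + (- real n) * flat (n + 1) x))) (at x)" for x
        using flat_DERIV[of n x, unfolded has_field_derivative_def]
        by (rule has_derivative_eq_rhs) (auto simp: fun_eq_iff)
      show "Ck_on k (\<lambda>x. v * (flat (n + 2) x + (- real n) * flat (n + 1) x)) UNIV" for v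
        by (rule Ck_on_bilinear[OF _ bounded_bilinear_mult Ck_on_const
              Ck_on_add[OF _ Suc Ck_on_bilinear[OF _ bounded_bilinear_mult Ck_on_const Suc]]]) simp_all
    qed simp
  qed
  then show ?thesis by (simp add: smooth_on_def)
qed

text \<open>The function is \<open>exp (- 1 / (r\<^sup>2 - \<bar>x - x0\<bar>\<^sup>2))\<close>
  inside a ball and zero outside; \<open>K\<close> is the closed ball.\<close>

lemma bump_function:
  fixes x0 :: "'a::euclidean_space"
  assumes "open S" "x0 \<in> S"
  obtains f :: "'a \<Rightarrow> real" and K where "smooth_on f UNIV" "\<And>x. f x \<ge> 0" "f x0 > 0"
    "compact K" "K \<subseteq> S" "\<And>x. x \<notin> K \<Longrightarrow> f x = 0"
proof -
  obtain r where "r > 0" and r: "cball x0 r \<subseteq> S"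
    using assms open_contains_cball by blast
  define f where "f x = flat 0 (r\<^sup>2 - (x - x0) \<bullet> (x - x0))" for x :: 'a
  have "smooth_on (\<lambda>x. r\<^sup>2 - (x - x0) \<bullet> (x - x0)) UNIV"
    by (rule smooth_on_diff[OF open_UNIV smooth_on_const smooth_on_inner[OF open_UNIV]];
        rule smooth_on_diff[OF open_UNIV smooth_on_linear[OF bounded_linear_ident] smooth_on_const])
  then have "smooth_on f UNIV"
    unfolding f_def by (rule smooth_on_compose[OF open_UNIV open_UNIV _ smooth_on_flat, rotated -1]) auto
  moreover have "f x \<ge> 0" for x by (simp add: f_def flat_def)
  moreover have "f x0 > 0" using \<open>r > 0\<close> by (simp add: f_def flat_def)
  moreover have "f x = 0" if "x \<notin> cball x0 r" for x
  proof -
    have "r < norm (x - x0)" using that by (simp add: dist_norm norm_minus_commute)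
    then have "r\<^sup>2 \<le> (x - x0) \<bullet> (x - x0)"
      using \<open>r > 0\<close> by (simp add: power2_norm_eq_inner[symmetric] power_mono)
    then show ?thesis by (simp add: f_def flat_def)
  qed
  ultimately show thesis using r compact_cball by (intro that[of f "cball x0 r"]) auto
qed

section \<open>Vector calculus in a chart\<close>

unbundle cross3_syntax

lemma bounded_bilinear_cross: "bounded_bilinear (\<times>)"
  using bilinear_cross bilinear_conv_bounded_bilinear by blast

lemmas smooth_on_cross = smooth_on_bilinear[OF _ bounded_bilinear_cross]

lemma frechet_derivative_bilinear:
  assumes "bounded_bilinear h" "f differentiable (at x)" "g differentiable (at x)"
  shows "fderiv (\<lambda>y. h (f y) (g y)) x v
    = h (f x) (fderiv g x v) + h (fderiv f x v) (g x)"
  using frechet_derivative_at[OF bounded_bilinear.FDERIV[OF assms(1)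
     assms(2,3)[unfolded frechet_derivative_works]]] by (simp add: fun_eq_iff)

lemmas frechet_derivative_inner = frechet_derivative_bilinear[OF bounded_bilinear_inner]
lemmas frechet_derivative_cross = frechet_derivative_bilinear[OF bounded_bilinear_cross]
lemmas frechet_derivative_scaleR = frechet_derivative_bilinear[OF bounded_bilinear_scaleR]

lemma frechet_derivative_add:
  assumes "f differentiable (at x)" "g differentiable (at x)"
  shows "fderiv (\<lambda>y. f y + g y) x v = fderiv f x v + fderiv g x v"
  using frechet_derivative_at[OF has_derivative_add[OF assms[unfolded frechet_derivative_works]]]
  by (simp add: fun_eq_iff)

text \<open>A covector field acts on vectors by the inner product; in these terms \<open>d\<close> is
  \<open>curl\<close> on 1-forms and \<open>dvg\<close> on 2-forms, the wedge product of 1-forms is the cross product,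
  \<open>\<iota>\<^sub>T\<close> of a 2-form is \<open>\<lambda>C. C \<times> T\<close>, and integrability of the kernel of \<open>w\<close> reads
  \<open>w \<bullet> curl w = 0\<close>.\<close>

definition grad :: "(real^3 \<Rightarrow> real) \<Rightarrow> real^3 \<Rightarrow> real^3" where
  "grad f x = (\<chi> i. fderiv f x (axis i 1))"

definition curl :: "(real^3 \<Rightarrow> real^3) \<Rightarrow> real^3 \<Rightarrow> real^3" where
  "curl F x = (\<Sum>i\<in>UNIV. axis i 1 \<times> fderiv F x (axis i 1))"

definition dvg :: "(real^3 \<Rightarrow> real^3) \<Rightarrow> real^3 \<Rightarrow> real" where
  "dvg F x = (\<Sum>i\<in>UNIV. axis i 1 \<bullet> fderiv F x (axis i 1))"

lemma smooth_on_grad: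
  assumes "open S" "smooth_on f S" shows "smooth_on (grad f) S"
  by (rule smooth_on_vec[OF assms(1)]) (simp add: grad_def smooth_on_frechet[OF assms(2)])

lemma smooth_on_curl:
  assumes "open S" "smooth_on F S" shows "smooth_on (curl F) S"
  unfolding curl_def
  by (intro smooth_on_sum smooth_on_cross smooth_on_const smooth_on_frechet assms)

lemma smooth_on_dvg:
  assumes "open S" "smooth_on F S" shows "smooth_on (dvg F) S"
  unfolding dvg_def
  by (intro smooth_on_sum smooth_on_inner smooth_on_const smooth_on_frechet assms)

lemma curl_cong:
  "open S \<Longrightarrow> x \<in> S \<Longrightarrow> (\<And>y. y \<in> S \<Longrightarrow> F y = G y) \<Longrightarrow> curl F x = curl G x"
  by (simp add: curl_def frechet_derivative_cong_open[of S x F G])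

lemma dvg_cong:
  "open S \<Longrightarrow> x \<in> S \<Longrightarrow> (\<And>y. y \<in> S \<Longrightarrow> F y = G y) \<Longrightarrow> dvg F x = dvg G x"
  by (simp add: dvg_def frechet_derivative_cong_open[of S x F G])

lemma linear_axis_expand:
  fixes L :: "real^'n \<Rightarrow> 'b::real_vector"
  assumes "linear L"
  shows "L v = (\<Sum>i\<in>UNIV. (v $ i) *\<^sub>R L (axis i 1))"
proof -
  have "v = (\<Sum>i\<in>UNIV. (v $ i) *\<^sub>R axis i 1)"
    by (auto simp: vec_eq_iff axis_def if_distrib cong: if_cong)
  then have "L v = L (\<Sum>i\<in>UNIV. (v $ i) *\<^sub>R axis i 1)" by simp
  then show ?thesis by (simp add: linear_sum[OF assms] linear_scale[OF assms])
qed

lemma linear_frechet_derivative_at: "f differentiable (at x) \<Longrightarrow> linear (fderiv f x)"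
  using frechet_derivative_works has_derivative_linear by blast

lemma grad_inner:
  assumes "f differentiable (at x)"
  shows "grad f x \<bullet> v = fderiv f x v"
  by (subst linear_axis_expand[OF linear_frechet_derivative_at[OF assms]]) (simp add: grad_def inner_vec_def mult.commute)

text \<open>This is dF (u, v), with a 2-form stored as the vector whose inner product with
  \<open>u \<times> v\<close> is its value. It links \<open>curl\<close> to the coordinate-free
  exterior derivative.\<close>

lemma curl_inner_cross:
  assumes "F differentiable (at x)"
  shows "curl F x \<bullet> (u \<times> v) = fderiv F x u \<bullet> v - fderiv F x v \<bullet> u"
proof -
  note L = linear_axis_expand[OF linear_frechet_derivative_at[OF assms]]
  show ?thesis
    by (subst L[of u], subst L[of v]) (simp add: curl_def cross3_simps axis_def)
qed

lemma curl_add: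
  assumes "F differentiable (at x)" "G differentiable (at x)"
  shows "curl (\<lambda>y. F y + G y) x = curl F x + curl G x"
  by (simp add: curl_def frechet_derivative_add[OF assms] cross_add_right sum.distrib)

lemma curl_scaleR:
  assumes "f differentiable (at x)" "F differentiable (at x)"
  shows "curl (\<lambda>y. f y *\<^sub>R F y) x = grad f x \<times> F x + f x *\<^sub>R curl F x"
  by (simp add: curl_def frechet_derivative_scaleR[OF assms] grad_def sum_3)
    (simp add: cross3_simps axis_def)

lemma curl_cmult:
  assumes "F differentiable (at x)"
  shows "curl (\<lambda>y. c *\<^sub>R F y) x = c *\<^sub>R curl F x"
  using curl_scaleR[OF _ assms, of "\<lambda>_. c"] by (simp add: grad_def zero_vec_def[symmetric])

lemma dvg_scaleR:
  assumes "f differentiable (at x)" "F differentiable (at x)"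
  shows "dvg (\<lambda>y. f y *\<^sub>R F y) x = grad f x \<bullet> F x + f x * dvg F x"
  by (simp add: dvg_def frechet_derivative_scaleR[OF assms] grad_def sum_3)
    (simp add: cross3_simps axis_def)

text \<open>The rule d (F \<and> G) = dF \<and> G - F \<and> dG for 1-forms.\<close>

lemma dvg_cross:
  assumes "F differentiable (at x)" "G differentiable (at x)"
  shows "dvg (\<lambda>y. F y \<times> G y) x = curl F x \<bullet> G x - F x \<bullet> curl G x"
  by (simp add: dvg_def curl_def frechet_derivative_cross[OF assms] sum_3)
    (simp add: cross3_simps axis_def)

lemma frechet_derivative_sum_cross:
  assumes "\<And>i. G i differentiable (at x)"
  shows "fderiv (\<lambda>y. \<Sum>i\<in>UNIV. axis i 1 \<times> G i y) x v
    = (\<Sum>i\<in>(UNIV :: 3 set). axis i 1 \<times> fderiv (G i) x v)"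
proof -
  have "((\<lambda>y. \<Sum>i\<in>(UNIV :: 3 set). axis i 1 \<times> G i y) has_derivative
      (\<lambda>v. \<Sum>i\<in>UNIV. axis i 1 \<times> fderiv (G i) x v)) (at x)"
    by (intro has_derivative_sum bounded_linear.has_derivative[OF bounded_bilinear.bounded_linear_right[OF bounded_bilinear_cross]]
        assms[unfolded frechet_derivative_works])
  from frechet_derivative_at[OF this] show ?thesis by (simp add: fun_eq_iff)
qed

lemma dvg_curl:
  assumes "open S" "x \<in> S" "smooth_on F S"
  shows "dvg (curl F) x = 0"
proof -
  have "fderiv (\<lambda>y. fderiv F y u) x v
    = fderiv (\<lambda>y. fderiv F y v) x u" for u v
    by (rule symmetric_second_derivative[OF assms(3,1,2)])
  note sym = this[of "axis 1 1" "axis 2 1"] this[of "axis 1 1" "axis 3 1"] this[of "axis 2 1" "axis 3 1"]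
  have "fderiv (curl F) x v = (\<Sum>i\<in>UNIV. axis i 1 \<times>
      fderiv (\<lambda>y. fderiv F y (axis i 1)) x v)" for v
    unfolding curl_def
    by (rule frechet_derivative_sum_cross) (rule smooth_on_differentiable[OF smooth_on_frechet[OF assms(3)] assms(2)])
  then show ?thesis
    unfolding dvg_def by (simp add: sum_3 sym) (simp add: cross3_simps axis_def)
qed

lemma curl_grad:
  assumes "open S" "x \<in> S" "smooth_on f S"
  shows "curl (grad f) x = 0"
proof -
  have g: "grad f differentiable (at x)"
    by (rule smooth_on_differentiable[OF smooth_on_grad[OF assms(1,3)] assms(2)])
  have "fderiv (grad f) x v $ i =
      fderiv (\<lambda>y. fderiv f y (axis i 1)) x v" for v i
    using frechet_derivative_linear_compose[OF bounded_linear_vec_nth[of i] g, of v]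
    by (simp add: grad_def)
  moreover have "fderiv (\<lambda>y. fderiv f y u) x v
    = fderiv (\<lambda>y. fderiv f y v) x u" for u v
    by (rule symmetric_second_derivative[OF assms(3,1,2)])
  ultimately have "fderiv (grad f) x (axis j 1) $ i = fderiv (grad f) x (axis i 1) $ j" for i j
    by metis
  note sym = this[of 1 2] this[of 1 3] this[of 2 3]
  show ?thesis
    unfolding curl_def by (simp add: sum_3 cross3_simps axis_def sym[unfolded axis_def])
qed

section \<open>Algebra of an integrable form and its transverse field\<close>

lemma cross_triple_expand: "a \<times> (b \<times> c) = (a \<bullet> c) *\<^sub>R b - (a \<bullet> b) *\<^sub>R c" for a b c :: "real^3"
  by (simp add: cross3_simps forall_3)

lemma inner_cross_rotate: "a \<bullet> (b \<times> c) = b \<bullet> (c \<times> a)" for a b c :: "real^3"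
  by (simp add: cross3_simps)

text \<open>A 2-form whose wedge product with \<omega> vanishes is divisible by \<omega>:
  contracting that wedge product with T, where \<omega> (T) = 1, exhibits the quotient.\<close>

lemma inner_eq_0_cross:
  fixes C o' T :: "real^3"
  assumes "o' \<bullet> T = 1" "o' \<bullet> C = 0"
  shows "C = o' \<times> (C \<times> T)"
  using assms by (simp add: cross_triple_expand)

text \<open>Here \<open>C\<close>, \<open>E\<close>, \<open>Z\<close>, \<open>A\<close> are the exterior derivatives of \<open>\<omega>\<close>, \<open>\<eta>\<close>,
  \<open>\<zeta> = \<iota>\<^sub>T d\<eta>\<close> and of the velocity \<open>a\<close> of \<open>\<omega>\<close>, and \<open>X\<close> is the velocity of \<open>T\<close>; the two last
  terms are \<open>- d(a \<and> \<zeta>)\<close>.\<close>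

lemma variation_identity:
  fixes o' T C e E z Z a X A :: "real^3"
  assumes "o' \<bullet> T = 1" "a \<bullet> T + o' \<bullet> X = 0" "z = E \<times> T" "o' \<bullet> C = 0" "E = o' \<times> z" "o' \<bullet> Z = C \<bullet> z"
  shows "(C \<times> X + A \<times> T) \<bullet> E = - (a \<bullet> (o' \<times> (Z \<times> T))) - A \<bullet> z + a \<bullet> Z"
proof -
  have "(C \<times> X) \<bullet> E = C \<bullet> (X \<times> E)"
    by (metis inner_commute inner_cross_rotate)
  also have "\<dots> = C \<bullet> (X \<times> (o' \<times> z))"
    using assms(5) by simp
  \<comment> \<open>The expansion also has a term with \<open>o' \<bullet> C\<close>, which
    integrability removes. So \<open>X\<close> enters through \<omega> (X) alone, and
    differentiating \<omega> (T) = 1 turns this into - a (T).\<close>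
  also have "\<dots> = - (X \<bullet> o') * (C \<bullet> z)"
    using assms(4) by (simp add: cross_triple_expand inner_diff_right inner_commute)
  also have "\<dots> = (a \<bullet> T) * (C \<bullet> z)"
    using assms(2) by (simp add: inner_commute minus_equation_iff[of "a \<bullet> T"] add_eq_0_iff)
  finally have 1: "(C \<times> X) \<bullet> E = (a \<bullet> T) * (C \<bullet> z)" .
  have 2: "(A \<times> T) \<bullet> E = - (A \<bullet> z)"
    using assms(3) by (metis inner_commute inner_cross_rotate cross_skew inner_minus_right)
  \<comment> \<open>\<open>Z \<times> T\<close> represents the third Lie derivative of \<omega>. The
    T-component here, of size \<open>C \<bullet> z\<close> by the last hypothesis, matches what the
    velocity of T left behind, so that velocity disappears from the final formula.\<close>
  have "o' \<times> (Z \<times> T) = Z - (C \<bullet> z) *\<^sub>R T"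
    using assms(1,6) by (simp add: cross_triple_expand)
  then have 3: "a \<bullet> (o' \<times> (Z \<times> T)) = a \<bullet> Z - (C \<bullet> z) * (a \<bullet> T)"
    by (simp add: inner_diff_right)
  show ?thesis
    by (simp add: inner_add_left 1 2 3)
qed

text \<open>Applying d to dF = G \<and> H gives 0 = dG \<and> H - G \<and> dH.\<close>

lemma dvg_zero_cross:
  assumes S: "open S" "x \<in> S" and "smooth_on F S" "smooth_on G S" "smooth_on H S"
    and eq: "\<And>y. y \<in> S \<Longrightarrow> curl F y = G y \<times> H y"
  shows "G x \<bullet> curl H x = curl G x \<bullet> H x"
proof -
  have "0 = dvg (curl F) x" using dvg_curl[OF S assms(3)] by simp
  also have "\<dots> = dvg (\<lambda>y. G y \<times> H y) x" by (rule dvg_cong[OF S eq])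
  also have "\<dots> = curl G x \<bullet> H x - G x \<bullet> curl H x"
    using smooth_on_differentiable[OF _ S(2)] assms by (intro dvg_cross) auto
  finally show ?thesis by simp
qed

text \<open>Two rounds of the same argument: a 2-form divisible by \<omega> is differentiated with d
  d = 0, which shows the next 2-form divisible by \<omega>. The first round yields d\<eta> =
  \<omega> \<and> \<zeta>; differentiating this once more yields the second identity.\<close>

lemma integrable_form_identities:
  assumes S: "open S" "x \<in> S" and sm: "smooth_on w S" "smooth_on T S"
    and wT: "\<And>y. y \<in> S \<Longrightarrow> w y \<bullet> T y = 1" and int: "\<And>y. y \<in> S \<Longrightarrow> w y \<bullet> curl w y = 0"
  defines "e \<equiv> \<lambda>y. curl w y \<times> T y"
  defines "z \<equiv> \<lambda>y. curl e y \<times> T y"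
  shows "curl e x = w x \<times> z x" "w x \<bullet> curl z x = curl w x \<bullet> z x"
proof -
  have sm': "smooth_on e S" "smooth_on z S"
    unfolding e_def z_def by (intro smooth_on_cross smooth_on_curl S sm)+
  have C: "curl w y = w y \<times> e y" if "y \<in> S" for y
    unfolding e_def by (rule inner_eq_0_cross[OF wT[OF that] int[OF that]])
  \<comment> \<open>\<omega> \<and> d\<eta> = d\<omega> \<and> \<eta>, and d\<omega> = \<omega>
    \<and> \<eta> makes the factor \<eta> occur twice.\<close>
  have "w y \<bullet> curl e y = 0" if "y \<in> S" for y
    using dvg_zero_cross[OF S(1) that sm(1) sm(1) sm'(1) C] C[OF that] by (simp add: dot_cross_self)
  then have E: "curl e y = w y \<times> z y" if "y \<in> S" for y
    unfolding z_def using inner_eq_0_cross[OF wT[OF that]] that by blast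
  show "curl e x = w x \<times> z x" by (rule E[OF S(2)])
  show "w x \<bullet> curl z x = curl w x \<bullet> z x"
    by (rule dvg_zero_cross[OF S sm'(1) sm(1) sm'(2) E])
qed

text \<open>Cartan's formula \<open>L_T w = \<iota>_T dw + d (w T)\<close>, whose last term vanishes
  because the pairing is constant. In components, the derivative of the constant pairing trades
  derivatives of T for derivatives of w.\<close>

lemma lie_derivative_eq_curl_cross:
  assumes S: "open S" "x \<in> S" and sm: "smooth_on (w c) S" "smooth_on (T c) S"
    and const: "\<And>y. y \<in> S \<Longrightarrow> w c y \<bullet> T c y = k"
  shows "lie_derivative T w c x = curl (w c) x \<times> T c x"
proof -
  have d: "w c differentiable (at x)" "T c differentiable (at x)"
    using sm S smooth_on_differentiable by blast+
  have "lie_derivative T w c x $ i = (curl (w c) x \<times> T c x) $ i" for i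
  proof -
    have "0 = fderiv (\<lambda>y. w c y \<bullet> T c y) x (axis i 1)"
      using frechet_derivative_cong_open[OF S const] by simp
    also have "\<dots> = w c x \<bullet> fderiv (T c) x (axis i 1) + fderiv (w c) x (axis i 1) \<bullet> T c x"
      by (rule frechet_derivative_inner[OF d])
    finally have 1: "w c x \<bullet> fderiv (T c) x (axis i 1) = - (fderiv (w c) x (axis i 1) \<bullet> T c x)"
      by simp
    have "(curl (w c) x \<times> T c x) $ i = (curl (w c) x \<times> T c x) \<bullet> axis i 1"
      by (simp add: cart_eq_inner_axis)
    also have "\<dots> = curl (w c) x \<bullet> (T c x \<times> axis i 1)"
      by (metis inner_commute inner_cross_rotate)
    also have "\<dots> = fderiv (w c) x (T c x) \<bullet> axis i 1 - fderiv (w c) x (axis i 1) \<bullet> T c x"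
      by (rule curl_inner_cross[OF d(1)])
    finally show ?thesis
      using frechet_derivative_linear_compose[OF bounded_linear_inner_left d(1)]
      by (simp add: lie_derivative_def lie_bracket_def 1)
  qed
  then show ?thesis by (simp add: vec_eq_iff)
qed

section \<open>Integrals with compact support\<close>

text \<open>The formula for functions with values in \<open>real^1\<close>, transported to real
  values through \<open>vec\<close>.\<close>

lemma integral_change_of_variables_real:
  fixes f :: "real^'m::{finite,wellorder} \<Rightarrow> real" and g :: "real^'m::_ \<Rightarrow> real^'m::_"
  assumes "S \<in> sets lebesgue" "\<And>x. x \<in> S \<Longrightarrow> (g has_derivative g' x) (at x within S)" "inj_on g S"
    and "f absolutely_integrable_on (g ` S)"
  shows "integral (g ` S) f = integral S (\<lambda>x. \<bar>det (matrix (g' x))\<bar> * f (g x))"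
proof -
  have f: "(\<lambda>x. vec (f x) :: real^1) absolutely_integrable_on (g ` S)"
    using assms(4) by (simp add: absolutely_integrable_on_1_iff)
  have "(\<lambda>x. \<bar>det (matrix (g' x))\<bar> *\<^sub>R (vec (f (g x)) :: real^1)) absolutely_integrable_on S"
    using absolutely_integrable_change_of_variables[OF assms(1-3), of "\<lambda>x. vec (f x) :: real^1"] f by simp
  then have "(\<lambda>x. \<bar>det (matrix (g' x))\<bar> * f (g x)) absolutely_integrable_on S"
    by (simp add: absolutely_integrable_on_1_iff)
  moreover have "integral (g ` S) (\<lambda>x. vec (f x) :: real^1) = integral S (\<lambda>x. \<bar>det (matrix (g' x))\<bar> *\<^sub>R vec (f (g x)))"
    by (rule integral_change_of_variables[OF assms(1-3) disjI1[OF f]])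
  ultimately show ?thesis
    using integral_on_1_eq[of "g ` S" "\<lambda>x. vec (f x) :: real^1"]
      integral_on_1_eq[of S "\<lambda>x. \<bar>det (matrix (g' x))\<bar> *\<^sub>R (vec (f (g x)) :: real^1)"]
    by (simp add: vec_eq_iff)
qed

lemma continuous_on_extend_by_zero:
  fixes f :: "'a::t2_space \<Rightarrow> 'b::real_normed_vector"
  assumes "open S" "continuous_on S f" "compact K" "\<And>x. x \<in> S - K \<Longrightarrow> f x = 0" "K \<subseteq> S"
  shows "continuous_on UNIV (\<lambda>x. if x \<in> S then f x else 0)"
proof -
  let ?f = "\<lambda>x. if x \<in> S then f x else 0"
  have "continuous_on S ?f"
    using assms(2) by (rule continuous_on_eq) simp
  moreover have "continuous_on (- K) ?f"
    by (rule continuous_on_eq[of _ "\<lambda>_. 0"]) (use assms(4) in auto)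
  ultimately have "continuous_on (S \<union> - K) ?f"
    by (rule continuous_on_open_Un[OF assms(1) open_Compl[OF compact_imp_closed[OF assms(3)]]])
  moreover have "S \<union> - K = UNIV" using assms(5) by auto
  ultimately show ?thesis by simp
qed

lemma integral_compact_support:
  fixes f :: "'a::euclidean_space \<Rightarrow> real"
  assumes "K \<subseteq> S" "\<And>x. x \<in> S - K \<Longrightarrow> f x = 0" "K \<subseteq> B"
  shows "integral S f = integral B (\<lambda>x. if x \<in> S then f x else 0)"
proof -
  have "(\<lambda>x. if x \<in> B then if x \<in> S then f x else 0 else 0) = (\<lambda>x. if x \<in> S then f x else 0)"
    using assms by (intro ext) (metis DiffI subsetD)
  then show ?thesis
    using integral_restrict_UNIV[of S f] integral_restrict_UNIV[of B "\<lambda>x. if x \<in> S then f x else 0"] by simp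
qed

lemma absolutely_integrable_compact_support:
  fixes f :: "'a::euclidean_space \<Rightarrow> real"
  assumes S: "open S" "continuous_on S f" "compact K" "K \<subseteq> S" "\<And>x. x \<in> S - K \<Longrightarrow> f x = 0"
  shows "f absolutely_integrable_on S"
proof -
  let ?f = "\<lambda>x. if x \<in> S then f x else 0"
  have c: "continuous_on UNIV ?f"
    using continuous_on_extend_by_zero[OF S(1-3,5,4)] by simp
  obtain a b where B: "K \<subseteq> cbox a b"
    using bounded_subset_cbox_symmetric[OF compact_imp_bounded[OF S(3)]] by metis
  have "?f absolutely_integrable_on cbox a b"
    by (rule absolutely_integrable_continuous[OF continuous_on_subset[OF c]]) simp
  then have "(\<lambda>x. if x \<in> cbox a b then ?f x else 0) absolutely_integrable_on UNIV"
    by (simp only: absolutely_integrable_restrict_UNIV)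
  also have "(\<lambda>x. if x \<in> cbox a b then ?f x else 0) = ?f"
    using B S(5) by (intro ext) (metis DiffI subsetD)
  finally show ?thesis
    by (simp only: absolutely_integrable_restrict_UNIV)
qed

lemmas integrable_compact_support =
  set_lebesgue_integral_eq_integral(1)[OF absolutely_integrable_compact_support]

lemma integral_pos_compact_support:
  fixes f :: "'a::euclidean_space \<Rightarrow> real"
  assumes S: "open S" "continuous_on S f" "compact K" "K \<subseteq> S" "\<And>x. x \<in> S - K \<Longrightarrow> f x = 0"
    and nonneg: "\<And>x. x \<in> S \<Longrightarrow> f x \<ge> 0" and x0: "x0 \<in> S" "f x0 > 0"
  shows "integral S f > 0"
proof -
  let ?f = "\<lambda>x. if x \<in> S then f x else 0"
  have c: "continuous_on UNIV ?f"
    using continuous_on_extend_by_zero[OF S(1-3,5,4)] by simp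
  \<comment> \<open>The unit ball around \<open>x0\<close> is included so that the box has nonempty
    interior and contains \<open>x0\<close>, as the criterion for a vanishing integral
    requires.\<close>
  obtain a where B: "K \<union> ball x0 1 \<subseteq> cbox (-a) a"
    using bounded_subset_cbox_symmetric[of "K \<union> ball x0 1"] compact_imp_bounded[OF S(3)] by auto
  have cB: "continuous_on (cbox (-a) a) ?f"
    by (rule continuous_on_subset[OF c]) simp
  have eq: "integral S f = integral (cbox (-a) a) ?f"
    using B S by (intro integral_compact_support[of K]) auto
  have "integral (cbox (-a) a) ?f \<ge> 0"
    using nonneg by (intro integral_nonneg integrable_continuous[OF cB]) auto
  moreover have "integral (cbox (-a) a) ?f \<noteq> 0"
  proof
    assume "integral (cbox (-a) a) ?f = 0"
    then have "(?f has_integral 0) (cbox (-a) a)"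
      using integrable_integral[OF integrable_continuous[OF cB]] by simp
    moreover have "ball x0 1 \<subseteq> interior (cbox (-a) a)"
      using B by (intro interior_maximal) auto
    then have "box (-a) a \<noteq> {}"
      using centre_in_ball[of x0 1] by (auto simp: interior_cbox)
    moreover have "x0 \<in> cbox (-a) a"
      using B centre_in_ball[of x0 1] by auto
    ultimately have "?f x0 = 0"
      using nonneg by (intro has_integral_0_cbox_imp_0[OF cB]) auto
    then show False using x0 by simp
  qed
  ultimately show ?thesis using eq by simp
qed

lemma has_vector_derivative_slice:
  fixes F :: "real \<Rightarrow> 'a::real_normed_vector \<Rightarrow> 'b::real_normed_vector"
  assumes "case_prod F differentiable (at (t, x))"
  shows "((\<lambda>t. F t x) has_vector_derivative fderiv (case_prod F) (t, x) (1, 0)) (at t)"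
proof -
  let ?D = "fderiv (case_prod F) (t, x)"
  have F: "(case_prod F has_derivative ?D) (at (t, x))"
    using assms by (simp add: frechet_derivative_works)
  have "((\<lambda>t. (t, x)) has_derivative (\<lambda>r. (r, 0))) (at t)"
    by (auto intro!: derivative_eq_intros)
  from has_derivative_compose[OF this F]
  have "((\<lambda>t. F t x) has_derivative (\<lambda>r. ?D (r, 0))) (at t)" by simp
  also have "(\<lambda>r. ?D (r, 0)) = (\<lambda>r. r *\<^sub>R ?D (1, 0))"
  proof
    fix r
    have "?D (r *\<^sub>R (1, 0)) = r *\<^sub>R ?D (1, 0)"
      by (rule linear_scale[OF has_derivative_linear[OF F]])
    moreover have "r *\<^sub>R (1, 0 :: 'a) = (r, 0)" by simp
    ultimately show "?D (r, 0) = r *\<^sub>R ?D (1, 0)" by metis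
  qed
  finally show ?thesis by (simp add: has_vector_derivative_def)
qed

text \<open>A compact set containing the supports for all \<open>t\<close> reduces differentiation
  under the integral over the open set \<open>S\<close> to the Leibniz rule on a fixed box, after
  extension by zero.\<close>

lemma has_real_derivative_integral_compact_support:
  fixes F :: "real \<Rightarrow> 'a::euclidean_space \<Rightarrow> real"
  assumes "\<epsilon> > 0" and S: "open S" "compact K" "K \<subseteq> S"
    and sm: "smooth_on (\<lambda>(t, x). F t x) (Sigma {-\<epsilon><..<\<epsilon>} (\<lambda>_. S))"
    and zero: "\<And>t x. \<bar>t\<bar> < \<epsilon> \<Longrightarrow> x \<in> S - K \<Longrightarrow> F t x = 0"
  shows "((\<lambda>t. integral S (F t)) has_real_derivative
    integral S (\<lambda>x. fderiv (\<lambda>(t, x). F t x) (0, x) (1, 0))) (at 0)"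
proof -
  define U where "U = {-\<epsilon><..<\<epsilon>}"
  define D where "D t x = (if x \<in> S then fderiv (\<lambda>(t, x). F t x) (t, x) (1, 0) else 0)" for t x
  define F0 where "F0 t x = (if x \<in> S then F t x else 0)" for t x
  have U: "0 \<in> U" "convex U" "open U" using \<open>\<epsilon> > 0\<close> by (auto simp: U_def)
  have sm: "smooth_on (\<lambda>(t, x). F t x) (Sigma U (\<lambda>_. S))"
    using sm unfolding U_def .
  have D: "((\<lambda>t. F0 t x) has_real_derivative D t x) (at t)" if "t \<in> U" for t x
  proof (cases "x \<in> S")
    case True
    have "case_prod F differentiable (at (t, x))"
      by (rule smooth_on_differentiable[OF sm]) (use True that in auto)
    from has_vector_derivative_slice[OF this] show ?thesis
      using True by (simp add: D_def F0_def has_real_derivative_iff_has_vector_derivative)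
  qed (simp add: D_def F0_def)
  \<comment> \<open>On \<open>S - K\<close> the time derivative vanishes because the function is
    zero for all \<open>t\<close>. Thus \<open>D\<close> is continuous on two open sets, over
    \<open>S\<close> and over the complement of \<open>K\<close>, which together cover
    everything.\<close>
  have D0: "D t x = 0" if "t \<in> U" "x \<notin> K" for t x
  proof -
    have "((\<lambda>t. F0 t x) has_real_derivative 0) (at t)"
      by (rule has_field_derivative_transform_within_open[OF DERIV_const U(3) that(1)])
        (use zero that in \<open>auto simp: F0_def U_def\<close>)
    then show ?thesis using D[OF that(1)] DERIV_unique by blast
  qed
  obtain a b where B: "K \<subseteq> cbox a b"
    using bounded_subset_cbox_symmetric[OF compact_imp_bounded[OF S(2)]] by metis
  have cont: "continuous_on (Sigma U (\<lambda>_. UNIV)) (\<lambda>(t, x). D t x)"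
  proof -
    have "continuous_on (Sigma U (\<lambda>_. S)) (\<lambda>(t, x). D t x)"
      by (rule continuous_on_eq[OF smooth_on_imp_continuous_on[OF smooth_on_frechet[OF sm, of "(1, 0)"]]])
        (auto simp: D_def)
    moreover have "continuous_on (Sigma U (\<lambda>_. - K)) (\<lambda>(t, x). D t x)"
      by (rule continuous_on_eq[OF continuous_on_const[of _ 0]]) (use D0 in auto)
    ultimately have "continuous_on (Sigma U (\<lambda>_. S) \<union> Sigma U (\<lambda>_. - K)) (\<lambda>(t, x). D t x)"
      using U S by (intro continuous_on_open_Un open_Times open_Compl compact_imp_closed)
    moreover have "Sigma U (\<lambda>_. S) \<union> Sigma U (\<lambda>_. - K) = Sigma U (\<lambda>_. UNIV)"
      using S(3) by auto
    ultimately show ?thesis by simp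
  qed
  have contF: "continuous_on S (F t)" if "t \<in> U" for t
  proof -
    have "continuous_on S (\<lambda>x. (\<lambda>(t, x). F t x) (t, x))"
      by (rule continuous_on_compose2[OF smooth_on_imp_continuous_on[OF sm]])
        (use that in \<open>auto intro!: continuous_intros\<close>)
    then show ?thesis by simp
  qed
  have "((\<lambda>t. integral (cbox a b) (F0 t)) has_field_derivative integral (cbox a b) (D 0)) (at 0 within U)"
  proof (rule leibniz_rule_field_derivative[OF _ _ _ U(1,2)])
    show "((\<lambda>t. F0 t x) has_field_derivative D t x) (at t within U)" if "t \<in> U" for t x
      using D[OF that] by (rule has_field_derivative_at_within)
    show "F0 t integrable_on cbox a b" if "t \<in> U" for t
    proof (rule integrable_continuous, rule continuous_on_subset[OF _ subset_UNIV])
      show "continuous_on UNIV (F0 t)"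
        unfolding F0_def using zero that S
        by (intro continuous_on_extend_by_zero[of S _ K] contF) (auto simp: U_def)
    qed
    show "continuous_on (Sigma U (\<lambda>_. cbox a b)) (\<lambda>(t, x). D t x)"
      by (rule continuous_on_subset[OF cont]) auto
  qed
  then have "((\<lambda>t. integral (cbox a b) (F0 t)) has_real_derivative integral (cbox a b) (D 0)) (at 0)"
    using at_within_open[OF U(1,3)] by simp
  moreover have "integral (cbox a b) (D 0) = integral S (\<lambda>x. fderiv (\<lambda>(t, x). F t x) (0, x) (1, 0))"
  proof -
    have "fderiv (\<lambda>(t, x). F t x) (0, x) (1, 0) = 0" if "x \<in> S - K" for x
      using D0[OF U(1), of x] that unfolding D_def by (metis DiffE)
    then show ?thesis
      unfolding D_def using S B by (intro integral_compact_support[of K, symmetric]) auto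
  qed
  moreover have "integral (cbox a b) (F0 t) = integral S (F t)" if "t \<in> U" for t
    unfolding F0_def using zero that S B
    by (intro integral_compact_support[of K, symmetric]) (auto simp: U_def)
  ultimately have "((\<lambda>t. integral (cbox a b) (F0 t)) has_real_derivative
      integral S (\<lambda>x. fderiv (\<lambda>(t, x). F t x) (0, x) (1, 0))) (at 0)"
    and eq: "\<And>t. t \<in> U \<Longrightarrow> integral (cbox a b) (F0 t) = integral S (F t)"
    by simp_all
  then show ?thesis
    by (rule has_field_derivative_transform_within_open[OF _ U(3,1)])
qed

lemma smooth_on_extend_by_zero:
  fixes f :: "'a::real_normed_vector \<Rightarrow> 'b::real_normed_vector"
  assumes "open S" "smooth_on f S" "compact K" "K \<subseteq> S" "\<And>x. x \<in> S - K \<Longrightarrow> f x = 0"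
  shows "smooth_on (\<lambda>x. if x \<in> S then f x else 0) UNIV"
proof (rule smooth_on_local[OF open_UNIV])
  let ?f = "\<lambda>x. if x \<in> S then f x else 0"
  fix x :: 'a
  have "smooth_on ?f S"
    by (rule iffD2[OF smooth_on_cong[OF assms(1)] assms(2)]) simp
  moreover have K: "open (- K)"
    by (rule open_Compl[OF compact_imp_closed[OF assms(3)]])
  moreover have "smooth_on ?f (- K)"
    by (rule iffD2[OF smooth_on_cong[OF K] smooth_on_const[of 0]]) (use assms in auto)
  ultimately show "\<exists>U. open U \<and> x \<in> U \<and> smooth_on ?f U"
    using assms(1,4) by blast
qed

text \<open>The integral of the translate \<open>f (x + t *\<^sub>R v)\<close> does not depend on
  \<open>t\<close>; its derivative at 0 is the integral in question.\<close>

lemma integral_directional_derivative_eq_0: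
  fixes f :: "real^'m::{finite,wellorder} \<Rightarrow> real"
  assumes "smooth_on f UNIV" "compact K" "\<And>x. x \<notin> K \<Longrightarrow> f x = 0"
  shows "integral UNIV (\<lambda>x. fderiv f x v) = 0"
proof -
  let ?F = "\<lambda>t x. f (x + t *\<^sub>R v)"
  \<comment> \<open>Contains the supports of all translates with
    \<open>\<bar>t\<bar> \<le> 1\<close>, as needed for differentiating under the integral.\<close>
  define K' where "K' = (\<lambda>(t, x). x - t *\<^sub>R v) ` (Sigma {-1..1} (\<lambda>_. K))"
  have "compact K'"
    unfolding K'_def
    by (intro compact_continuous_image compact_Times assms(2)) (auto intro!: continuous_intros simp: split_beta)
  have lin: "bounded_linear (\<lambda>(t, x). x + t *\<^sub>R v)"
    unfolding split_beta
    by (intro bounded_linear_add bounded_linear_snd bounded_linear_compose[OF bounded_linear_scaleR_left] bounded_linear_fst)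
  have smF: "smooth_on (\<lambda>p. f ((\<lambda>(t, x). x + t *\<^sub>R v) p)) UNIV"
    by (rule smooth_on_compose[OF open_UNIV open_UNIV subset_UNIV assms(1) smooth_on_linear[OF lin]])
  then have smF: "smooth_on (\<lambda>(t, x). ?F t x) UNIV"
    by (simp add: case_prod_unfold)
  have "((\<lambda>t. integral UNIV (?F t)) has_real_derivative
      integral UNIV (\<lambda>x. fderiv (\<lambda>(t, x). ?F t x) (0, x) (1, 0))) (at 0)"
  proof (rule has_real_derivative_integral_compact_support[of 1 UNIV K'])
    show "f (x + t *\<^sub>R v) = 0" if "\<bar>t\<bar> < 1" "x \<in> UNIV - K'" for t x
    proof (rule assms(3))
      show "x + t *\<^sub>R v \<notin> K"
      proof
        assume "x + t *\<^sub>R v \<in> K"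
        then have "(\<lambda>(t, x). x - t *\<^sub>R v) (t, x + t *\<^sub>R v) \<in> K'"
          unfolding K'_def using that(1) by (intro imageI) auto
        then show False using that(2) by simp
      qed
    qed
  qed (auto intro: \<open>compact K'\<close> smooth_on_subset[OF smF])
  moreover have "fderiv (\<lambda>(t, x). ?F t x) (0, x) (1, 0) = fderiv f x v" for x
  proof -
    have "((\<lambda>(t, x). x + t *\<^sub>R v) has_derivative (\<lambda>(t, x). x + t *\<^sub>R v)) (at (0, x))"
      by (rule bounded_linear_imp_has_derivative[OF lin])
    moreover have "(f has_derivative fderiv f x) (at ((\<lambda>(t, x). x + t *\<^sub>R v) (0, x)))"
      using smooth_on_has_derivative[OF assms(1), of x] by simp
    ultimately have "((\<lambda>p. f ((\<lambda>(t, x). x + t *\<^sub>R v) p)) has_derivative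
        (\<lambda>p. fderiv f x ((\<lambda>(t, x). x + t *\<^sub>R v) p))) (at (0, x))"
      by (rule has_derivative_compose)
    from fun_cong[OF frechet_derivative_at[OF this], of "(1, 0)"] show ?thesis
      by (simp add: case_prod_unfold)
  qed
  moreover have "integral UNIV (?F t) = integral UNIV f" for t
  proof -
    have "f absolutely_integrable_on UNIV"
      using assms smooth_on_imp_continuous_on
      by (intro absolutely_integrable_compact_support[of UNIV f K]) auto
    moreover have "range (\<lambda>x. x + t *\<^sub>R v) = UNIV"
      by (rule surjI[of _ "\<lambda>x. x - t *\<^sub>R v"]) simp
    moreover have "((\<lambda>x. x + t *\<^sub>R v) has_derivative (\<lambda>h. h)) (at x within UNIV)" for x
      by (auto intro!: derivative_eq_intros)
    ultimately show ?thesis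
      using integral_change_of_variables_real[of UNIV "\<lambda>x. x + t *\<^sub>R v" "\<lambda>_ h. h" f]
      by (simp add: inj_on_def matrix_id_mat_1[unfolded id_def])
  qed
  ultimately show ?thesis
    using DERIV_unique[OF _ DERIV_const] by auto
qed

lemma dvg_eq_sum: 
  assumes "F differentiable (at x)"
  shows "dvg F x = (\<Sum>i\<in>UNIV. fderiv (\<lambda>y. F y $ i) x (axis i 1))"
  using frechet_derivative_linear_compose[OF bounded_linear_vec_nth assms]
  by (simp add: dvg_def inner_axis' )

text \<open>Each partial derivative of the extension by zero integrates to zero; there is no
  boundary term.\<close>

lemma integral_dvg_eq_0:
  assumes "open S" "smooth_on F S" "compact K" "K \<subseteq> S" "\<And>x. x \<in> S - K \<Longrightarrow> F x = 0"
  shows "integral S (dvg F) = 0"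
proof -
  define G where "G x = (if x \<in> S then F x else 0)" for x
  have G: "smooth_on G UNIV"
    unfolding G_def by (rule smooth_on_extend_by_zero[OF assms])
  have K: "open (- K)"
    by (rule open_Compl[OF compact_imp_closed[OF assms(3)]])
  have "fderiv G x = (\<lambda>_. 0)" if "x \<notin> K" for x
    using frechet_derivative_cong_open[OF K, of x G "\<lambda>_. 0"] that assms(4,5) by (auto simp: G_def)
  then have 0: "dvg G x = 0" if "x \<notin> K" for x
    using that by (simp add: dvg_def)
  have "dvg F x = dvg G x" if "x \<in> S" for x
    by (rule dvg_cong[OF assms(1) that]) (simp add: G_def)
  then have "(\<lambda>x. if x \<in> S then dvg F x else 0) = dvg G"
    using 0 assms(4) by (auto simp: fun_eq_iff)
  then have "integral S (dvg F) = integral UNIV (dvg G)"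
    using integral_restrict_UNIV[of S "dvg F"] by simp
  also have "\<dots> = integral UNIV (\<lambda>x. \<Sum>i\<in>UNIV. fderiv (\<lambda>y. G y $ i) x (axis i 1))"
    by (rule arg_cong[where f="integral UNIV"], rule ext, rule dvg_eq_sum[OF smooth_on_differentiable[OF G UNIV_I]])
  also have "\<dots> = (\<Sum>i\<in>UNIV. integral UNIV (\<lambda>x. fderiv (\<lambda>y. G y $ i) x (axis i 1)))"
  proof (rule integral_sum)
    fix i :: 3
    have "smooth_on (\<lambda>y. G y $ i) UNIV"
      by (rule smooth_on_linear_compose[OF open_UNIV bounded_linear_vec_nth G])
    note sm = smooth_on_imp_continuous_on[OF smooth_on_frechet[OF this]]
    have "fderiv (\<lambda>y. G y $ i) x v = 0" if "x \<notin> K" for x v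
      using frechet_derivative_linear_compose[OF bounded_linear_vec_nth smooth_on_differentiable[OF G UNIV_I], of i x v]
        \<open>\<And>x. x \<notin> K \<Longrightarrow> fderiv G x = (\<lambda>_. 0)\<close>[OF that] by simp
    then show "(\<lambda>x. fderiv (\<lambda>y. G y $ i) x (axis i 1)) integrable_on UNIV"
      using sm assms(3) by (intro integrable_compact_support[of UNIV _ K]) auto
  qed simp
  also have "\<dots> = 0"
  proof (rule sum.neutral, rule ballI)
    fix i :: 3
    show "integral UNIV (\<lambda>x. fderiv (\<lambda>y. G y $ i) x (axis i 1)) = 0"
      using assms(4,5)
      by (intro integral_directional_derivative_eq_0[of _ K] assms(3)
          smooth_on_linear_compose[OF open_UNIV bounded_linear_vec_nth G]) (auto simp: G_def)
  qed
  finally show ?thesis .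
qed

section \<open>Charts and partitions of unity\<close>

lemma det_matrix_triple:
  fixes L :: "real^3 \<Rightarrow> real^3"
  shows "det (matrix L) = L (axis 1 1) \<bullet> (L (axis 2 1) \<times> L (axis 3 1))"
  by (simp add: matrix_def det_3 cross3_simps)

text \<open>Pull-back of a 3-form multiplies its coefficient by the determinant, here for the wedge
  product of the 1-form \<open>a\<close> and the 2-form stored as \<open>W\<close>.\<close>

lemma one_form_two_form_change:
  fixes L :: "real^3 \<Rightarrow> real^3"
  assumes a: "\<And>v. a \<bullet> v = a' \<bullet> L v" and W: "\<And>u v. W \<bullet> (u \<times> v) = W' \<bullet> (L u \<times> L v)"
  shows "a \<bullet> W = det (matrix L) * (a' \<bullet> W')"
proof -
  have "a \<bullet> W = (a \<bullet> axis 1 1) * (W \<bullet> (axis 2 1 \<times> axis 3 1)) + (a \<bullet> axis 2 1) * (W \<bullet> (axis 3 1 \<times> axis 1 1))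
      + (a \<bullet> axis 3 1) * (W \<bullet> (axis 1 1 \<times> axis 2 1))"
    by (simp add: cross3_simps axis_def)
  also have "\<dots> = (L (axis 1 1) \<bullet> (L (axis 2 1) \<times> L (axis 3 1))) * (a' \<bullet> W')"
    unfolding a W by (simp add: cross3_simps)
  finally show ?thesis by (simp add: det_matrix_triple)
qed

lemma one_forms_cross_change:
  fixes L :: "real^3 \<Rightarrow> real^3"
  assumes "\<And>v. a \<bullet> v = a' \<bullet> L v" "\<And>v. b \<bullet> v = b' \<bullet> L v"
  shows "(a \<times> b) \<bullet> (u \<times> v) = (a' \<times> b') \<bullet> (L u \<times> L v)"
proof -
  have "(a \<times> b) \<bullet> (u \<times> v) = (a \<bullet> u) * (b \<bullet> v) - (a \<bullet> v) * (b \<bullet> u)" for a b u v :: "real^3"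
    by (simp add: cross3_simps)
  then show ?thesis by (simp add: assms)
qed

locale closed_manifold =
  fixes A :: "'a::t2_space chart set"
  assumes manifold: "closed_oriented_3manifold A"
begin

lemma compact_space: "compact (UNIV :: 'a set)"
  using manifold by (simp add: closed_oriented_3manifold_def)

lemma closed_imp_compact: "closed K \<Longrightarrow> compact (K :: 'a set)"
  using closed_Int_compact[OF _ compact_space] by simp

lemma charts_cover: "\<exists>c\<in>A. p \<in> fst c"
  using manifold by (auto simp: closed_oriented_3manifold_def)

context
  fixes c assumes c: "c \<in> A"
begin

lemma chartD: "open (fst c)" "open (chart_img c)"
    "homeomorphism (fst c) (chart_img c) (snd c) (chart_inv c)"
  using c manifold by (auto simp: closed_oriented_3manifold_def is_chart_def)

lemma chart_inv_inverse: "p \<in> fst c \<Longrightarrow> chart_inv c (snd c p) = p"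
  and chart_inverse: "x \<in> chart_img c \<Longrightarrow> snd c (chart_inv c x) = x"
  and chart_inv_in: "x \<in> chart_img c \<Longrightarrow> chart_inv c x \<in> fst c"
  and chart_in: "p \<in> fst c \<Longrightarrow> snd c p \<in> chart_img c"
  and continuous_on_chart: "continuous_on (fst c) (snd c)"
  and continuous_on_chart_inv: "continuous_on (chart_img c) (chart_inv c)"
  using chartD(3) by (auto simp: homeomorphism_def)

lemma in_overlap_iff: "x \<in> overlap c d \<longleftrightarrow> x \<in> chart_img c \<and> chart_inv c x \<in> fst d"
proof
  assume "x \<in> overlap c d"
  then obtain p where "p \<in> fst c" "p \<in> fst d" "x = snd c p"
    by (auto simp: overlap_def)
  then show "x \<in> chart_img c \<and> chart_inv c x \<in> fst d"
    using chart_in chart_inv_inverse by simp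
next
  assume "x \<in> chart_img c \<and> chart_inv c x \<in> fst d"
  then show "x \<in> overlap c d"
    unfolding overlap_def using chart_inv_in chart_inverse by (intro image_eqI[of _ _ "chart_inv c x"]) auto
qed

lemma open_chart_preimage: "open W \<Longrightarrow> open {x \<in> chart_img c. chart_inv c x \<in> W}"
  using continuous_open_preimage[OF continuous_on_chart_inv chartD(2)] by (simp add: vimage_def Int_def)

lemma compact_chart_image:
  assumes "closed K" "K \<subseteq> fst c"
  shows "compact (snd c ` K)" "snd c ` K \<subseteq> chart_img c"
  using compact_continuous_image[OF continuous_on_subset[OF continuous_on_chart assms(2)] closed_imp_compact[OF assms(1)]]
    chart_in assms(2) by auto

end

lemma open_overlap: "c \<in> A \<Longrightarrow> d \<in> A \<Longrightarrow> open (overlap c d)"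
  using open_chart_preimage[OF _ chartD(1), of c d] in_overlap_iff[of c _ d, symmetric] by simp

lemma overlap_subset: "c \<in> A \<Longrightarrow> overlap c d \<subseteq> chart_img c"
  using in_overlap_iff[of c _ d] by blast

lemma overlap_self: "c \<in> A \<Longrightarrow> overlap c c = chart_img c"
  using in_overlap_iff[of c _ c] chart_inv_in[of c] by blast

context
  fixes c d x assumes c: "c \<in> A" and d: "d \<in> A" and x: "x \<in> overlap c d"
begin

lemma chart_inv_transition: "chart_inv d (transition c d x) = chart_inv c x"
  using x in_overlap_iff[OF c] chart_inv_inverse[OF d] by (simp add: transition_def)

lemma transition_in_overlap: "transition c d x \<in> overlap d c"
  using x chart_inv_transition in_overlap_iff[OF c] in_overlap_iff[OF d] chart_inv_in[OF c] chart_in[OF d]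
  by (simp add: transition_def)

lemma transition_in: "transition c d x \<in> chart_img d"
  using transition_in_overlap overlap_subset[OF d] by blast

lemma transition_inverse: "transition d c (transition c d x) = x"
  using x chart_inv_transition in_overlap_iff[OF c] chart_inverse[OF c] by (simp add: transition_def[of d c])

lemma transition_det: "det (matrix (Dtransition c d x)) > 0"
  using c d x manifold by (auto simp: closed_oriented_3manifold_def)

end

lemma smooth_on_transition: "c \<in> A \<Longrightarrow> d \<in> A \<Longrightarrow> smooth_on (transition c d) (overlap c d)"
  using manifold by (auto simp: closed_oriented_3manifold_def)

lemma Dtransition_has_derivative:
  "c \<in> A \<Longrightarrow> d \<in> A \<Longrightarrow> x \<in> overlap c d \<Longrightarrow> (transition c d has_derivative Dtransition c d x) (at x)"
  using smooth_on_has_derivative smooth_on_transition by blast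

lemma transition_compose:
  assumes "c \<in> A" "d \<in> A" "x \<in> overlap c d" 
  shows "transition d e (transition c d x) = transition c e x"
  using chart_inv_transition[OF assms] by (simp add: transition_def)

lemma overlap_transition:
  assumes "c \<in> A" "d \<in> A" "x \<in> overlap c d" 
  shows "transition c d x \<in> overlap d e \<longleftrightarrow> x \<in> overlap c e"
  using assms chart_inv_transition[OF assms] transition_in[OF assms] in_overlap_iff by auto

lemma Dtransition_compose:
  assumes cde: "c \<in> A" "d \<in> A" "e \<in> A" and x: "x \<in> overlap c d" "x \<in> overlap c e"
  shows "Dtransition d e (transition c d x) (Dtransition c d x v) = Dtransition c e x v"
proof -
  have "((\<lambda>y. transition d e (transition c d y)) has_derivative
      (\<lambda>v. Dtransition d e (transition c d x) (Dtransition c d x v))) (at x)"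
    using x overlap_transition[OF cde(1,2)] cde
    by (intro has_derivative_compose[OF Dtransition_has_derivative Dtransition_has_derivative]) auto
  then have "(transition c e has_derivative
      (\<lambda>v. Dtransition d e (transition c d x) (Dtransition c d x v))) (at x)"
    by (rule iffD1[OF has_derivative_cong_open[OF open_overlap[OF cde(1,2)] x(1)], rotated])
      (rule transition_compose[OF cde(1,2)])
  from frechet_derivative_at[OF this] show ?thesis by (simp add: fun_eq_iff)
qed

lemma transition_self: "c \<in> A \<Longrightarrow> x \<in> chart_img c \<Longrightarrow> transition c c x = x"
  by (simp add: transition_def chart_inverse)

lemma Dtransition_self: "c \<in> A \<Longrightarrow> x \<in> chart_img c \<Longrightarrow> Dtransition c c x v = v"
  using frechet_derivative_cong_open[OF chartD(2), of c x "transition c c" "\<lambda>y. y"] transition_self by simp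

lemma transition_image: "c \<in> A \<Longrightarrow> d \<in> A \<Longrightarrow> transition c d ` overlap c d = overlap d c"
proof
  assume cd: "c \<in> A" "d \<in> A"
  then show "transition c d ` overlap c d \<subseteq> overlap d c"
    using transition_in_overlap by blast
  show "overlap d c \<subseteq> transition c d ` overlap c d"
    using transition_inverse[OF cd(2,1)] transition_in_overlap[OF cd(2,1)] by (metis imageI subsetI)
qed

lemma inj_on_transition: "c \<in> A \<Longrightarrow> d \<in> A \<Longrightarrow> inj_on (transition c d) (overlap c d)"
  by (rule inj_on_inverseI[of _ "transition d c"]) (rule transition_inverse)

lemma smooth_functionD: "smooth_function A g \<Longrightarrow> c \<in> A \<Longrightarrow> smooth_on (\<lambda>x. g (chart_inv c x)) (chart_img c)"
  by (simp add: smooth_function_def o_def)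

text \<open>Extension by zero from the overlap to all of chart \<open>d\<close>. Closedness of
  \<open>K\<close> in the whole manifold gives an open set of zeros which together with the overlap
  covers the chart, so nothing goes wrong at the edge of the overlap.\<close>

lemma smooth_on_cut_off:
  fixes f :: "real^3 \<Rightarrow> 'b::real_normed_vector"
  assumes cd: "c \<in> A" "d \<in> A" and K: "closed K" "K \<subseteq> fst c"
    and f: "smooth_on f (overlap d c)" and zero: "\<And>x. x \<in> overlap d c \<Longrightarrow> chart_inv d x \<notin> K \<Longrightarrow> f x = 0"
  shows "smooth_on (\<lambda>x. if x \<in> overlap d c then f x else 0) (chart_img d)"
proof (rule smooth_on_local[OF chartD(2)[OF cd(2)]])
  let ?f = "\<lambda>x. if x \<in> overlap d c then f x else 0"
  let ?U = "{x \<in> chart_img d. chart_inv d x \<in> - K}"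
  fix x assume x: "x \<in> chart_img d"
  have "smooth_on ?f (overlap d c)"
    by (rule iffD2[OF smooth_on_cong[OF open_overlap[OF cd(2,1)]] f]) simp
  moreover have U: "open ?U"
    by (rule open_chart_preimage[OF cd(2)]) (use K in auto)
  moreover have "smooth_on ?f ?U"
    by (rule iffD2[OF smooth_on_cong[OF U] smooth_on_const[of 0]]) (use zero in auto)
  moreover have "x \<in> overlap d c \<or> x \<in> ?U"
    using x K(2) in_overlap_iff[OF cd(2)] by auto
  ultimately show "\<exists>U. open U \<and> x \<in> U \<and> smooth_on ?f U"
    using open_overlap[OF cd(2,1)] by blast
qed

lemma bump_function_manifold:
  assumes c: "c \<in> A" "p \<in> fst c"
  obtains g where "smooth_function A g" "\<And>q. g q \<ge> 0" "g p > 0" "closure {q. g q \<noteq> 0} \<subseteq> fst c"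
proof -
  obtain f :: "real^3 \<Rightarrow> real" and K where f: "smooth_on f UNIV" "\<And>x. f x \<ge> 0" "f (snd c p) > 0"
    and K: "compact K" "K \<subseteq> chart_img c" "\<And>x. x \<notin> K \<Longrightarrow> f x = 0"
    using bump_function[OF chartD(2) chart_in, OF c(1) c] by metis
  define L where "L = chart_inv c ` K"
  \<comment> \<open>A compact set in a Hausdorff space is closed. Hence the support of the
    transported bump cannot reach beyond the domain of the chart, and the extension by zero is
    smooth everywhere.\<close>
  have L: "closed L" "L \<subseteq> fst c"
    unfolding L_def
    using compact_imp_closed[OF compact_continuous_image[OF continuous_on_subset[OF continuous_on_chart_inv[OF c(1)] K(2)] K(1)]]
      chart_inv_in[OF c(1)] K(2) by blast+
  define g where "g q = (if q \<in> fst c then f (snd c q) else 0)" for q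
  have supp: "{q. g q \<noteq> 0} \<subseteq> L"
  proof
    fix q assume "q \<in> {q. g q \<noteq> 0}"
    then have "q \<in> fst c" "snd c q \<in> K" using K(3) by (auto simp: g_def split: if_splits)
    then show "q \<in> L" unfolding L_def using chart_inv_inverse[OF c(1)] by force
  qed
  have "smooth_on (g \<circ> chart_inv d) (chart_img d)" if d: "d \<in> A" for d
  proof -
    have "smooth_on (\<lambda>x. if x \<in> overlap d c then f (transition d c x) else 0) (chart_img d)"
    proof (rule smooth_on_cut_off[OF c(1) d L])
      show "smooth_on (\<lambda>x. f (transition d c x)) (overlap d c)"
        by (rule smooth_on_compose[OF open_overlap[OF d c(1)] open_UNIV subset_UNIV f(1) smooth_on_transition[OF d c(1)]])
      show "f (transition d c x) = 0" if "x \<in> overlap d c" "chart_inv d x \<notin> L" for x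
      proof -
        have "chart_inv d x \<in> fst c" using that(1) in_overlap_iff[OF d] by simp
        moreover have "g (chart_inv d x) = 0" using supp that(2) by blast
        ultimately show ?thesis by (simp add: g_def transition_def)
      qed
    qed
    then show ?thesis
      by (rule iffD2[OF smooth_on_cong[OF chartD(2)[OF d]], rotated])
        (simp add: g_def in_overlap_iff[OF d] transition_def)
  qed
  moreover have "closure {q. g q \<noteq> 0} \<subseteq> fst c"
    using closure_minimal[OF supp L(1)] L(2) by blast
  ultimately show thesis
    using f(2,3) c by (intro that[of g]) (auto simp: smooth_function_def g_def)
qed

lemma smooth_function_continuous:
  assumes "smooth_function A g" shows "continuous_on UNIV g"
proof -
  have "isCont g p" for p
  proof -
    obtain c where c: "c \<in> A" "p \<in> fst c" using charts_cover by blast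
    have "continuous_on (fst c) (\<lambda>q. g (chart_inv c (snd c q)))"
      using chart_in[OF c(1)]
      by (intro continuous_on_compose2[OF smooth_on_imp_continuous_on[OF smooth_functionD[OF assms c(1)]] continuous_on_chart[OF c(1)]]) auto
    then have "continuous_on (fst c) g"
      by (rule continuous_on_eq) (simp add: chart_inv_inverse[OF c(1)])
    then show ?thesis
      using c(2) chartD(1)[OF c(1)] continuous_on_eq_continuous_at by blast
  qed
  then show ?thesis by (simp add: continuous_at_imp_continuous_on)
qed

text \<open>Gives meaning to the choice made in \<open>manifold_integral\<close>. Compactness
  selects finitely many bumps with a positive sum, by which they are then divided.\<close>

lemma partition_of_unity_exists: "\<exists>C \<rho>. partition_of_unity A C \<rho>"
proof -
  have "\<exists>c g. c \<in> A \<and> smooth_function A g \<and> (\<forall>q. g q \<ge> 0) \<and> g p > 0 \<and> closure {q. g q \<noteq> 0} \<subseteq> fst c" for p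
    using charts_cover[of p] bump_function_manifold[of _ p] by metis
  then obtain ch g where cg: "\<And>p. ch p \<in> A" "\<And>p. smooth_function A (g p)" "\<And>p q. g p q \<ge> 0"
      "\<And>p. g p p > (0::real)" "\<And>p. closure {q. g p q \<noteq> 0} \<subseteq> fst (ch p)"
    by metis
  have "\<exists>I. finite I \<and> (UNIV :: 'a set) \<subseteq> (\<Union>p\<in>I. {q. g p q > 0})"
  proof (rule compactE_image[OF compact_space, of UNIV "\<lambda>p. {q. g p q > 0}"])
    show "open {q. g p q > 0}" for p
      using open_Collect_less[OF continuous_on_const smooth_function_continuous[OF cg(2)]] by blast
    show "UNIV \<subseteq> (\<Union>p. {q. g p q > 0})" using cg(4) by auto
  qed auto
  then obtain I where I: "finite I" "\<And>q. \<exists>p\<in>I. g p q > 0" by blast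
  define h where "h q = (\<Sum>p\<in>I. g p q)" for q
  have h: "h q > 0" for q
    unfolding h_def using I cg(3) by (meson sum_pos2)
  define C where "C = ch ` I"
  \<comment> \<open>A partition is indexed by charts, but bumps around different points may share a
    chart; those are added up.\<close>
  define \<rho> where "\<rho> c q = (\<Sum>p\<in>{p\<in>I. ch p = c}. g p q) / h q" for c q
  have "smooth_function A (\<rho> c)" for c
    unfolding smooth_function_def
  proof
    fix d assume d: "d \<in> A"
    have "smooth_on (\<lambda>x. (\<Sum>p\<in>{p\<in>I. ch p = c}. g p (chart_inv d x)) / h (chart_inv d x)) (chart_img d)"
      using h[of "chart_inv d _"] unfolding h_def
      by (intro smooth_on_divide smooth_on_sum smooth_functionD[OF cg(2) d] chartD(2)[OF d]) (simp add: less_le)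
    then show "smooth_on (\<rho> c \<circ> chart_inv d) (chart_img d)"
      by (simp add: \<rho>_def o_def)
  qed
  moreover have "0 \<le> \<rho> c q" for c q
    unfolding \<rho>_def using h[of q] cg(3) by (intro divide_nonneg_nonneg sum_nonneg) auto
  moreover have "closure {q. \<rho> c q \<noteq> 0} \<subseteq> fst c" for c
  proof -
    have "{q. \<rho> c q \<noteq> 0} \<subseteq> (\<Union>p\<in>{p\<in>I. ch p = c}. closure {q. g p q \<noteq> 0})"
    proof
      fix q assume "q \<in> {q. \<rho> c q \<noteq> 0}"
      then have "(\<Sum>p\<in>{p\<in>I. ch p = c}. g p q) \<noteq> 0" by (auto simp: \<rho>_def)
      then obtain p where "p \<in> {p\<in>I. ch p = c}" "g p q \<noteq> 0"
        by (meson sum.not_neutral_contains_not_neutral)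
      then show "q \<in> (\<Union>p\<in>{p\<in>I. ch p = c}. closure {q. g p q \<noteq> 0})"
        using closure_subset[of "{q. g p q \<noteq> 0}"] by blast
    qed
    then have "closure {q. \<rho> c q \<noteq> 0} \<subseteq> (\<Union>p\<in>{p\<in>I. ch p = c}. closure {q. g p q \<noteq> 0})"
      by (rule closure_minimal) (use I in auto)
    then show ?thesis using cg(5) by fastforce
  qed
  moreover have "(\<Sum>c\<in>C. \<rho> c q) = 1" for q
  proof -
    have "(\<Sum>c\<in>C. \<Sum>p\<in>{p\<in>I. ch p = c}. g p q) = h q"
      unfolding C_def h_def by (rule sum.image_gen[OF I(1), symmetric])
    then show ?thesis
      using h[of q] by (simp add: \<rho>_def flip: sum_divide_distrib)
  qed
  ultimately have "partition_of_unity A C \<rho>"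
    using I cg(1) by (auto simp: partition_of_unity_def C_def)
  then show ?thesis by blast
qed

end

section \<open>Forms, densities and the theorem of Stokes\<close>

text \<open>In vector notation \<open>\<iota>_T dw\<close>. It agrees with \<open>L_T w\<close>
  whenever w (T) is constant, so its iterates on \<omega> are the iterated Lie derivatives.\<close>

definition iota_d :: "'a field \<Rightarrow> 'a field \<Rightarrow> 'a field" where
  "iota_d T w c x = curl (w c) x \<times> T c x"

lemma interior_product_ext_deriv:
  assumes "w c differentiable (at x)"
  shows "interior_product T (ext_deriv w) c x = iota_d T w c x"
proof -
  have "ext_deriv w c x (T c x) v = iota_d T w c x \<bullet> v" for v
    using curl_inner_cross[OF assms, of "T c x" v] inner_cross_rotate[of v "curl (w c) x" "T c x"]
      inner_cross_rotate[of "curl (w c) x" "T c x" v]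
    by (simp add: ext_deriv_def iota_d_def inner_commute)
  then show ?thesis
    by (simp add: interior_product_def vec_eq_iff flip: cart_eq_inner_axis)
qed

lemma wedge_ext_deriv:
  assumes "\<beta> c differentiable (at x)"
  shows "wedge \<alpha> (ext_deriv \<beta>) c x (axis 1 1) (axis 2 1) (axis 3 1) = \<alpha> c x \<bullet> curl (\<beta> c) x"
proof -
  have "ext_deriv \<beta> c x u v = curl (\<beta> c) x \<bullet> (u \<times> v)" for u v
    using curl_inner_cross[OF assms] by (simp add: ext_deriv_def)
  then show ?thesis
    by (simp add: wedge_def) (simp add: cross3_simps axis_def)
qed

context closed_manifold
begin

lemma one_formD:
  assumes "one_form A w"
  shows one_form_smooth: "c \<in> A \<Longrightarrow> smooth_on (w c) (chart_img c)"
    and one_form_change: "c \<in> A \<Longrightarrow> d \<in> A \<Longrightarrow> x \<in> overlap c d \<Longrightarrow>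
      w c x \<bullet> v = w d (transition c d x) \<bullet> Dtransition c d x v"
  using assms by (auto simp: one_form_def)

lemma vector_fieldD:
  assumes "vector_field A X"
  shows vector_field_smooth: "c \<in> A \<Longrightarrow> smooth_on (X c) (chart_img c)"
    and vector_field_change: "c \<in> A \<Longrightarrow> d \<in> A \<Longrightarrow> x \<in> overlap c d \<Longrightarrow>
      X d (transition c d x) = Dtransition c d x (X c x)"
  using assms by (auto simp: vector_field_def)

lemma one_form_differentiable:
  "one_form A w \<Longrightarrow> c \<in> A \<Longrightarrow> x \<in> chart_img c \<Longrightarrow> w c differentiable (at x)"
  using smooth_on_differentiable one_form_smooth by blast

text \<open>The exterior derivative commutes with pull-back: the second derivative of the transition
  map, being symmetric, drops out of the antisymmetrised expression.\<close>

lemma curl_change: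
  assumes w: "one_form A w" and cd: "c \<in> A" "d \<in> A" and x: "x \<in> overlap c d"
  shows "curl (w c) x \<bullet> (u \<times> v)
    = curl (w d) (transition c d x) \<bullet> (Dtransition c d x u \<times> Dtransition c d x v)"
proof -
  let ?\<phi> = "transition c d"
  note O = open_overlap[OF cd]
  have x': "x \<in> chart_img c" using x overlap_subset[OF cd(1)] by blast
  note wc = one_form_differentiable[OF w cd(1) x']
  note wd = one_form_differentiable[OF w cd(2) transition_in[OF cd x]]
  note \<phi> = Dtransition_has_derivative[OF cd x]
  have wd\<phi>: "((\<lambda>y. w d (?\<phi> y)) has_derivative
      (\<lambda>u. fderiv (w d) (?\<phi> x) (Dtransition c d x u))) (at x)"
    by (rule has_derivative_compose[OF \<phi> wd[unfolded frechet_derivative_works]])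
  define H where "H v u = fderiv (\<lambda>y. Dtransition c d y v) x u" for u v
  have H: "H v u = H u v" for u v
    unfolding H_def by (rule symmetric_second_derivative[OF smooth_on_transition[OF cd] O x])
  have eq: "fderiv (w c) x u \<bullet> v = w d (?\<phi> x) \<bullet> H v u
      + fderiv (w d) (?\<phi> x) (Dtransition c d x u) \<bullet> Dtransition c d x v" for u v
  proof -
    have "fderiv (w c) x u \<bullet> v = fderiv (\<lambda>y. w c y \<bullet> v) x u"
      by (rule frechet_derivative_linear_compose[OF bounded_linear_inner_left wc, symmetric])
    also have "\<dots> = fderiv (\<lambda>y. w d (?\<phi> y) \<bullet> Dtransition c d y v) x u"
      using frechet_derivative_cong_open[OF O x one_form_change[OF w cd]] by simp
    also have "\<dots> = w d (?\<phi> x) \<bullet> H v u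
      + fderiv (\<lambda>y. w d (?\<phi> y)) x u \<bullet> Dtransition c d x v"
      unfolding H_def
      by (rule frechet_derivative_inner[OF differentiableI[OF wd\<phi>]
            smooth_on_differentiable[OF smooth_on_frechet[OF smooth_on_transition[OF cd]] x]])
    finally show ?thesis
      using frechet_derivative_at[OF wd\<phi>] by (simp add: fun_eq_iff)
  qed
  show ?thesis
    unfolding curl_inner_cross[OF wc] curl_inner_cross[OF wd] eq using H[of u v] by simp
qed

lemma one_form_iota_d:
  assumes T: "vector_field A T" and w: "one_form A w"
  shows "one_form A (iota_d T w)"
  unfolding one_form_def
proof (intro conjI ballI allI)
  fix c assume c: "c \<in> A"
  show "smooth_on (iota_d T w c) (chart_img c)"
    unfolding iota_d_def
    by (intro smooth_on_cross smooth_on_curl chartD(2) one_form_smooth[OF w] vector_field_smooth[OF T] c)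
next
  fix c d x v assume cd: "c \<in> A" "d \<in> A" "x \<in> overlap c d"
  have "a \<times> b \<bullet> v = a \<bullet> (b \<times> v)" for a b v :: "real^3"
    by (simp add: cross3_simps)
  then show "iota_d T w c x \<bullet> v = iota_d T w d (transition c d x) \<bullet> Dtransition c d x v"
    unfolding iota_d_def using curl_change[OF w cd] vector_field_change[OF T cd] by simp
qed

lemma one_form_grad:
  assumes g: "smooth_function A g"
  shows "one_form A (\<lambda>c. grad (\<lambda>x. g (chart_inv c x)))"
  unfolding one_form_def
proof (intro conjI ballI allI)
  fix c assume c: "c \<in> A"
  show "smooth_on (grad (\<lambda>x. g (chart_inv c x))) (chart_img c)"
    by (intro smooth_on_grad chartD(2) smooth_functionD[OF g] c)
next
  fix c d x v assume cd: "c \<in> A" "d \<in> A" and x: "x \<in> overlap c d"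
  have x': "x \<in> chart_img c" using x overlap_subset[OF cd(1)] by blast
  note gc = smooth_on_differentiable[OF smooth_functionD[OF g cd(1)] x']
  note gd = smooth_on_differentiable[OF smooth_functionD[OF g cd(2)] transition_in[OF cd x]]
  have "((\<lambda>y. g (chart_inv d (transition c d y))) has_derivative
      (\<lambda>v. fderiv (\<lambda>x. g (chart_inv d x)) (transition c d x) (Dtransition c d x v))) (at x)"
    by (rule has_derivative_compose[OF Dtransition_has_derivative[OF cd x] gd[unfolded frechet_derivative_works]])
  then have "((\<lambda>y. g (chart_inv c y)) has_derivative
      (\<lambda>v. fderiv (\<lambda>x. g (chart_inv d x)) (transition c d x) (Dtransition c d x v))) (at x)"
    by (rule iffD1[OF has_derivative_cong_open[OF open_overlap[OF cd] x], rotated])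
      (simp add: chart_inv_transition[OF cd])
  from frechet_derivative_at[OF this]
  show "grad (\<lambda>x. g (chart_inv c x)) x \<bullet> v
      = grad (\<lambda>x. g (chart_inv d x)) (transition c d x) \<bullet> Dtransition c d x v"
    unfolding grad_inner[OF gc] grad_inner[OF gd] by (simp add: fun_eq_iff)
qed

section \<open>Integration of 3-forms over the manifold\<close>

text \<open>A 3-form given by its coefficient on the coordinate basis. Transition determinants are
  positive, so no absolute value distinguishes it from a measure density.\<close>

definition density :: "('a chart \<Rightarrow> real^3 \<Rightarrow> real) \<Rightarrow> bool" where
  "density F \<longleftrightarrow> (\<forall>c\<in>A. continuous_on (chart_img c) (F c)) \<and>
     (\<forall>c\<in>A. \<forall>d\<in>A. \<forall>x\<in>overlap c d. F c x = det (matrix (Dtransition c d x)) * F d (transition c d x))"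

lemma density_one_form_curl:
  assumes "one_form A \<alpha>" "one_form A \<beta>"
  shows "density (\<lambda>c x. \<alpha> c x \<bullet> curl (\<beta> c) x)"
  unfolding density_def
proof (intro conjI ballI)
  fix c assume c: "c \<in> A"
  show "continuous_on (chart_img c) (\<lambda>x. \<alpha> c x \<bullet> curl (\<beta> c) x)"
    by (intro smooth_on_imp_continuous_on smooth_on_inner smooth_on_curl chartD(2) one_form_smooth assms c)
next
  fix c d x assume cd: "c \<in> A" "d \<in> A" "x \<in> overlap c d"
  show "\<alpha> c x \<bullet> curl (\<beta> c) x = det (matrix (Dtransition c d x)) *
      (\<alpha> d (transition c d x) \<bullet> curl (\<beta> d) (transition c d x))"
    by (rule one_form_two_form_change[OF one_form_change[OF assms(1) cd] curl_change[OF assms(2) cd]])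
qed

lemma density_one_forms:
  assumes "one_form A \<alpha>" "one_form A \<beta>" "one_form A \<gamma>"
  shows "density (\<lambda>c x. \<alpha> c x \<bullet> (\<beta> c x \<times> \<gamma> c x))"
  unfolding density_def
proof (intro conjI ballI)
  fix c assume c: "c \<in> A"
  show "continuous_on (chart_img c) (\<lambda>x. \<alpha> c x \<bullet> (\<beta> c x \<times> \<gamma> c x))"
    by (intro smooth_on_imp_continuous_on smooth_on_inner smooth_on_cross chartD(2) one_form_smooth assms c)
next
  fix c d x assume cd: "c \<in> A" "d \<in> A" "x \<in> overlap c d"
  show "\<alpha> c x \<bullet> (\<beta> c x \<times> \<gamma> c x) = det (matrix (Dtransition c d x)) *
      (\<alpha> d (transition c d x) \<bullet> (\<beta> d (transition c d x) \<times> \<gamma> d (transition c d x)))"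
    by (rule one_form_two_form_change[OF one_form_change[OF assms(1) cd]
          one_forms_cross_change[OF one_form_change[OF assms(2) cd] one_form_change[OF assms(3) cd]]])
qed

lemma density_mult:
  assumes "density F" "continuous_on UNIV g"
  shows "density (\<lambda>c x. g (chart_inv c x) * F c x)"
  unfolding density_def
proof (intro conjI ballI)
  fix c assume c: "c \<in> A"
  show "continuous_on (chart_img c) (\<lambda>x. g (chart_inv c x) * F c x)"
    using assms(1) c
    by (intro continuous_on_mult continuous_on_compose2[OF assms(2) continuous_on_chart_inv[OF c]])
      (auto simp: density_def)
next
  fix c d x assume cd: "c \<in> A" "d \<in> A" "x \<in> overlap c d"
  show "g (chart_inv c x) * F c x = det (matrix (Dtransition c d x)) *
      (g (chart_inv d (transition c d x)) * F d (transition c d x))"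
    using assms(1) cd by (simp add: density_def chart_inv_transition)
qed

text \<open>For support inside both domains the two integrals live on the overlap, where the
  transition map is a change of variables with positive Jacobian determinant.\<close>

lemma integral_density_change:
  assumes F: "density F" and cd: "c \<in> A" "d \<in> A" and K: "closed K" "K \<subseteq> fst c" "K \<subseteq> fst d"
    and zero: "\<And>x. x \<in> chart_img c \<Longrightarrow> chart_inv c x \<notin> K \<Longrightarrow> F c x = 0"
      "\<And>x. x \<in> chart_img d \<Longrightarrow> chart_inv d x \<notin> K \<Longrightarrow> F d x = 0"
  shows "integral (chart_img c) (F c) = integral (chart_img d) (F d)"
proof -
  \<comment> \<open>Stated for arbitrary \<open>c\<close> and \<open>d\<close>, because it is
    applied in both directions.\<close>
  have restrict: "integral (chart_img c) (F c) = integral (overlap c d) (F c)"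
    if "c \<in> A" "K \<subseteq> fst d" "\<And>x. x \<in> chart_img c \<Longrightarrow> chart_inv c x \<notin> K \<Longrightarrow> F c x = 0" for c d
  proof -
    have "(if x \<in> chart_img c then F c x else 0) = (if x \<in> overlap c d then F c x else 0)" for x
      using that(2,3) in_overlap_iff[OF that(1), of x d] by auto
    then show ?thesis
      using integral_restrict_UNIV[of "chart_img c" "F c"] integral_restrict_UNIV[of "overlap c d" "F c"] by simp
  qed
  let ?K = "snd d ` K"
  have "?K \<subseteq> overlap d c"
    using K(2,3) by (auto simp: overlap_def)
  moreover have "F d x = 0" if "x \<in> overlap d c - ?K" for x
  proof -
    have x: "x \<in> chart_img d" using that overlap_subset[OF cd(2)] by blast
    then have "chart_inv d x \<notin> K"
      using that chart_inverse[OF cd(2) x] by (metis DiffE image_eqI)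
    then show ?thesis using zero(2) x by blast
  qed
  moreover have "continuous_on (overlap d c) (F d)"
    using F cd(2) by (intro continuous_on_subset[OF _ overlap_subset[OF cd(2)]]) (simp add: density_def)
  ultimately have abs: "F d absolutely_integrable_on overlap d c"
    using compact_chart_image(1)[OF cd(2) K(1,3)]
    by (intro absolutely_integrable_compact_support[OF open_overlap[OF cd(2,1)]]) auto
  have "integral (chart_img d) (F d) = integral (overlap d c) (F d)"
    by (rule restrict[OF cd(2) K(2) zero(2)])
  also have "\<dots> = integral (overlap c d) (\<lambda>x. \<bar>det (matrix (Dtransition c d x))\<bar> * F d (transition c d x))"
    unfolding transition_image[OF cd, symmetric]
  proof (rule integral_change_of_variables_real)
    show "overlap c d \<in> sets lebesgue"
      using open_overlap[OF cd] by (simp add: borel_open)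
    show "(transition c d has_derivative Dtransition c d x) (at x within overlap c d)" if "x \<in> overlap c d" for x
      using Dtransition_has_derivative[OF cd that] has_derivative_at_withinI by blast
    show "F d absolutely_integrable_on transition c d ` overlap c d"
      using abs transition_image[OF cd] by simp
  qed (rule inj_on_transition[OF cd])
  also have "\<dots> = integral (overlap c d) (F c)"
  proof (rule integral_cong)
    fix x assume x: "x \<in> overlap c d"
    show "\<bar>det (matrix (Dtransition c d x))\<bar> * F d (transition c d x) = F c x"
      using F cd x transition_det[OF cd x] by (simp add: density_def)
  qed
  also have "\<dots> = integral (chart_img c) (F c)"
    by (rule restrict[OF cd(1) K(3) zero(1), symmetric])
  finally show ?thesis by simp
qed

text \<open>Together with \<open>pou\<close>, names the very pair selected by the
  \<open>SOME\<close> in \<open>manifold_integral\<close>, so that the two integrals agree by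
  unfolding.\<close>

definition pou_charts :: "'a chart set" where
  "pou_charts = fst (SOME (C, \<rho>). partition_of_unity A C \<rho>)"

definition pou :: "'a chart \<Rightarrow> 'a \<Rightarrow> real" where
  "pou = snd (SOME (C, \<rho>). partition_of_unity A C \<rho>)"

lemma partition_of_unity_pou: "partition_of_unity A pou_charts pou"
proof -
  have "\<exists>p. case p of (C, \<rho>) \<Rightarrow> partition_of_unity A C \<rho>"
    using partition_of_unity_exists by simp
  from someI_ex[OF this] show ?thesis
    by (simp add: pou_charts_def pou_def case_prod_unfold)
qed

lemma finite_pou_charts: "finite pou_charts"
  and pou_charts_subset: "c \<in> pou_charts \<Longrightarrow> c \<in> A"
  and pou_smooth: "c \<in> pou_charts \<Longrightarrow> smooth_function A (pou c)"
  and pou_nonneg: "c \<in> pou_charts \<Longrightarrow> 0 \<le> pou c p"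
  and pou_support: "c \<in> pou_charts \<Longrightarrow> closure {p. pou c p \<noteq> 0} \<subseteq> fst c"
  and sum_pou: "(\<Sum>c\<in>pou_charts. pou c p) = 1"
  using partition_of_unity_pou by (auto simp: partition_of_unity_def)

lemma pou_eq_0: "p \<notin> closure {p. pou c p \<noteq> 0} \<Longrightarrow> pou c p = 0"
  using closure_subset[of "{p. pou c p \<noteq> 0}"] by blast

definition integral_M :: "('a chart \<Rightarrow> real^3 \<Rightarrow> real) \<Rightarrow> real" where
  "integral_M F = (\<Sum>c\<in>pou_charts. integral (chart_img c) (\<lambda>x. pou c (chart_inv c x) * F c x))"

abbreviation integral_wedge_d :: "'a field \<Rightarrow> real" where
  "integral_wedge_d \<alpha> \<equiv> integral_M (\<lambda>c x. \<alpha> c x \<bullet> curl (\<alpha> c) x)"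

lemma manifold_integral_eq:
  "manifold_integral A \<Omega> = integral_M (\<lambda>c x. \<Omega> c x (axis 1 1) (axis 2 1) (axis 3 1))"
  by (simp add: manifold_integral_def integral_M_def pou_charts_def pou_def case_prod_unfold Let_def)

lemma integral_M_cong:
  assumes "\<And>c x. c \<in> A \<Longrightarrow> x \<in> chart_img c \<Longrightarrow> F c x = G c x"
  shows "integral_M F = integral_M G"
  unfolding integral_M_def using assms pou_charts_subset
  by (intro sum.cong integral_cong refl) auto

abbreviation pou_supp :: "'a chart \<Rightarrow> (real^3) set" where
  "pou_supp c \<equiv> snd c ` closure {p. pou c p \<noteq> 0}"

lemma pou_supp:
  assumes c: "c \<in> pou_charts"
  shows "compact (pou_supp c)" "pou_supp c \<subseteq> chart_img c"
    "x \<in> chart_img c - pou_supp c \<Longrightarrow> pou c (chart_inv c x) = 0"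
  using compact_chart_image[OF pou_charts_subset[OF c] closed_closure pou_support[OF c]] 
proof -
  assume x: "x \<in> chart_img c - pou_supp c"
  then have "chart_inv c x \<notin> closure {p. pou c p \<noteq> 0}"
    using chart_inverse[OF pou_charts_subset[OF c], of x] by (metis DiffE image_eqI)
  then show "pou c (chart_inv c x) = 0" by (rule pou_eq_0)
qed auto

lemma smooth_on_pou: "c \<in> pou_charts \<Longrightarrow> d \<in> A \<Longrightarrow> smooth_on (\<lambda>x. pou c (chart_inv d x)) (chart_img d)"
  using smooth_functionD pou_smooth by blast

lemma pou_integrable:
  assumes c: "c \<in> pou_charts" and F: "continuous_on (chart_img c) F"
  shows "(\<lambda>x. pou c (chart_inv c x) * F x) integrable_on chart_img c"
proof -
  note cA = pou_charts_subset[OF c]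
  show ?thesis
    using pou_supp[OF c] chartD(2)[OF cA]
    by (intro integrable_compact_support[of "chart_img c" _ "pou_supp c"] continuous_on_mult F
        smooth_on_imp_continuous_on[OF smooth_on_pou[OF c cA]]) auto
qed

lemma integral_M_add:
  assumes "\<And>c. c \<in> A \<Longrightarrow> continuous_on (chart_img c) (F c)" "\<And>c. c \<in> A \<Longrightarrow> continuous_on (chart_img c) (G c)"
  shows "integral_M (\<lambda>c x. F c x + G c x) = integral_M F + integral_M G"
proof -
  have "integral (chart_img c) (\<lambda>x. pou c (chart_inv c x) * (F c x + G c x))
      = integral (chart_img c) (\<lambda>x. pou c (chart_inv c x) * F c x) + integral (chart_img c) (\<lambda>x. pou c (chart_inv c x) * G c x)"
    if "c \<in> pou_charts" for c
    unfolding distrib_left using assms pou_charts_subset[OF that]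
    by (intro integral_add pou_integrable[OF that]) auto
  then show ?thesis by (simp add: integral_M_def sum.distrib)
qed

lemma integral_M_cmult: "integral_M (\<lambda>c x. r * F c x) = r * integral_M F"
  by (simp add: integral_M_def sum_distrib_left mult.left_commute[of _ r])

lemma integral_M_pos:
  assumes F: "\<And>c. c \<in> A \<Longrightarrow> continuous_on (chart_img c) (F c)"
    and nonneg: "\<And>c x. c \<in> A \<Longrightarrow> x \<in> chart_img c \<Longrightarrow> F c x \<ge> 0"
    and pos: "\<And>c. c \<in> A \<Longrightarrow> p \<in> fst c \<Longrightarrow> F c (snd c p) > 0"
  shows "integral_M F > 0"
proof -
  have "(\<Sum>c\<in>pou_charts. pou c p) \<noteq> 0" using sum_pou by simp
  then obtain c where c: "c \<in> pou_charts" "pou c p \<noteq> 0"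
    by (meson sum.not_neutral_contains_not_neutral)
  have "0 \<le> integral (chart_img c) (\<lambda>x. pou c (chart_inv c x) * F c x)" if "c \<in> pou_charts" for c
    using pou_nonneg[OF that] nonneg pou_charts_subset[OF that] F
    by (intro integral_nonneg pou_integrable that) auto
  moreover have "0 < integral (chart_img c) (\<lambda>x. pou c (chart_inv c x) * F c x)"
  proof (rule integral_pos_compact_support[where K="pou_supp c"])
    note cA = pou_charts_subset[OF c(1)]
    have p: "p \<in> fst c"
      using c pou_support[OF c(1)] pou_eq_0 by blast
    show "continuous_on (chart_img c) (\<lambda>x. pou c (chart_inv c x) * F c x)"
      by (intro continuous_on_mult F smooth_on_imp_continuous_on[OF smooth_on_pou] c cA)
    show "0 \<le> pou c (chart_inv c x) * F c x" if "x \<in> chart_img c" for x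
      using pou_nonneg[OF c(1)] nonneg[OF cA that] by simp
    show "snd c p \<in> chart_img c" by (rule chart_in[OF cA p])
    show "0 < pou c (chart_inv c (snd c p)) * F c (snd c p)"
      using pos[OF cA p] c(2) pou_nonneg[OF c(1), of p] by (simp add: chart_inv_inverse[OF cA p])
  qed (use chartD(2)[OF pou_charts_subset[OF c(1)]] pou_supp[OF c(1)] in auto)
  ultimately show ?thesis
    unfolding integral_M_def using finite_pou_charts c(1) by (meson sum_pos2)
qed

text \<open>Independence of the partition, for support in one chart: each piece is supported in the
  domains of both \<open>c\<close> and \<open>d\<close>, may be moved to \<open>d\<close>, and there
  the weights add up to 1.\<close>

lemma integral_M_local:
  assumes F: "density F" and d: "d \<in> A" and K: "closed K" "K \<subseteq> fst d"
    and zero: "\<And>c x. c \<in> A \<Longrightarrow> x \<in> chart_img c \<Longrightarrow> chart_inv c x \<notin> K \<Longrightarrow> F c x = 0"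
  shows "integral_M F = integral (chart_img d) (F d)"
proof -
  have cF: "continuous_on (chart_img d) (F d)" using F d by (auto simp: density_def)
  have 1: "integral (chart_img c) (\<lambda>x. pou c (chart_inv c x) * F c x) = integral (chart_img d) (\<lambda>x. pou c (chart_inv d x) * F d x)"
    if c: "c \<in> pou_charts" for c
  proof (rule integral_density_change[where K="closure {p. pou c p \<noteq> 0} \<inter> K"])
    note cA = pou_charts_subset[OF c]
    show "density (\<lambda>c' x. pou c (chart_inv c' x) * F c' x)"
      by (rule density_mult[OF F smooth_function_continuous[OF pou_smooth[OF c]]])
    have "pou c (chart_inv e x) * F e x = 0"
      if "e \<in> A" "x \<in> chart_img e" "chart_inv e x \<notin> closure {p. pou c p \<noteq> 0} \<inter> K" for e x
      using zero[OF that(1,2)] pou_eq_0[of "chart_inv e x" c] that(3) by (metis IntI mult_eq_0_iff)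
    then show "x \<in> chart_img c \<Longrightarrow> chart_inv c x \<notin> closure {p. pou c p \<noteq> 0} \<inter> K \<Longrightarrow> pou c (chart_inv c x) * F c x = 0"
      and "x \<in> chart_img d \<Longrightarrow> chart_inv d x \<notin> closure {p. pou c p \<noteq> 0} \<inter> K \<Longrightarrow> pou c (chart_inv d x) * F d x = 0" for x
      using cA d by blast+
    show "closed (closure {p. pou c p \<noteq> 0} \<inter> K)" by (rule closed_Int[OF closed_closure K(1)])
    show "closure {p. pou c p \<noteq> 0} \<inter> K \<subseteq> fst c" using pou_support[OF c] by blast
    show "closure {p. pou c p \<noteq> 0} \<inter> K \<subseteq> fst d" using K(2) by blast
  qed (use pou_charts_subset[OF c] d in auto)
  have int: "(\<lambda>x. pou c (chart_inv d x) * F d x) integrable_on chart_img d" if c: "c \<in> pou_charts" for c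
  proof (rule integrable_compact_support[of "chart_img d" _ "snd d ` K"])
    show "continuous_on (chart_img d) (\<lambda>x. pou c (chart_inv d x) * F d x)"
      by (intro continuous_on_mult cF smooth_on_imp_continuous_on[OF smooth_on_pou] c d)
    show "pou c (chart_inv d x) * F d x = 0" if "x \<in> chart_img d - snd d ` K" for x
    proof -
      have "chart_inv d x \<notin> K"
        using that chart_inverse[OF d, of x] by (metis DiffE image_eqI)
      then show ?thesis using zero[OF d] that by auto
    qed
  qed (use chartD(2)[OF d] compact_chart_image[OF d K] in auto)
  have "integral_M F = (\<Sum>c\<in>pou_charts. integral (chart_img d) (\<lambda>x. pou c (chart_inv d x) * F d x))"
    using 1 by (simp add: integral_M_def)
  also have "\<dots> = integral (chart_img d) (\<lambda>x. \<Sum>c\<in>pou_charts. pou c (chart_inv d x) * F d x)"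
    using int by (intro integral_sum[symmetric] finite_pou_charts)
  also have "\<dots> = integral (chart_img d) (F d)"
    by (simp add: sum_pou flip: sum_distrib_right)
  finally show ?thesis .
qed

text \<open>Only \<open>\<Sum>\<^sub>c d\<rho>\<^sub>c = 0\<close> is at stake: in the chart \<open>c\<close> the form \<open>\<rho>\<^sub>c d\<sigma>\<close> is
  \<open>- d\<rho>\<^sub>c \<and> \<sigma>\<close> up to the differential of a compactly supported form, and after insertion of
  \<open>\<Sum>\<^sub>d \<rho>\<^sub>d = 1\<close> each term \<open>\<rho>\<^sub>d d\<rho>\<^sub>c \<and> \<sigma>\<close> may be integrated in the chart \<open>d\<close> instead.\<close>

lemma stokes:
  assumes a: "one_form A a" and b: "one_form A b"
  shows "integral_M (\<lambda>c. dvg (\<lambda>x. a c x \<times> b c x)) = 0"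
proof -
  let ?V = "\<lambda>c x. a c x \<times> b c x"
  let ?g = "\<lambda>c d. grad (\<lambda>x. pou c (chart_inv d x))"
  have V: "smooth_on (?V c) (chart_img c)" if "c \<in> A" for c
    by (intro smooth_on_cross chartD(2) one_form_smooth a b that)
  have dens: "density (\<lambda>d x. ?g c d x \<bullet> ?V d x)" if "c \<in> pou_charts" for c
    by (intro density_one_forms one_form_grad pou_smooth that a b)
  have g0: "?g c d x = 0" if c: "c \<in> pou_charts" "d \<in> A" "x \<in> chart_img d" "chart_inv d x \<notin> closure {p. pou c p \<noteq> 0}" for c d x
  proof -
    let ?U = "{x \<in> chart_img d. chart_inv d x \<in> - closure {p. pou c p \<noteq> 0}}"
    have U: "open ?U" by (rule open_chart_preimage[OF c(2)]) (rule open_Compl[OF closed_closure])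
    have "fderiv (\<lambda>x. pou c (chart_inv d x)) x = fderiv (\<lambda>x. 0) x"
    proof (rule frechet_derivative_cong_open[OF U])
      show "x \<in> ?U" using c(3,4) by simp
      show "pou c (chart_inv d y) = 0" if "y \<in> ?U" for y
        using that pou_eq_0[of "chart_inv d y" c] by simp
    qed
    then show ?thesis by (simp add: grad_def vec_eq_iff)
  qed
  have 1: "integral (chart_img c) (\<lambda>x. pou c (chart_inv c x) * dvg (?V c) x)
      = - integral_M (\<lambda>d x. ?g c d x \<bullet> ?V d x)" if c: "c \<in> pou_charts" for c
  proof -
    note cA = pou_charts_subset[OF c]
    have "integral (chart_img c) (dvg (\<lambda>x. pou c (chart_inv c x) *\<^sub>R ?V c x)) = 0"
      using chartD(2)[OF cA] pou_supp[OF c]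
      by (intro integral_dvg_eq_0[where K="pou_supp c"] smooth_on_scaleR smooth_on_pou V c cA) auto
    also have "integral (chart_img c) (dvg (\<lambda>x. pou c (chart_inv c x) *\<^sub>R ?V c x))
        = integral (chart_img c) (\<lambda>x. ?g c c x \<bullet> ?V c x + pou c (chart_inv c x) * dvg (?V c) x)"
      by (intro integral_cong dvg_scaleR smooth_on_differentiable[OF smooth_on_pou[OF c cA]] smooth_on_differentiable[OF V[OF cA]])
    also have "\<dots> = integral (chart_img c) (\<lambda>x. ?g c c x \<bullet> ?V c x) + integral (chart_img c) (\<lambda>x. pou c (chart_inv c x) * dvg (?V c) x)"
    proof (intro integral_add pou_integrable c integrable_compact_support[where K="pou_supp c"])
      show "continuous_on (chart_img c) (dvg (?V c))"
        by (intro smooth_on_imp_continuous_on smooth_on_dvg chartD(2) V cA)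
      show "continuous_on (chart_img c) (\<lambda>x. ?g c c x \<bullet> ?V c x)"
        using dens[OF c] cA by (simp add: density_def)
      show "?g c c x \<bullet> ?V c x = 0" if x: "x \<in> chart_img c - pou_supp c" for x
      proof -
        have "chart_inv c x \<notin> closure {p. pou c p \<noteq> 0}"
          using x chart_inverse[OF cA, of x] by (metis DiffE image_eqI)
        then show ?thesis using g0[OF c cA] x by simp
      qed
    qed (use chartD(2)[OF cA] pou_supp[OF c] in auto)
    also have "integral (chart_img c) (\<lambda>x. ?g c c x \<bullet> ?V c x) = integral_M (\<lambda>d x. ?g c d x \<bullet> ?V d x)"
      using g0[OF c] by (intro integral_M_local[symmetric, OF dens[OF c] cA closed_closure pou_support[OF c]]) simp
    finally show ?thesis by simp
  qed
  have "integral_M (\<lambda>c. dvg (?V c)) = (\<Sum>c\<in>pou_charts. - integral_M (\<lambda>d x. ?g c d x \<bullet> ?V d x))"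
    unfolding integral_M_def[of "\<lambda>c. dvg (?V c)"] using 1 by (rule sum.cong[OF refl])
  also have "\<dots> = - (\<Sum>d\<in>pou_charts. \<Sum>c\<in>pou_charts. integral (chart_img d) (\<lambda>x. pou d (chart_inv d x) * (?g c d x \<bullet> ?V d x)))"
    unfolding integral_M_def sum_negf by (subst sum.swap) simp
  also have "(\<Sum>d\<in>pou_charts. \<Sum>c\<in>pou_charts. integral (chart_img d) (\<lambda>x. pou d (chart_inv d x) * (?g c d x \<bullet> ?V d x))) = 0"
  proof (rule sum.neutral, rule ballI)
    fix d assume d: "d \<in> pou_charts"
    note dA = pou_charts_subset[OF d]
    have "(\<Sum>c\<in>pou_charts. integral (chart_img d) (\<lambda>x. pou d (chart_inv d x) * (?g c d x \<bullet> ?V d x)))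
        = integral (chart_img d) (\<lambda>x. \<Sum>c\<in>pou_charts. pou d (chart_inv d x) * (?g c d x \<bullet> ?V d x))"
      using dens dA by (intro integral_sum[symmetric] finite_pou_charts pou_integrable d) (simp add: density_def)
    also have "\<dots> = integral (chart_img d) (\<lambda>x. 0)"
    proof (rule integral_cong)
      fix x assume x: "x \<in> chart_img d"
      have "((\<lambda>x. \<Sum>c\<in>pou_charts. pou c (chart_inv d x)) has_derivative
          (\<lambda>v. \<Sum>c\<in>pou_charts. fderiv (\<lambda>x. pou c (chart_inv d x)) x v)) (at x)"
        by (intro has_derivative_sum smooth_on_has_derivative[OF smooth_on_pou] dA x)
      from frechet_derivative_at[OF this]
      have "(\<Sum>c\<in>pou_charts. fderiv (\<lambda>x. pou c (chart_inv d x)) x v) = 0" for v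
        by (simp add: sum_pou fun_eq_iff)
      then have "(\<Sum>c\<in>pou_charts. ?g c d x) = 0"
        by (simp add: vec_eq_iff grad_def)
      then have "(\<Sum>c\<in>pou_charts. ?g c d x \<bullet> ?V d x) = 0"
        by (simp flip: inner_sum_left)
      then show "(\<Sum>c\<in>pou_charts. pou d (chart_inv d x) * (?g c d x \<bullet> ?V d x)) = 0"
        by (simp flip: sum_distrib_left)
    qed
    finally show "(\<Sum>c\<in>pou_charts. integral (chart_img d) (\<lambda>x. pou d (chart_inv d x) * (?g c d x \<bullet> ?V d x))) = 0"
      by simp
  qed
  finally show ?thesis by simp
qed

end

section \<open>One-parameter families and the dual form\<close>

text \<open>Taken as a derivative of the map on the product space in the direction (1, 0), so that
  the symmetry of second derivatives relates it to spatial derivatives.\<close>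

definition time_deriv :: "(real \<Rightarrow> 'a::real_normed_vector \<Rightarrow> 'b::real_normed_vector) \<Rightarrow> 'a \<Rightarrow> 'b" where
  "time_deriv F x = fderiv (\<lambda>(t, x). F t x) (0, x) (1, 0)"

lemma has_derivative_slice:
  assumes "case_prod F differentiable (at (t, x))"
  shows "(F t has_derivative (\<lambda>v. fderiv (case_prod F) (t, x) (0, v))) (at x)"
proof -
  have "((\<lambda>x. (t, x)) has_derivative (\<lambda>v. (0, v))) (at x)"
    by (auto intro!: derivative_eq_intros)
  from has_derivative_compose[OF this assms[unfolded frechet_derivative_works]] show ?thesis by simp
qed

lemma has_derivative_time_slice:
  assumes "case_prod F differentiable (at (0, x))"
  shows "((\<lambda>t. F t x) has_vector_derivative time_deriv F x) (at 0)"
  unfolding time_deriv_def by (rule has_vector_derivative_slice[OF assms])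

lemma smooth_on_slice:
  fixes F :: "real \<Rightarrow> 'a::euclidean_space \<Rightarrow> 'b::real_normed_vector"
  assumes "open S" "open I" "t \<in> I" "smooth_on (case_prod F) (Sigma I (\<lambda>_. S))"
  shows "smooth_on (F t) S"
proof -
  have "smooth_on (\<lambda>x. case_prod F (t, x)) S"
    by (rule smooth_on_compose[OF assms(1) open_Times[OF assms(2,1)] _ assms(4)])
      (use assms in \<open>simp_all add: smooth_on_Pair smooth_on_const smooth_on_linear[OF bounded_linear_ident] image_subset_iff\<close>)
  then show ?thesis by simp
qed

lemma smooth_on_time_deriv:
  fixes F :: "real \<Rightarrow> 'a::euclidean_space \<Rightarrow> 'b::real_normed_vector"
  assumes "open S" "open I" "0 \<in> I" "smooth_on (case_prod F) (Sigma I (\<lambda>_. S))"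
  shows "smooth_on (time_deriv F) S"
  unfolding time_deriv_def[abs_def]
  using smooth_on_slice[OF assms(1-3), of "\<lambda>t x. fderiv (case_prod F) (t, x) (1, 0)"]
    smooth_on_frechet[OF assms(4), of "(1, 0)"] by (simp add: case_prod_unfold)

lemma smooth_on_family_bilinear:
  assumes "open P" "bounded_bilinear h" "smooth_on (case_prod F) P" "smooth_on (case_prod G) P"
  shows "smooth_on (\<lambda>(t, x). h (F t x) (G t x)) P"
  using smooth_on_bilinear[OF assms] by (simp add: case_prod_unfold)

lemma time_deriv_bilinear:
  assumes "bounded_bilinear h" "case_prod F differentiable (at (0, x))" "case_prod G differentiable (at (0, x))"
  shows "time_deriv (\<lambda>t x. h (F t x) (G t x)) x = h (F 0 x) (time_deriv G x) + h (time_deriv F x) (G 0 x)"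
  using frechet_derivative_bilinear[OF assms, of "(1, 0)"] by (simp add: time_deriv_def case_prod_unfold)

lemma curl_slice:
  assumes "case_prod F differentiable (at (t, x))"
  shows "curl (F t) x = (\<Sum>i\<in>UNIV. axis i 1 \<times> fderiv (case_prod F) (t, x) (0, axis i 1))"
  unfolding curl_def using frechet_derivative_at[OF has_derivative_slice[OF assms]] by (simp add: fun_eq_iff)

lemma smooth_on_curl_family:
  assumes "open P" "smooth_on (case_prod F) P"
  shows "smooth_on (\<lambda>(t, x). curl (F t) x) P"
proof -
  have "smooth_on (\<lambda>p. \<Sum>i\<in>UNIV. axis i 1 \<times> fderiv (case_prod F) p (0, axis i 1)) P"
    by (intro smooth_on_sum smooth_on_cross smooth_on_const smooth_on_frechet assms)
  then show ?thesis
    by (rule iffD2[OF smooth_on_cong[OF assms(1)], rotated])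
      (auto simp: curl_slice[OF smooth_on_differentiable[OF assms(2)]])
qed

text \<open>Time and space derivatives commute, by symmetry of the second derivative on the product
  space.\<close>

lemma time_deriv_curl:
  assumes "open P" "(0, x) \<in> P" "smooth_on (case_prod F) P"
  shows "time_deriv (\<lambda>t. curl (F t)) x = curl (time_deriv F) x"
proof -
  let ?F = "case_prod F"
  define G where "G i p = fderiv ?F p (0, axis i 1)" for i p
  define H where "H t x = fderiv ?F (t, x) (1, 0)" for t x
  have G: "smooth_on (G i) P" for i
    unfolding G_def by (rule smooth_on_frechet[OF assms(3)])
  have H: "smooth_on (case_prod H) P"
    unfolding H_def using smooth_on_frechet[OF assms(3), of "(1, 0)"] by (simp add: case_prod_unfold)
  have "time_deriv (\<lambda>t. curl (F t)) x = fderiv (\<lambda>p. \<Sum>i\<in>UNIV. axis i 1 \<times> G i p) (0, x) (1, 0)"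
    unfolding time_deriv_def G_def
    by (intro fun_cong[OF frechet_derivative_cong_open[OF assms(1,2)]])
      (auto simp: curl_slice[OF smooth_on_differentiable[OF assms(3)]])
  also have "\<dots> = (\<Sum>i\<in>UNIV. axis i 1 \<times> fderiv (G i) (0, x) (1, 0))"
    by (rule frechet_derivative_sum_cross[OF smooth_on_differentiable[OF G assms(2)]])
  also have "\<dots> = (\<Sum>i\<in>UNIV. axis i 1 \<times> fderiv (case_prod H) (0, x) (0, axis i 1))"
  proof -
    have "fderiv (G i) (0, x) (1, 0) = fderiv (case_prod H) (0, x) (0, axis i 1)" for i
      using symmetric_second_derivative[OF assms(3,1,2), of "(0, axis i 1)" "(1, 0)"]
      by (simp add: G_def[abs_def] H_def case_prod_unfold)
    then show ?thesis by simp
  qed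
  also have "\<dots> = curl (H 0) x"
    by (rule curl_slice[OF smooth_on_differentiable[OF H assms(2)], symmetric])
  also have "H 0 = time_deriv F"
    by (simp add: fun_eq_iff H_def time_deriv_def)
  finally show ?thesis .
qed

section \<open>The normalised form of a transverse pair\<close>

text \<open>Every \<open>v\<close> differs from a multiple of \<open>T\<close> by an element of the
  kernel of \<open>w\<close>.\<close>

lemma form_eqI:
  fixes w T :: "'a::real_inner"
  assumes "linear f" "w \<bullet> T = 1" "f T = 1" "\<And>v. w \<bullet> v = 0 \<Longrightarrow> f v = (0::real)"
  shows "f v = w \<bullet> v"
proof -
  have "f (v - (w \<bullet> v) *\<^sub>R T) = 0"
    by (rule assms(4)) (simp add: inner_diff_right assms(2))
  then show ?thesis
    by (simp add: linear_diff[OF assms(1)] linear_scale[OF assms(1)] assms(3))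
qed

lemma dual_form_eqI:
  assumes "{v. w \<bullet> v = 0} = D c x" "w \<bullet> T c x = 1"
  shows "dual_form D T c x = w"
  unfolding dual_form_def
proof (rule the_equality)
  fix a assume a: "{v. a \<bullet> v = 0} = D c x \<and> a \<bullet> T c x = 1"
  have "a \<bullet> v = w \<bullet> v" for v
  proof (rule form_eqI[OF _ assms(2)])
    show "linear ((\<bullet>) a)" by (simp add: bounded_linear.linear bounded_linear_inner_right)
  qed (use a assms(1) in auto)
  then show "a = w" using vector_eq_rdot[of a w] by blast
qed (use assms in auto)

lemma transverse_kernel_form:
  assumes "D c x = {v. a \<bullet> v = 0}" "T c x \<notin> D c x"
  shows "dual_form D T c x = (1 / (a \<bullet> T c x)) *\<^sub>R a" "a \<bullet> T c x \<noteq> 0"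
proof -
  show nz: "a \<bullet> T c x \<noteq> 0" using assms by simp
  show "dual_form D T c x = (1 / (a \<bullet> T c x)) *\<^sub>R a"
    by (rule dual_form_eqI) (use assms nz in simp_all)
qed

context closed_manifold
begin

context
  fixes D T assumes D: "plane_field A D" and T: "vector_field A T" and tr: "transverse A T D"
begin

lemma dual_form_props:
  assumes "c \<in> A" "x \<in> chart_img c"
  shows "dual_form D T c x \<bullet> T c x = 1" "D c x = {v. dual_form D T c x \<bullet> v = 0}"
proof -
  obtain V a' where "x \<in> V" "\<forall>y\<in>V. a' y \<noteq> 0 \<and> D c y = {v. a' y \<bullet> v = 0}"
    using D[unfolded plane_field_def, THEN conjunct1, rule_format, OF assms] by blast
  then obtain a where a: "D c x = {v. a \<bullet> v = 0}" by blast
  have nT: "T c x \<notin> D c x"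
    using tr assms by (simp add: transverse_def)
  show "dual_form D T c x \<bullet> T c x = 1" "D c x = {v. dual_form D T c x \<bullet> v = 0}"
    using transverse_kernel_form[of D c x a T, OF a nT] a by simp_all
qed

text \<open>Smoothness comes from normalising a local defining form by its nonzero value on T; the
  transformation law comes from uniqueness, as the pulled-back form has the same kernel and the same
  value on T.\<close>

lemma one_form_dual_form: "one_form A (dual_form D T)"
  unfolding one_form_def
proof (intro conjI ballI allI)
  fix c assume c: "c \<in> A"
  show "smooth_on (dual_form D T c) (chart_img c)"
  proof (rule smooth_on_local[OF chartD(2)[OF c]])
    fix x assume x: "x \<in> chart_img c"
    obtain V a where V: "open V" "x \<in> V" "V \<subseteq> chart_img c" "smooth_on a V"
      and a: "\<And>y. y \<in> V \<Longrightarrow> D c y = {v. a y \<bullet> v = 0}"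
      using D[unfolded plane_field_def, THEN conjunct1, rule_format, OF c x] by blast
    have nT: "T c y \<notin> D c y" if "y \<in> V" for y
      using tr c V(3) that by (auto simp: transverse_def)
    have nz: "a y \<bullet> T c y \<noteq> 0" and eq: "dual_form D T c y = (1 / (a y \<bullet> T c y)) *\<^sub>R a y" if "y \<in> V" for y
      using transverse_kernel_form[of D c y "a y" T] a[OF that] nT[OF that] by blast+
    have TV: "smooth_on (T c) V"
      using vector_field_smooth[OF T c] V(3) smooth_on_subset by blast
    have "smooth_on (\<lambda>y. (1 / (a y \<bullet> T c y)) *\<^sub>R a y) V"
      by (rule smooth_on_scaleR[OF V(1) smooth_on_divide[OF V(1) smooth_on_const
            smooth_on_inner[OF V(1,4) TV] nz] V(4)])
    then have "smooth_on (dual_form D T c) V"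
      by (rule iffD2[OF smooth_on_cong[OF V(1)], rotated]) (rule eq)
    then show "\<exists>U. open U \<and> x \<in> U \<and> smooth_on (dual_form D T c) U"
      using V(1,2) by blast
  qed
next
  fix c d x v assume cd: "c \<in> A" "d \<in> A" and x: "x \<in> overlap c d"
  let ?L = "Dtransition c d x" and ?y = "transition c d x"
  have x': "x \<in> chart_img c" using x overlap_subset[OF cd(1)] by blast
  note y = transition_in[OF cd x]
  have L: "linear ?L"
    using Dtransition_has_derivative[OF cd x] has_derivative_linear by blast
  have "linear (\<lambda>v. dual_form D T d ?y \<bullet> ?L v)"
    by (intro linearI) (simp_all add: linear_add[OF L] linear_scale[OF L] inner_add_right)
  moreover have "dual_form D T d ?y \<bullet> ?L (T c x) = 1"
    using dual_form_props(1)[OF cd(2) y] vector_field_change[OF T cd x] by simp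
  moreover have "dual_form D T d ?y \<bullet> ?L v = 0" if "dual_form D T c x \<bullet> v = 0" for v
  proof -
    have "?L v \<in> ?L ` D c x"
      using that dual_form_props(2)[OF cd(1) x'] by blast
    also have "?L ` D c x = D d ?y"
      using D cd x unfolding plane_field_def by simp
    finally show ?thesis using dual_form_props(2)[OF cd(2) y] by blast
  qed
  ultimately show "dual_form D T c x \<bullet> v = dual_form D T d ?y \<bullet> ?L v"
    using form_eqI[OF _ dual_form_props(1)[OF cd(1) x'], of "\<lambda>v. dual_form D T d ?y \<bullet> ?L v" v] by simp
qed

text \<open>The easy half of the theorem of Frobenius: with p the third foliated coordinate,
  \<omega> = h dp, so d\<omega> = dh \<and> dp and \<omega> \<and> d\<omega> = 0.\<close>

lemma dual_form_integrable:
  assumes int: "integrable_planes A D" and c: "c \<in> A" and x: "x \<in> chart_img c"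
  shows "dual_form D T c x \<bullet> curl (dual_form D T c) x = 0"
proof -
  obtain V and \<psi> :: "real^3 \<Rightarrow> real^3" where V: "x \<in> V" "V \<subseteq> chart_img c" "diffeo_on \<psi> V"
    and D\<psi>: "\<And>y. y \<in> V \<Longrightarrow> D c y = {v. fderiv \<psi> y v $ 3 = 0}"
    using int[unfolded integrable_planes_def, rule_format, OF c x] by blast
  have V': "open V" "smooth_on \<psi> V"
    using V(3) by (auto simp: diffeo_on_def)
  define p where "p y = \<psi> y $ 3" for y
  define h where "h y = 1 / (grad p y \<bullet> T c y)" for y
  have p: "smooth_on p V"
    unfolding p_def by (rule smooth_on_linear_compose[OF V'(1) bounded_linear_vec_nth V'(2)])
  have gp: "smooth_on (grad p) V"
    by (rule smooth_on_grad[OF V'(1) p])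
  have a: "D c y = {v. grad p y \<bullet> v = 0}" if "y \<in> V" for y
  proof -
    have "grad p y \<bullet> v = fderiv \<psi> y v $ 3" for v
      unfolding grad_inner[OF smooth_on_differentiable[OF p that]] unfolding p_def
      by (rule frechet_derivative_linear_compose[OF bounded_linear_vec_nth smooth_on_differentiable[OF V'(2) that]])
    then show ?thesis using D\<psi>[OF that] by simp
  qed
  have nT: "T c y \<notin> D c y" if "y \<in> V" for y
    using tr c V(2) that by (auto simp: transverse_def)
  have nz: "grad p y \<bullet> T c y \<noteq> 0" and eq: "dual_form D T c y = h y *\<^sub>R grad p y" if "y \<in> V" for y
    using transverse_kernel_form[of D c y "grad p y" T] a[OF that] nT[OF that] unfolding h_def by blast+
  have TV: "smooth_on (T c) V"
    using vector_field_smooth[OF T c] V(2) smooth_on_subset by blast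
  have h: "smooth_on h V"
    unfolding h_def[abs_def]
    by (rule smooth_on_divide[OF V'(1) smooth_on_const smooth_on_inner[OF V'(1) gp TV] nz])
  have "curl (dual_form D T c) x = curl (\<lambda>y. h y *\<^sub>R grad p y) x"
    by (rule curl_cong[OF V'(1) V(1) eq])
  also have "\<dots> = grad h x \<times> grad p x"
    using curl_scaleR[OF smooth_on_differentiable[OF h V(1)] smooth_on_differentiable[OF gp V(1)]]
      curl_grad[OF V'(1) V(1) p] by simp
  finally show ?thesis
    using eq[OF V(1)] by (simp add: dot_cross_self)
qed

end

text \<open>The normalisation makes \<open>w\<close> itself the dual form of its kernel on every
  chart image. This applies to each member of a variation.\<close>

lemma gv_ker_form:
  assumes w: "one_form A w" and wT: "\<And>c x. c \<in> A \<Longrightarrow> x \<in> chart_img c \<Longrightarrow> w c x \<bullet> T c x = 1"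
    and T: "vector_field A T"
  shows "gv A (ker_form w) T = integral_wedge_d (iota_d T w)"
proof -
  let ?\<eta> = "interior_product T (ext_deriv (dual_form (ker_form w) T))"
  have dual: "dual_form (ker_form w) T c x = w c x" if "c \<in> A" "x \<in> chart_img c" for c x
    by (rule dual_form_eqI) (use wT[OF that] in \<open>auto simp: ker_form_def\<close>)
  have \<eta>: "?\<eta> c x = iota_d T w c x" if c: "c \<in> A" "x \<in> chart_img c" for c x
  proof -
    note O = chartD(2)[OF c(1)]
    have "dual_form (ker_form w) T c differentiable (at x)"
      by (rule iffD2[OF differentiable_cong_open[OF O c(2) dual[OF c(1)]] one_form_differentiable[OF w c]])
    then have "?\<eta> c x = iota_d T (dual_form (ker_form w) T) c x"
      by (rule interior_product_ext_deriv)
    also have "\<dots> = iota_d T w c x"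
      unfolding iota_d_def using curl_cong[OF O c(2) dual[OF c(1)]] by simp
    finally show ?thesis .
  qed
  have "wedge ?\<eta> (ext_deriv ?\<eta>) c x (axis 1 1) (axis 2 1) (axis 3 1) = iota_d T w c x \<bullet> curl (iota_d T w c) x"
    if c: "c \<in> A" "x \<in> chart_img c" for c x
  proof -
    note O = chartD(2)[OF c(1)]
    have "?\<eta> c differentiable (at x)"
      by (rule iffD2[OF differentiable_cong_open[OF O c(2) \<eta>[OF c(1)]]
            one_form_differentiable[OF one_form_iota_d[OF T w] c]])
    then have "wedge ?\<eta> (ext_deriv ?\<eta>) c x (axis 1 1) (axis 2 1) (axis 3 1) = ?\<eta> c x \<bullet> curl (?\<eta> c) x"
      by (rule wedge_ext_deriv)
    then show ?thesis
      using curl_cong[OF O c(2) \<eta>[OF c(1)]] \<eta>[OF c] by simp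
  qed
  then show ?thesis
    unfolding gv_def Let_def manifold_integral_eq by (rule integral_M_cong)
qed

lemma iota_d_inner_self: "iota_d T w c x \<bullet> T c x = 0"
  by (simp add: iota_d_def dot_cross_self)

text \<open>The separate \<open>w'\<close> permits iteration: an iterated Lie derivative is known to
  equal a 1-form only on the chart image.\<close>

lemma lie_derivative_eq_iota_d:
  assumes T: "vector_field A T" and w: "one_form A w" and c: "c \<in> A"
    and eq: "\<And>y. y \<in> chart_img c \<Longrightarrow> w' c y = w c y"
    and const: "\<And>y. y \<in> chart_img c \<Longrightarrow> w c y \<bullet> T c y = k" and x: "x \<in> chart_img c"
  shows "lie_derivative T w' c x = iota_d T w c x"
proof -
  note O = chartD(2)[OF c]
  have "smooth_on (w' c) (chart_img c)"
    by (rule iffD2[OF smooth_on_cong[OF O eq] one_form_smooth[OF w c]])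
  then have "lie_derivative T w' c x = curl (w' c) x \<times> T c x"
    using const eq by (intro lie_derivative_eq_curl_cross[of "chart_img c" x w' c T k] O x vector_field_smooth[OF T c]) simp_all
  then show ?thesis
    unfolding iota_d_def using curl_cong[OF O x eq] by simp
qed

text \<open>The pairings with T at the three stages are the constants 1, 0 and 0, so Cartan's
  correction term vanishes each time.\<close>

lemma lie_derivative_cubed:
  assumes T: "vector_field A T" and w: "one_form A w"
    and wT: "\<And>c x. c \<in> A \<Longrightarrow> x \<in> chart_img c \<Longrightarrow> w c x \<bullet> T c x = 1"
    and cx: "c \<in> A" "x \<in> chart_img c"
  shows "(lie_derivative T ^^ 3) w c x = iota_d T (iota_d T (iota_d T w)) c x"
proof -
  note 1 = lie_derivative_eq_iota_d[of T w c w 1, OF T w cx(1) refl wT[OF cx(1)]]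
  note 2 = lie_derivative_eq_iota_d[of T "iota_d T w" c "lie_derivative T w" 0,
      OF T one_form_iota_d[OF T w] cx(1) 1 iota_d_inner_self]
  note 3 = lie_derivative_eq_iota_d[of T "iota_d T (iota_d T w)" c "lie_derivative T (lie_derivative T w)" 0,
      OF T one_form_iota_d[OF T one_form_iota_d[OF T w]] cx(1) 2 iota_d_inner_self cx(2)]
  show ?thesis
    using 3 by (simp add: numeral_3_eq_3)
qed

end

section \<open>The first variation\<close>

lemma time_deriv_const:
  assumes "case_prod (\<lambda>t::real. f) differentiable (at (0, x))"
  shows "time_deriv (\<lambda>t. f) x = 0"
  using vector_derivative_unique_at[OF has_derivative_time_slice[OF assms] has_vector_derivative_const] .

lemma smooth_on_const_family:
  fixes f :: "'a::euclidean_space \<Rightarrow> 'b::real_normed_vector"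
  assumes "open S" "open I" "smooth_on f S"
  shows "smooth_on (case_prod (\<lambda>t::real. f)) (Sigma I (\<lambda>_. S))"
proof -
  have "smooth_on (\<lambda>p. f (snd p)) (Sigma I (\<lambda>_. S))"
    by (rule smooth_on_compose[OF open_Times[OF assms(2,1)] assms(1) _ assms(3) smooth_on_linear[OF bounded_linear_snd]]) auto
  then show ?thesis by (simp add: case_prod_unfold)
qed

context closed_manifold
begin

lemma iota_d_cong:
  assumes "c \<in> A" "x \<in> chart_img c" "\<And>y. y \<in> chart_img c \<Longrightarrow> w c y = w' c y" "T c x = T' c x"
  shows "iota_d T w c x = iota_d T' w' c x"
  unfolding iota_d_def using curl_cong[OF chartD(2)[OF assms(1)] assms(2,3)] assms(4) by simp

lemma one_form_add:
  assumes "one_form A a" "one_form A b"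
  shows "one_form A (\<lambda>c x. a c x + b c x)"
  unfolding one_form_def
proof (intro conjI ballI allI)
  fix c assume "c \<in> A"
  then show "smooth_on (\<lambda>x. a c x + b c x) (chart_img c)"
    by (intro smooth_on_add chartD(2) one_form_smooth assms)
qed (simp add: inner_add_left one_form_change[OF assms(1)] one_form_change[OF assms(2)])

lemma one_form_scaleR:
  assumes "one_form A a"
  shows "one_form A (\<lambda>c x. r *\<^sub>R a c x)"
  unfolding one_form_def
proof (intro conjI ballI allI)
  fix c assume "c \<in> A"
  then show "smooth_on (\<lambda>x. r *\<^sub>R a c x) (chart_img c)"
    by (intro smooth_on_scaleR smooth_on_const chartD(2) one_form_smooth assms)
qed (simp add: one_form_change[OF assms])

section \<open>Derivative of \<open>gv\<close> along a variation\<close>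

context
  fixes \<epsilon> :: real and wt Tt :: "real \<Rightarrow> 'a field"
  assumes \<epsilon>: "\<epsilon> > 0"
    and wt: "\<And>t. \<bar>t\<bar> < \<epsilon> \<Longrightarrow> one_form A (wt t)" and Tt: "\<And>t. \<bar>t\<bar> < \<epsilon> \<Longrightarrow> vector_field A (Tt t)"
    and sm: "smooth_family A \<epsilon> wt" "smooth_family A \<epsilon> Tt"
    and pairing: "\<And>t c x. \<bar>t\<bar> < \<epsilon> \<Longrightarrow> c \<in> A \<Longrightarrow> x \<in> chart_img c \<Longrightarrow> wt t c x \<bullet> Tt t c x = 1"
begin

abbreviation "dwt \<equiv> \<lambda>c. time_deriv (\<lambda>t. wt t c)"
abbreviation "dTt \<equiv> \<lambda>c. time_deriv (\<lambda>t. Tt t c)"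

lemma smooth_families:
  assumes "c \<in> A"
  shows "smooth_on (case_prod (\<lambda>t. wt t c)) (Sigma {-\<epsilon><..<\<epsilon>} (\<lambda>_. chart_img c))"
    "smooth_on (case_prod (\<lambda>t. Tt t c)) (Sigma {-\<epsilon><..<\<epsilon>} (\<lambda>_. chart_img c))"
  using sm assms by (auto simp: smooth_family_def)

lemma families_differentiable:
  assumes "c \<in> A" "x \<in> chart_img c"
  shows "case_prod (\<lambda>t. wt t c) differentiable (at (0, x))"
    "case_prod (\<lambda>t. Tt t c) differentiable (at (0, x))"
  by (rule smooth_on_differentiable[OF smooth_families(1)[OF assms(1)]], use assms \<epsilon> in simp)
    (rule smooth_on_differentiable[OF smooth_families(2)[OF assms(1)]], use assms \<epsilon> in simp)

text \<open>The transition maps do not depend on t, so the transformation law may be differentiated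
  in t.\<close>

lemma time_deriv_one_form: "one_form A dwt"
  unfolding one_form_def
proof (intro conjI ballI allI)
  fix c assume c: "c \<in> A"
  show "smooth_on (dwt c) (chart_img c)"
    by (rule smooth_on_time_deriv[OF chartD(2)[OF c] _ _ smooth_families(1)[OF c]]) (use \<epsilon> in auto)
next
  fix c d x v assume cd: "c \<in> A" "d \<in> A" and x: "x \<in> overlap c d"
  have x': "x \<in> chart_img c" using x overlap_subset[OF cd(1)] by blast
  have "((\<lambda>t. wt t d (transition c d x) \<bullet> Dtransition c d x v) has_vector_derivative
      dwt d (transition c d x) \<bullet> Dtransition c d x v) (at 0)"
    by (rule bounded_linear.has_vector_derivative[OF bounded_linear_inner_left
          has_derivative_time_slice[OF families_differentiable(1)[OF cd(2) transition_in[OF cd x]]]])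
  then have "((\<lambda>t. wt t c x \<bullet> v) has_vector_derivative
      dwt d (transition c d x) \<bullet> Dtransition c d x v) (at 0)"
    by (rule has_vector_derivative_transform_within_open[of _ _ _ "{-\<epsilon><..<\<epsilon>}"])
      (use \<epsilon> one_form_change[OF wt cd x] in \<open>auto simp: abs_less_iff\<close>)
  moreover have "((\<lambda>t. wt t c x \<bullet> v) has_vector_derivative dwt c x \<bullet> v) (at 0)"
    by (rule bounded_linear.has_vector_derivative[OF bounded_linear_inner_left
          has_derivative_time_slice[OF families_differentiable(1)[OF cd(1) x']]])
  ultimately show "dwt c x \<bullet> v = dwt d (transition c d x) \<bullet> Dtransition c d x v"
    using vector_derivative_unique_at by blast
qed

lemma time_deriv_vector_field: "vector_field A dTt"
  unfolding vector_field_def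
proof (intro conjI ballI allI)
  fix c assume c: "c \<in> A"
  show "smooth_on (dTt c) (chart_img c)"
    by (rule smooth_on_time_deriv[OF chartD(2)[OF c] _ _ smooth_families(2)[OF c]]) (use \<epsilon> in auto)
next
  fix c d x assume cd: "c \<in> A" "d \<in> A" and x: "x \<in> overlap c d"
  have x': "x \<in> chart_img c" using x overlap_subset[OF cd(1)] by blast
  have "bounded_linear (Dtransition c d x)"
    using Dtransition_has_derivative[OF cd x] has_derivative_bounded_linear by blast
  then have "((\<lambda>t. Dtransition c d x (Tt t c x)) has_vector_derivative Dtransition c d x (dTt c x)) (at 0)"
    by (rule bounded_linear.has_vector_derivative[OF _
          has_derivative_time_slice[OF families_differentiable(2)[OF cd(1) x']]])
  then have "((\<lambda>t. Tt t d (transition c d x)) has_vector_derivative Dtransition c d x (dTt c x)) (at 0)"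
    by (rule has_vector_derivative_transform_within_open[of _ _ _ "{-\<epsilon><..<\<epsilon>}"])
      (use \<epsilon> vector_field_change[OF Tt cd x] in \<open>auto simp: abs_less_iff\<close>)
  then show "dTt d (transition c d x) = Dtransition c d x (dTt c x)"
    using vector_derivative_unique_at
      [OF has_derivative_time_slice[OF families_differentiable(2)[OF cd(2) transition_in[OF cd x]]]] by blast
qed

lemma time_deriv_pairing:
  assumes "c \<in> A" "x \<in> chart_img c"
  shows "dwt c x \<bullet> Tt 0 c x + wt 0 c x \<bullet> dTt c x = 0"
proof -
  have "((\<lambda>t. wt t c x \<bullet> Tt t c x) has_vector_derivative
      wt 0 c x \<bullet> dTt c x + dwt c x \<bullet> Tt 0 c x) (at 0)"
    by (rule bounded_bilinear.has_vector_derivative[OF bounded_bilinear_inner])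
      (rule has_derivative_time_slice families_differentiable assms)+
  moreover have "((\<lambda>t. wt t c x \<bullet> Tt t c x) has_vector_derivative 0) (at 0)"
    by (rule has_vector_derivative_transform_within_open[OF has_vector_derivative_const[of 1], of "{-\<epsilon><..<\<epsilon>}"])
      (use \<epsilon> pairing[OF _ assms] in \<open>auto simp: abs_less_iff\<close>)
  ultimately show ?thesis
    using vector_derivative_unique_at by fastforce
qed

text \<open>The velocity at t = 0 of \<open>\<iota>_T d\<omega>\<close> along the family, as the
  product rule gives it; written so, it is visibly a global 1-form.\<close>

definition "eta_deriv = (\<lambda>c x. iota_d dTt (wt 0) c x + iota_d (Tt 0) dwt c x)"

lemma one_form_eta_deriv: "one_form A eta_deriv"
  unfolding eta_deriv_def using \<epsilon>
  by (intro one_form_add one_form_iota_d time_deriv_one_form time_deriv_vector_field wt Tt) simp_all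

text \<open>In each chart of the partition the weight confines the integrand to a compact set
  independent of t, which allows differentiation under the integral; the product rule does the
  rest.\<close>

lemma gv_family_has_derivative:
  "((\<lambda>t. gv A (ker_form (wt t)) (Tt t)) has_real_derivative
    integral_M (\<lambda>c x. eta_deriv c x \<bullet> curl (iota_d (Tt 0) (wt 0) c) x
      + iota_d (Tt 0) (wt 0) c x \<bullet> curl (eta_deriv c) x)) (at 0)"
proof -
  define I where "I = {-\<epsilon><..<\<epsilon>}"
  have I: "open I" "0 \<in> I" using \<epsilon> by (auto simp: I_def)
  define G where "G c t x = iota_d (Tt t) (wt t) c x \<bullet> curl (iota_d (Tt t) (wt t) c) x" for c t x
  define G' where "G' c x = eta_deriv c x \<bullet> curl (iota_d (Tt 0) (wt 0) c) x
      + iota_d (Tt 0) (wt 0) c x \<bullet> curl (eta_deriv c) x" for c x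
  have "((\<lambda>t. integral (chart_img c) (\<lambda>x. pou c (chart_inv c x) * G c t x)) has_real_derivative
      integral (chart_img c) (\<lambda>x. pou c (chart_inv c x) * G' c x)) (at 0)" if c: "c \<in> pou_charts" for c
  proof -
    note cA = pou_charts_subset[OF c] and O = chartD(2)[OF pou_charts_subset[OF c]]
    let ?P = "Sigma I (\<lambda>_. chart_img c)"
    have P: "open ?P" by (rule open_Times[OF I(1) O])
    note smW = smooth_families(1)[OF cA, folded I_def] and smT = smooth_families(2)[OF cA, folded I_def]
    define E where "E t x = curl (wt t c) x \<times> Tt t c x" for t x
    have E: "iota_d (Tt t) (wt t) c = E t" for t
      by (simp add: fun_eq_iff iota_d_def E_def)
    have smE: "smooth_on (case_prod E) ?P"
      unfolding E_def[abs_def]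
      by (rule smooth_on_family_bilinear[OF P bounded_bilinear_cross smooth_on_curl_family[OF P smW] smT])
    have smG: "smooth_on (case_prod (G c)) ?P"
      unfolding G_def[abs_def] E
      by (rule smooth_on_family_bilinear[OF P bounded_bilinear_inner smE smooth_on_curl_family[OF P smE]])
    have sm\<rho>: "smooth_on (case_prod (\<lambda>t::real. \<lambda>x. pou c (chart_inv c x))) ?P"
      by (rule smooth_on_const_family[OF O I(1) smooth_on_pou[OF c cA]])
    have in_P: "(0, x) \<in> ?P" if "x \<in> chart_img c" for x using that I by simp
    have dE: "time_deriv E x = eta_deriv c x" if "x \<in> chart_img c" for x
    proof -
      note P0 = in_P[OF that]
      have "time_deriv E x = curl (wt 0 c) x \<times> dTt c x + time_deriv (\<lambda>t. curl (wt t c)) x \<times> Tt 0 c x"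
        unfolding E_def[abs_def]
        by (rule time_deriv_bilinear[OF bounded_bilinear_cross
              smooth_on_differentiable[OF smooth_on_curl_family[OF P smW] P0] smooth_on_differentiable[OF smT P0]])
      then show ?thesis
        by (simp add: time_deriv_curl[OF P P0 smW] eta_deriv_def iota_d_def)
    qed
    have dG: "time_deriv (G c) x = G' c x" if "x \<in> chart_img c" for x
    proof -
      note P0 = in_P[OF that]
      have "time_deriv (G c) x = E 0 x \<bullet> time_deriv (\<lambda>t. curl (E t)) x + time_deriv E x \<bullet> curl (E 0) x"
        unfolding G_def[abs_def] E
        by (rule time_deriv_bilinear[OF bounded_bilinear_inner smooth_on_differentiable[OF smE P0]
              smooth_on_differentiable[OF smooth_on_curl_family[OF P smE] P0]])
      also have "time_deriv (\<lambda>t. curl (E t)) x = curl (time_deriv E) x"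
        by (rule time_deriv_curl[OF P P0 smE])
      also have "\<dots> = curl (eta_deriv c) x"
        by (rule curl_cong[OF O that dE])
      finally show ?thesis
        by (simp add: G'_def E dE[OF that])
    qed
    have "((\<lambda>t. integral (chart_img c) ((\<lambda>t x. pou c (chart_inv c x) * G c t x) t)) has_real_derivative
      integral (chart_img c) (\<lambda>x. fderiv (\<lambda>(t, x). pou c (chart_inv c x) * G c t x) (0, x) (1, 0))) (at 0)"
    proof (rule has_real_derivative_integral_compact_support[OF \<epsilon> O pou_supp(1,2)[OF c]])
      show "smooth_on (\<lambda>(t, x). pou c (chart_inv c x) * G c t x) (Sigma {-\<epsilon><..<\<epsilon>} (\<lambda>_. chart_img c))"
        using smooth_on_family_bilinear[OF P bounded_bilinear_mult sm\<rho> smG] by (simp add: I_def)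
      show "pou c (chart_inv c x) * G c t x = 0" if "x \<in> chart_img c - pou_supp c" for t x
        using pou_supp(3)[OF c that] by simp
    qed
    moreover have "fderiv (\<lambda>(t, x). pou c (chart_inv c x) * G c t x) (0, x) (1, 0)
        = pou c (chart_inv c x) * G' c x" if "x \<in> chart_img c" for x
    proof -
      note P0 = in_P[OF that]
      have "time_deriv (\<lambda>t x. pou c (chart_inv c x) * G c t x) x
          = pou c (chart_inv c x) * time_deriv (G c) x + time_deriv (\<lambda>t x. pou c (chart_inv c x)) x * G c 0 x"
        by (rule time_deriv_bilinear[OF bounded_bilinear_mult smooth_on_differentiable[OF sm\<rho> P0]
              smooth_on_differentiable[OF smG P0]])
      also have "time_deriv (\<lambda>t x. pou c (chart_inv c x)) x = 0"
        by (rule time_deriv_const[OF smooth_on_differentiable[OF sm\<rho> P0]])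
      finally show ?thesis
        unfolding time_deriv_def[of "\<lambda>t x. pou c (chart_inv c x) * G c t x"] using dG[OF that] by simp
    qed
    then have "integral (chart_img c) (\<lambda>x. fderiv (\<lambda>(t, x). pou c (chart_inv c x) * G c t x) (0, x) (1, 0))
      = integral (chart_img c) (\<lambda>x. pou c (chart_inv c x) * G' c x)"
      by (rule integral_cong)
    ultimately show ?thesis by simp
  qed
  then have "((\<lambda>t. integral_M (\<lambda>c. G c t)) has_real_derivative integral_M G') (at 0)"
    unfolding integral_M_def by (rule DERIV_sum)
  then have "((\<lambda>t. gv A (ker_form (wt t)) (Tt t)) has_real_derivative integral_M G') (at 0)"
  proof (rule has_field_derivative_transform_within_open[OF _ I])
    fix t assume "t \<in> I"
    then have t: "\<bar>t\<bar> < \<epsilon>" by (auto simp: I_def)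
    show "integral_M (\<lambda>c. G c t) = gv A (ker_form (wt t)) (Tt t)"
      unfolding G_def by (rule gv_ker_form[OF wt[OF t] pairing[OF t] Tt[OF t], symmetric])
  qed
  then show ?thesis by (simp add: G'_def[abs_def])
qed

end

section \<open>The first variation modulo exact forms\<close>

lemma integral_first_variation:
  assumes w: "one_form A w" and T: "vector_field A T" and a: "one_form A a" and X: "vector_field A X"
    and wT: "\<And>c x. c \<in> A \<Longrightarrow> x \<in> chart_img c \<Longrightarrow> w c x \<bullet> T c x = 1"
    and int: "\<And>c x. c \<in> A \<Longrightarrow> x \<in> chart_img c \<Longrightarrow> w c x \<bullet> curl (w c) x = 0"
    and aX: "\<And>c x. c \<in> A \<Longrightarrow> x \<in> chart_img c \<Longrightarrow> a c x \<bullet> T c x + w c x \<bullet> X c x = 0"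
    and b: "b = (\<lambda>c x. iota_d X w c x + iota_d T a c x)"
  defines "e \<equiv> iota_d T w"
  defines "z \<equiv> iota_d T e"
  shows "integral_M (\<lambda>c x. b c x \<bullet> curl (e c) x + e c x \<bullet> curl (b c) x)
    = - 2 * integral_M (\<lambda>c x. a c x \<bullet> (w c x \<times> iota_d T z c x))"
proof -
  note forms = one_form_iota_d[OF T]
  have e: "one_form A e" unfolding e_def by (rule forms[OF w])
  have z: "one_form A z" unfolding z_def by (rule forms[OF e])
  have b': "one_form A b" unfolding b
    by (rule one_form_add[OF one_form_iota_d[OF X w] forms[OF a]])
  \<comment> \<open>Moving d from \<open>b\<close> to \<open>e\<close> costs d (e \<and> b) and
    doubles \<open>b \<bullet> curl e\<close>; then \<open>variation_identity\<close> rewrites this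
    term at the cost of d (a \<and> z). That explains the coefficients -2 and -1 of the two exact
    forms.\<close>
  have pointwise: "b c x \<bullet> curl (e c) x + e c x \<bullet> curl (b c) x
      = (-2) * (a c x \<bullet> (w c x \<times> iota_d T z c x))
        + ((-2) * dvg (\<lambda>x. a c x \<times> z c x) x + (-1) * dvg (\<lambda>x. e c x \<times> b c x) x)"
    if c: "c \<in> A" "x \<in> chart_img c" for c x
  proof -
    note O = chartD(2)[OF c(1)]
    note diff = one_form_differentiable[OF _ c]
    have e': "e c = (\<lambda>y. curl (w c) y \<times> T c y)" and z': "z c = (\<lambda>y. curl (e c) y \<times> T c y)"
      by (simp_all add: fun_eq_iff e_def z_def iota_d_def)
    have ids: "curl (e c) x = w c x \<times> z c x" "w c x \<bullet> curl (z c) x = curl (w c) x \<bullet> z c x"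
      using integrable_form_identities[OF O c(2) one_form_smooth[OF w c(1)] vector_field_smooth[OF T c(1)]
          wT[OF c(1)] int[OF c(1)]] unfolding e' z' by auto
    have "(curl (w c) x \<times> X c x + curl (a c) x \<times> T c x) \<bullet> curl (e c) x =
        - (a c x \<bullet> (w c x \<times> (curl (z c) x \<times> T c x))) - curl (a c) x \<bullet> z c x + a c x \<bullet> curl (z c) x"
      by (rule variation_identity[OF wT[OF c] aX[OF c] _ int[OF c] ids]) (simp add: z')
    moreover have "dvg (\<lambda>x. a c x \<times> z c x) x = curl (a c) x \<bullet> z c x - a c x \<bullet> curl (z c) x"
      by (rule dvg_cross[OF diff[OF a] diff[OF z]])
    moreover have "dvg (\<lambda>x. e c x \<times> b c x) x = curl (e c) x \<bullet> b c x - e c x \<bullet> curl (b c) x"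
      by (rule dvg_cross[OF diff[OF e] diff[OF b']])
    moreover have "b c x = curl (w c) x \<times> X c x + curl (a c) x \<times> T c x"
      by (simp add: b iota_d_def)
    ultimately show ?thesis
      by (simp add: iota_d_def inner_commute)
  qed
  have cont1: "continuous_on (chart_img c) (\<lambda>x. (-2) * (a c x \<bullet> (w c x \<times> iota_d T z c x)))" if "c \<in> A" for c
    using density_one_forms[OF a w forms[OF z]] that by (intro continuous_on_mult) (auto simp: density_def)
  have cont2: "continuous_on (chart_img c) (\<lambda>x. r * dvg (\<lambda>x. f c x \<times> g c x) x)"
    if "one_form A f" "one_form A g" "c \<in> A" for r f g c
    by (intro continuous_on_mult continuous_on_const smooth_on_imp_continuous_on smooth_on_dvg smooth_on_cross
        chartD(2) one_form_smooth that)
  have "integral_M (\<lambda>c x. b c x \<bullet> curl (e c) x + e c x \<bullet> curl (b c) x)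
    = integral_M (\<lambda>c x. (-2) * (a c x \<bullet> (w c x \<times> iota_d T z c x))
        + ((-2) * dvg (\<lambda>x. a c x \<times> z c x) x + (-1) * dvg (\<lambda>x. e c x \<times> b c x) x))"
    by (rule integral_M_cong) (rule pointwise)
  also have "\<dots> = integral_M (\<lambda>c x. (-2) * (a c x \<bullet> (w c x \<times> iota_d T z c x)))
      + integral_M (\<lambda>c x. (-2) * dvg (\<lambda>x. a c x \<times> z c x) x + (-1) * dvg (\<lambda>x. e c x \<times> b c x) x)"
    by (rule integral_M_add[OF cont1 continuous_on_add[OF cont2[OF a z] cont2[OF e b']]])
  also have "integral_M (\<lambda>c x. (-2) * dvg (\<lambda>x. a c x \<times> z c x) x + (-1) * dvg (\<lambda>x. e c x \<times> b c x) x)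
      = integral_M (\<lambda>c x. (-2) * dvg (\<lambda>x. a c x \<times> z c x) x) + integral_M (\<lambda>c x. (-1) * dvg (\<lambda>x. e c x \<times> b c x) x)"
    by (rule integral_M_add[OF cont2[OF a z] cont2[OF e b']])
  finally show ?thesis
    unfolding integral_M_cmult using stokes[OF a z] stokes[OF e b'] by simp
qed

section \<open>Test forms supported in one chart\<close>

text \<open>The 1-form \<open>g \<gamma>\<close> prescribed in chart \<open>c\<close>, seen from
  chart \<open>d\<close> by pull-back along the transition map and extended by zero.\<close>

definition local_form :: "'a chart \<Rightarrow> ('a \<Rightarrow> real) \<Rightarrow> (real^3 \<Rightarrow> real^3) \<Rightarrow> 'a field" where
  "local_form c g \<gamma> d y = (if y \<in> overlap d c then
     (\<chi> i. g (chart_inv d y) * (\<gamma> (transition d c y) \<bullet> Dtransition d c y (axis i 1))) else 0)"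

context
  fixes c :: "'a chart" and g :: "'a \<Rightarrow> real" and \<gamma> :: "real^3 \<Rightarrow> real^3"
  assumes c: "c \<in> A" and g: "smooth_function A g" and supp: "closure {p. g p \<noteq> 0} \<subseteq> fst c"
    and \<gamma>: "smooth_on \<gamma> (chart_img c)"
begin

lemma local_form_inner:
  assumes "d \<in> A"
  shows "local_form c g \<gamma> d y \<bullet> v = (if y \<in> overlap d c then
     g (chart_inv d y) * (\<gamma> (transition d c y) \<bullet> Dtransition d c y v) else 0)"
proof -
  have "(\<chi> i. g (chart_inv d y) * (\<gamma> (transition d c y) \<bullet> Dtransition d c y (axis i 1))) \<bullet> v
      = g (chart_inv d y) * (\<gamma> (transition d c y) \<bullet> Dtransition d c y v)" if y: "y \<in> overlap d c"
  proof -
    have "linear (Dtransition d c y)"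
      using Dtransition_has_derivative[OF assms c y] has_derivative_linear by blast
    from linear_axis_expand[OF this, of v] show ?thesis
      by (simp add: inner_vec_def[of "\<chi> i. _ i"] inner_sum_right sum_distrib_left algebra_simps)
  qed
  then show ?thesis by (simp add: local_form_def)
qed

lemma local_form_self: "y \<in> chart_img c \<Longrightarrow> local_form c g \<gamma> c y = g (chart_inv c y) *\<^sub>R \<gamma> y"
  using local_form_inner[OF c, of y] overlap_self[OF c] Dtransition_self[OF c, of y] transition_self[OF c, of y]
  by (intro vector_eq_rdot[THEN iffD1]) simp

lemma local_form_eq_0: "g (chart_inv d y) = 0 \<Longrightarrow> local_form c g \<gamma> d y = 0"
  by (simp add: local_form_def vec_eq_iff)

lemma local_form_near_0:
  assumes "d \<in> A" "y \<in> chart_img d" "chart_inv d y \<notin> closure {p. g p \<noteq> 0}"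
  obtains U where "open U" "y \<in> U" "\<And>y'. y' \<in> U \<Longrightarrow> local_form c g \<gamma> d y' = 0"
proof (rule that)
  let ?U = "{x \<in> chart_img d. chart_inv d x \<in> - closure {p. g p \<noteq> 0}}"
  show "open ?U" by (rule open_chart_preimage[OF assms(1)]) (rule open_Compl[OF closed_closure])
  show "y \<in> ?U" using assms by simp
  show "local_form c g \<gamma> d y' = 0" if "y' \<in> ?U" for y'
    using that closure_subset[of "{p. g p \<noteq> 0}"] by (intro local_form_eq_0) blast
qed

lemma one_form_local_form: "one_form A (local_form c g \<gamma>)"
  unfolding one_form_def
proof (intro conjI ballI allI)
  fix d assume d: "d \<in> A"
  let ?f = "\<lambda>y. \<chi> i. g (chart_inv d y) * (\<gamma> (transition d c y) \<bullet> Dtransition d c y (axis i 1))"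
  have "smooth_on (\<lambda>y. if y \<in> overlap d c then ?f y else 0) (chart_img d)"
  proof (rule smooth_on_cut_off[OF c d closed_closure supp])
    note O = open_overlap[OF d c]
    have "smooth_on (\<lambda>y. g (chart_inv d y)) (overlap d c)"
      using smooth_on_subset[OF smooth_functionD[OF g d] overlap_subset[OF d]] .
    moreover have "smooth_on (\<lambda>y. \<gamma> (transition d c y)) (overlap d c)"
      using transition_in[OF d c]
      by (intro smooth_on_compose[OF O chartD(2)[OF c] _ \<gamma> smooth_on_transition[OF d c]]) auto
    ultimately show "smooth_on ?f (overlap d c)"
      by (intro smooth_on_vec[OF O])
        (simp add: smooth_on_mult smooth_on_inner smooth_on_frechet[OF smooth_on_transition[OF d c]] O)
    show "?f y = 0" if "chart_inv d y \<notin> closure {p. g p \<noteq> 0}" for y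
    proof -
      have "g (chart_inv d y) = 0"
        using that closure_subset[of "{p. g p \<noteq> 0}"] by blast
      then show ?thesis by (simp add: vec_eq_iff)
    qed
  qed
  then show "smooth_on (local_form c g \<gamma> d) (chart_img d)"
    by (simp add: local_form_def[abs_def])
next
  fix d e y v assume de: "d \<in> A" "e \<in> A" and y: "y \<in> overlap d e"
  show "local_form c g \<gamma> d y \<bullet> v = local_form c g \<gamma> e (transition d e y) \<bullet> Dtransition d e y v"
    unfolding local_form_inner[OF de(1)] local_form_inner[OF de(2)] overlap_transition[OF de y]
    using transition_compose[OF de y] chart_inv_transition[OF de y] Dtransition_compose[OF de c y] by simp
qed

lemma local_form_vector_field:
  assumes T: "vector_field A T" and \<gamma>T: "\<And>y. y \<in> chart_img c \<Longrightarrow> \<gamma> y \<bullet> T c y = 0" and d: "d \<in> A"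
  shows "local_form c g \<gamma> d y \<bullet> T d y = 0"
  using \<gamma>T[OF transition_in[OF d c, of y]] vector_field_change[OF T d c, of y, symmetric]
  by (simp add: local_form_inner[OF d])

end

section \<open>Straight-line variations with fixed T\<close>

text \<open>As \<beta> (T) = 0, the normalisation holds for every t without moving T; the bound 1 is
  arbitrary.\<close>

lemma variation_line:
  assumes D: "plane_field A D" and T: "vector_field A T" and tr: "transverse A T D"
    and \<beta>: "one_form A \<beta>" and \<beta>T: "\<And>c x. c \<in> A \<Longrightarrow> x \<in> chart_img c \<Longrightarrow> \<beta> c x \<bullet> T c x = 0"
  shows "variation A D T 1 (\<lambda>t c x. dual_form D T c x + t *\<^sub>R \<beta> c x) (\<lambda>_. T)"
proof -
  note w = one_form_dual_form[OF D T tr]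
  have "smooth_on (\<lambda>(t, x). T c x) (Sigma {-1<..<1::real} (\<lambda>_. chart_img c))" 
    "smooth_on (\<lambda>(t, x). dual_form D T c x + t *\<^sub>R \<beta> c x) (Sigma {-1<..<1::real} (\<lambda>_. chart_img c))" if c: "c \<in> A" for c
  proof -
    note O = chartD(2)[OF c]
    have P: "open (Sigma {-1<..<1::real} (\<lambda>_. chart_img c))" by (rule open_Times) (simp_all add: O)
    note fam = smooth_on_const_family[OF O open_greaterThanLessThan[of "-1" 1]]
    show "smooth_on (\<lambda>(t, x). T c x) (Sigma {-1<..<1::real} (\<lambda>_. chart_img c))"
      using fam[OF vector_field_smooth[OF T c]] .
    show "smooth_on (\<lambda>(t, x). dual_form D T c x + t *\<^sub>R \<beta> c x) (Sigma {-1<..<1::real} (\<lambda>_. chart_img c))"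
      using smooth_on_add[OF P fam[OF one_form_smooth[OF w c]]
          smooth_on_scaleR[OF P smooth_on_linear[OF bounded_linear_fst] fam[OF one_form_smooth[OF \<beta> c]]]]
      by (simp add: case_prod_unfold)
  qed
  then show ?thesis
    using T one_form_add[OF w one_form_scaleR[OF \<beta>]] \<beta>T dual_form_props(1)[OF D T tr]
    by (simp add: variation_def smooth_family_def inner_add_left)
qed

lemma gv_line:
  assumes T: "vector_field A T" and w: "one_form A w" and \<beta>: "one_form A \<beta>"
    and wT: "\<And>c x. c \<in> A \<Longrightarrow> x \<in> chart_img c \<Longrightarrow> w c x \<bullet> T c x = 1"
    and \<beta>T: "\<And>c x. c \<in> A \<Longrightarrow> x \<in> chart_img c \<Longrightarrow> \<beta> c x \<bullet> T c x = 0"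
  defines "e \<equiv> iota_d T w" and "b \<equiv> iota_d T \<beta>"
  shows "gv A (ker_form (\<lambda>c x. w c x + t *\<^sub>R \<beta> c x)) T
    = integral_wedge_d e
      + (t * integral_M (\<lambda>c x. e c x \<bullet> curl (b c) x + b c x \<bullet> curl (e c) x)
      + t\<^sup>2 * integral_wedge_d b)"
proof -
  have e: "one_form A e" and b: "one_form A b"
    unfolding e_def b_def by (rule one_form_iota_d[OF T w] one_form_iota_d[OF T \<beta>])+
  let ?w = "\<lambda>c x. w c x + t *\<^sub>R \<beta> c x"
  have *: "iota_d T ?w c x = e c x + t *\<^sub>R b c x" if c: "c \<in> A" "x \<in> chart_img c" for c x
  proof -
    have "curl (\<lambda>x. w c x + t *\<^sub>R \<beta> c x) x = curl (w c) x + t *\<^sub>R curl (\<beta> c) x"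
      using one_form_differentiable[OF w c] one_form_differentiable[OF \<beta> c]
      by (simp add: curl_add curl_cmult differentiable_cmult_right_iff)
    then show ?thesis
      by (simp add: iota_d_def e_def b_def cross_add_left cross_mult_left)
  qed
  have "iota_d T ?w c x \<bullet> curl (iota_d T ?w c) x = e c x \<bullet> curl (e c) x
      + (t * (e c x \<bullet> curl (b c) x + b c x \<bullet> curl (e c) x) + t\<^sup>2 * (b c x \<bullet> curl (b c) x))"
    if c: "c \<in> A" "x \<in> chart_img c" for c x
  proof -
    have "curl (iota_d T ?w c) x = curl (\<lambda>x. e c x + t *\<^sub>R b c x) x"
      by (rule curl_cong[OF chartD(2)[OF c(1)] c(2) *[OF c(1)]])
    also have "\<dots> = curl (e c) x + t *\<^sub>R curl (b c) x"
      using one_form_differentiable[OF e c] one_form_differentiable[OF b c]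
      by (simp add: curl_add curl_cmult)
    finally show ?thesis
      unfolding *[OF c] by (simp add: inner_add_left inner_add_right power2_eq_square algebra_simps)
  qed
  note eq = integral_M_cong[OF this]
  have cont: "continuous_on (chart_img c) (\<lambda>x. f c x \<bullet> curl (h c) x)"
    if "one_form A f" "one_form A h" "c \<in> A" for f h c
    using density_one_form_curl[OF that(1,2)] that(3) by (simp add: density_def)
  have "gv A (ker_form ?w) T = integral_wedge_d (iota_d T ?w)"
    using wT \<beta>T by (intro gv_ker_form one_form_add w one_form_scaleR \<beta> T) (simp add: inner_add_left)
  also have "\<dots> = integral_M (\<lambda>c x. e c x \<bullet> curl (e c) x
      + (t * (e c x \<bullet> curl (b c) x + b c x \<bullet> curl (e c) x) + t\<^sup>2 * (b c x \<bullet> curl (b c) x)))"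
    by (rule eq)
  also have "\<dots> = integral_wedge_d e
      + integral_M (\<lambda>c x. t * (e c x \<bullet> curl (b c) x + b c x \<bullet> curl (e c) x) + t\<^sup>2 * (b c x \<bullet> curl (b c) x))"
    by (rule integral_M_add) (intro cont e b continuous_on_add continuous_on_mult continuous_on_const; assumption)+
  also have "integral_M (\<lambda>c x. t * (e c x \<bullet> curl (b c) x + b c x \<bullet> curl (e c) x) + t\<^sup>2 * (b c x \<bullet> curl (b c) x))
      = integral_M (\<lambda>c x. t * (e c x \<bullet> curl (b c) x + b c x \<bullet> curl (e c) x)) + integral_M (\<lambda>c x. t\<^sup>2 * (b c x \<bullet> curl (b c) x))"
    by (rule integral_M_add) (intro cont e b continuous_on_add continuous_on_mult continuous_on_const; assumption)+
  finally show ?thesis by (simp only: integral_M_cmult)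
qed

end

section \<open>The second variation\<close>

text \<open>The real part of \<open>exp (- i (k \<bullet> x + \<theta>)) (F + i G)\<close>. Raising
  \<theta> by a quarter turn replaces (cos, sin) by (- sin, cos).\<close>

definition rotating :: "real^3 \<Rightarrow> real \<Rightarrow> (real^3 \<Rightarrow> real^3) \<Rightarrow> (real^3 \<Rightarrow> real^3) \<Rightarrow> real^3 \<Rightarrow> real^3" where
  "rotating k \<theta> F G x = cos (k \<bullet> x + \<theta>) *\<^sub>R F x + sin (k \<bullet> x + \<theta>) *\<^sub>R G x"

text \<open>Such waves are stable under \<open>curl\<close>: differentiating the phase mixes the two
  amplitudes through \<open>k\<close>.\<close>

lemma curl_rotating:
  assumes "F differentiable (at x)" "G differentiable (at x)"
  shows "curl (rotating k \<theta> F G) x = rotating k \<theta> (\<lambda>x. curl F x + k \<times> G x) (\<lambda>x. curl G x - k \<times> F x) x"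
proof -
  have c: "((\<lambda>x. cos (k \<bullet> x + \<theta>)) has_derivative (\<lambda>v. - sin (k \<bullet> x + \<theta>) * (k \<bullet> v))) (at x)"
    and s: "((\<lambda>x. sin (k \<bullet> x + \<theta>)) has_derivative (\<lambda>v. cos (k \<bullet> x + \<theta>) * (k \<bullet> v))) (at x)"
    by (auto intro!: derivative_eq_intros simp: fun_eq_iff)
  have gc: "grad (\<lambda>x. cos (k \<bullet> x + \<theta>)) x = - sin (k \<bullet> x + \<theta>) *\<^sub>R k"
    and gs: "grad (\<lambda>x. sin (k \<bullet> x + \<theta>)) x = cos (k \<bullet> x + \<theta>) *\<^sub>R k"
    by (simp_all add: grad_def vec_eq_iff frechet_derivative_at[OF c, symmetric]
        frechet_derivative_at[OF s, symmetric] flip: cart_eq_inner_axis)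
  note dc = differentiableI[OF c] and ds = differentiableI[OF s]
  show ?thesis
    unfolding rotating_def curl_scaleR[OF dc assms(1)] curl_scaleR[OF ds assms(2)] gc gs
      curl_add[OF differentiable_scaleR[OF dc assms(1)] differentiable_scaleR[OF ds assms(2)]]
    by (simp add: cross_mult_left algebra_simps)
qed

lemma smooth_on_rotating:
  assumes "open S" "smooth_on F S" "smooth_on G S"
  shows "smooth_on (rotating k \<theta> F G) S"
proof -
  have h: "smooth_on (\<lambda>x. k \<bullet> x + \<theta>) S"
    by (intro smooth_on_add smooth_on_const smooth_on_linear bounded_linear_inner_right assms)
  show ?thesis
    unfolding rotating_def[abs_def]
    by (intro smooth_on_add[OF assms(1) smooth_on_scaleR smooth_on_scaleR] smooth_on_cos smooth_on_sin h assms)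
qed

text \<open>Averaging over the two phases \<open>\<theta> = 0\<close> and \<open>\<theta> = pi / 2\<close> removes all oscillating terms.\<close>

lemma rotating_average:
  fixes F G T :: "real^3 \<Rightarrow> real^3" and k :: "real^3"
  assumes S: "open S" "x \<in> S" and sm: "smooth_on F S" "smooth_on G S" "smooth_on T S"
    and FT: "\<And>y. y \<in> S \<Longrightarrow> F y \<bullet> T y = 0" and GT: "\<And>y. y \<in> S \<Longrightarrow> G y \<bullet> T y = 0"
  defines "b \<equiv> \<lambda>\<theta> x. curl (rotating k \<theta> F G) x \<times> T x"
  defines "U \<equiv> \<lambda>x. curl F x \<times> T x + (k \<bullet> T x) *\<^sub>R G x"
  defines "U' \<equiv> \<lambda>x. curl G x \<times> T x - (k \<bullet> T x) *\<^sub>R F x"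
  shows "b 0 x \<bullet> curl (b 0) x + b (pi/2) x \<bullet> curl (b (pi/2)) x
    = U x \<bullet> curl U x + U' x \<bullet> curl U' x + 2 * (k \<bullet> (U' x \<times> U x))"
proof -
  have kT: "smooth_on (\<lambda>x. k \<bullet> T x) S"
    by (intro smooth_on_inner smooth_on_const S sm)
  have U: "smooth_on U S" "smooth_on U' S"
    unfolding U_def U'_def
    by (intro smooth_on_add smooth_on_diff smooth_on_cross smooth_on_curl smooth_on_scaleR kT S sm)+
  \<comment> \<open>Contraction with T preserves the wave form. In
    \<open>(k \<times> G) \<times> T\<close> the part along \<open>k\<close> carries the factor
    \<open>G \<bullet> T = 0\<close>, and what remains is
    \<open>(k \<bullet> T) *\<^sub>R G\<close>; likewise for \<open>F\<close>.\<close>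
  have b: "b \<theta> y = rotating k \<theta> U U' y" if "y \<in> S" for \<theta> y
  proof -
    have swap: "(u \<times> v) \<times> t = (u \<bullet> t) *\<^sub>R v - (v \<bullet> t) *\<^sub>R u" for u v t :: "real^3"
      by (simp add: cross3_simps forall_3)
    show ?thesis
      unfolding b_def curl_rotating[OF smooth_on_differentiable[OF sm(1) that] smooth_on_differentiable[OF sm(2) that]]
      by (simp add: rotating_def U_def U'_def cross_add_left cross_mult_left Cross3.left_diff_distrib swap
          FT[OF that] GT[OF that])
  qed
  have curl_b: "curl (b \<theta>) x = rotating k \<theta> (\<lambda>x. curl U x + k \<times> U' x) (\<lambda>x. curl U' x - k \<times> U x) x" for \<theta>
    using curl_cong[OF S, of "b \<theta>" "rotating k \<theta> U U'"] b
      curl_rotating[OF smooth_on_differentiable[OF U(1) S(2)] smooth_on_differentiable[OF U(2) S(2)]] by simp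
  have avg: "(c *\<^sub>R u + s *\<^sub>R u') \<bullet> (c *\<^sub>R v + s *\<^sub>R v') + ((-s) *\<^sub>R u + c *\<^sub>R u') \<bullet> ((-s) *\<^sub>R v + c *\<^sub>R v')
      = (c\<^sup>2 + s\<^sup>2) * (u \<bullet> v + u' \<bullet> v')" for c s and u u' v v' :: "real^3"
    by (simp add: inner_add_left inner_add_right power2_eq_square algebra_simps)
  have "b 0 x \<bullet> curl (b 0) x + b (pi/2) x \<bullet> curl (b (pi/2)) x
      = U x \<bullet> (curl U x + k \<times> U' x) + U' x \<bullet> (curl U' x - k \<times> U x)"
    using avg[of "cos (k \<bullet> x)" "U x" "sin (k \<bullet> x)" "U' x" "curl U x + k \<times> U' x" "curl U' x - k \<times> U x"]
    by (simp add: b[OF S(2)] curl_b rotating_def cos_add sin_add)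
  also have "\<dots> = U x \<bullet> curl U x + U' x \<bullet> curl U' x + 2 * (k \<bullet> (U' x \<times> U x))"
    by (simp add: inner_add_right inner_diff_right) (simp add: cross3_simps)
  finally show ?thesis .
qed

lemma cubic_positive_value:
  fixes a3 a2 a1 a0 :: real
  assumes "a3 \<noteq> 0"
  obtains N where "0 < N ^ 3 * a3 + N\<^sup>2 * a2 + N * a1 + a0"
proof -
  define s where "s = \<bar>a2\<bar> + \<bar>a1\<bar> + \<bar>a0\<bar>"
  \<comment> \<open>With this size the cubic term equals
    \<open>M\<^sup>2 * (\<bar>a3\<bar> + s)\<close>, while the lower terms are at most
    \<open>M\<^sup>2 * s\<close>. The sign of \<open>N\<close> is that of \<open>a3\<close>.\<close>
  define M where "M = 1 + s / \<bar>a3\<bar>"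
  define N where "N = sgn a3 * M"
  have M: "M \<ge> 1" using assms by (simp add: M_def s_def)
  have sgn: "sgn a3 * sgn a3 = 1" using assms by (simp add: sgn_if)
  then have N2: "N\<^sup>2 = M\<^sup>2" by (simp add: N_def power2_eq_square)
  have "M\<^sup>2 \<ge> M" "M\<^sup>2 \<ge> 1"
    using M by (simp_all add: power2_eq_square mult_le_cancel_left1 mult_ge1_I)
  have "\<bar>N\<^sup>2 * a2\<bar> = M\<^sup>2 * \<bar>a2\<bar>" by (simp add: N2 abs_mult)
  moreover have "\<bar>N * a1\<bar> \<le> M\<^sup>2 * \<bar>a1\<bar>"
    using M \<open>M\<^sup>2 \<ge> M\<close> assms by (simp add: N_def abs_mult mult_right_mono)
  moreover have "\<bar>a0\<bar> \<le> M\<^sup>2 * \<bar>a0\<bar>"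
    using mult_right_mono[OF \<open>M\<^sup>2 \<ge> 1\<close>, of "\<bar>a0\<bar>"] by simp
  moreover have "N ^ 3 * a3 - M\<^sup>2 * s = M\<^sup>2 * \<bar>a3\<bar>"
  proof -
    have "N ^ 3 * a3 = M\<^sup>2 * (M * \<bar>a3\<bar>)"
      using N2 assms by (simp add: power3_eq_cube power2_eq_square N_def abs_sgn mult_ac)
    also have "M * \<bar>a3\<bar> = \<bar>a3\<bar> + s"
      using assms by (simp add: M_def field_simps)
    finally show ?thesis by (simp add: algebra_simps)
  qed
  moreover have "M\<^sup>2 * s = M\<^sup>2 * \<bar>a2\<bar> + M\<^sup>2 * \<bar>a1\<bar> + M\<^sup>2 * \<bar>a0\<bar>"
    by (simp add: s_def algebra_simps)
  moreover have "M\<^sup>2 * \<bar>a3\<bar> > 0" using assms M by simp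
  ultimately show thesis by (intro that[of N]) linarith
qed

text \<open>The amplitudes \<open>T \<times> a\<close> and \<open>T \<times> b\<close> are
  annihilated by T, and with \<open>k = a \<times> b\<close> the coefficient of \<open>N ^ 3\<close>
  becomes -2 times the integral of \<open>(k \<bullet> T) ^ 4 * \<phi>\<^sup>2\<close>, which is
  nonzero. The factor \<open>s\<close> prescribes the sign.\<close>

lemma rotating_integral_sign:
  fixes T :: "real^3 \<Rightarrow> real^3" and \<phi> :: "real^3 \<Rightarrow> real"
  assumes S: "open S" and sm: "smooth_on T S" "smooth_on \<phi> S"
    and K: "compact K" "K \<subseteq> S" "\<And>x. x \<in> S - K \<Longrightarrow> \<phi> x = 0"
    and x0: "x0 \<in> S" "\<phi> x0 \<noteq> 0" "(a \<times> b) \<bullet> T x0 \<noteq> 0"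
    and s: "s \<noteq> 0"
  defines "\<gamma> \<equiv> \<lambda>N \<theta>. rotating (N *\<^sub>R (a \<times> b)) \<theta> (\<lambda>x. \<phi> x *\<^sub>R (T x \<times> a)) (\<lambda>x. \<phi> x *\<^sub>R (T x \<times> b))"
  defines "\<delta> \<equiv> \<lambda>N \<theta> x. curl (\<gamma> N \<theta>) x \<times> T x"
  defines "Q \<equiv> \<lambda>N \<theta>. integral S (\<lambda>x. \<delta> N \<theta> x \<bullet> curl (\<delta> N \<theta>) x)"
  shows "\<exists>N \<theta>. s * Q N \<theta> > 0"
proof -
  define k where "k = a \<times> b"
  define F where "F x = \<phi> x *\<^sub>R (T x \<times> a)" for x
  define G where "G x = \<phi> x *\<^sub>R (T x \<times> b)" for x
  define \<tau> where "\<tau> x = k \<bullet> T x" for x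
  \<comment> \<open>The contracted wave has amplitudes \<open>q + N p\<close> and
    \<open>q' + N p'\<close>; this splitting sorts the averaged integrand by powers of
    \<open>N\<close>.\<close>
  define p q p' q' where "p x = \<tau> x *\<^sub>R G x" and "q x = curl F x \<times> T x"
    and "p' x = (- \<tau> x) *\<^sub>R F x" and "q' x = curl G x \<times> T x" for x
  have smFG: "smooth_on F S" "smooth_on G S"
    unfolding F_def G_def by (intro smooth_on_scaleR smooth_on_cross smooth_on_const S sm)+
  have smpq: "smooth_on p S" "smooth_on q S" "smooth_on p' S" "smooth_on q' S"
    unfolding p_def q_def p'_def q'_def \<tau>_def
    by (intro smooth_on_scaleR smooth_on_minus smooth_on_inner smooth_on_const smooth_on_cross smooth_on_curl smFG S sm)+
  have FT: "F x \<bullet> T x = 0" "G x \<bullet> T x = 0" for x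
    by (simp_all add: F_def G_def dot_cross_self)
  have SK: "open (S - K)" by (rule open_Diff[OF S compact_imp_closed[OF K(1)]])
  have curl0: "curl H x = 0" if "x \<in> S - K" "\<And>y. y \<in> S - K \<Longrightarrow> H y = 0" for H x
    using curl_cong[OF SK that(1), of H "\<lambda>_. 0"] that(2) by (simp add: curl_def)
  have zero: "p x = 0" "q x = 0" "p' x = 0" "q' x = 0" if "x \<in> S - K" for x
    using curl0[OF that, of F] curl0[OF that, of G] K(3) that
    by (simp_all add: p_def q_def p'_def q'_def F_def G_def)
  define f3 where "f3 x = 2 * (k \<bullet> (p' x \<times> p x))" for x
  define f2 where "f2 x = p x \<bullet> curl p x + p' x \<bullet> curl p' x + 2 * (k \<bullet> (p' x \<times> q x)) + 2 * (k \<bullet> (q' x \<times> p x))" for x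
  define f1 where "f1 x = p x \<bullet> curl q x + q x \<bullet> curl p x + p' x \<bullet> curl q' x + q' x \<bullet> curl p' x + 2 * (k \<bullet> (q' x \<times> q x))" for x
  define f0 where "f0 x = q x \<bullet> curl q x + q' x \<bullet> curl q' x" for x
  have integrable: "f integrable_on S" if "smooth_on f S" "\<And>x. x \<in> S - K \<Longrightarrow> f x = 0" for f :: "real^3 \<Rightarrow> real"
    by (rule integrable_compact_support[OF S smooth_on_imp_continuous_on[OF that(1)] K(1,2) that(2)])
  note smooth_intros = smooth_on_add smooth_on_mult smooth_on_inner smooth_on_cross smooth_on_const smooth_on_curl S smpq
  have smf: "smooth_on f3 S" "smooth_on f2 S" "smooth_on f1 S" "smooth_on f0 S"
    unfolding f3_def f2_def f1_def f0_def by (intro smooth_intros)+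
  have zf: "f3 x = 0" "f2 x = 0" "f1 x = 0" "f0 x = 0" if "x \<in> S - K" for x
    by (simp_all add: f3_def f2_def f1_def f0_def zero[OF that])
  note int_f = integrable[OF smf(1) zf(1)] integrable[OF smf(2) zf(2)] integrable[OF smf(3) zf(3)] integrable[OF smf(4) zf(4)]
  have \<gamma>: "\<gamma> N \<theta> = rotating (N *\<^sub>R k) \<theta> F G" for N \<theta>
    by (simp add: \<gamma>_def F_def[abs_def] G_def[abs_def] k_def)
  have sm\<delta>: "smooth_on (\<delta> N \<theta>) S" for N \<theta>
    unfolding \<delta>_def \<gamma> by (intro smooth_on_cross smooth_on_curl smooth_on_rotating S sm smFG)
  have z\<delta>: "\<delta> N \<theta> x = 0" if "x \<in> S - K" for N \<theta> x
    using curl0[OF that, of "\<gamma> N \<theta>"] K(3) by (simp add: \<delta>_def \<gamma>_def rotating_def)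
  have int_\<delta>: "(\<lambda>x. \<delta> N \<theta> x \<bullet> curl (\<delta> N \<theta>) x) integrable_on S" for N \<theta>
    by (rule integrable) (use z\<delta> in \<open>auto intro!: smooth_on_inner smooth_on_curl S sm\<delta>\<close>)
  have sum: "\<delta> N 0 x \<bullet> curl (\<delta> N 0) x + \<delta> N (pi/2) x \<bullet> curl (\<delta> N (pi/2)) x
      = N ^ 3 * f3 x + N\<^sup>2 * f2 x + N * f1 x + f0 x" if x: "x \<in> S" for N x
  proof -
    note diff = smpq[THEN smooth_on_differentiable[OF _ x]]
    have U: "(\<lambda>x. curl F x \<times> T x + ((N *\<^sub>R k) \<bullet> T x) *\<^sub>R G x) = (\<lambda>x. q x + N *\<^sub>R p x)"
      and U': "(\<lambda>x. curl G x \<times> T x - ((N *\<^sub>R k) \<bullet> T x) *\<^sub>R F x) = (\<lambda>x. q' x + N *\<^sub>R p' x)"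
      and Ux: "curl F x \<times> T x + ((N *\<^sub>R k) \<bullet> T x) *\<^sub>R G x = q x + N *\<^sub>R p x"
      and Ux': "curl G x \<times> T x - ((N *\<^sub>R k) \<bullet> T x) *\<^sub>R F x = q' x + N *\<^sub>R p' x"
      by (simp_all add: q_def p_def q'_def p'_def \<tau>_def)
    have curl_U: "curl (\<lambda>x. q x + N *\<^sub>R p x) x = curl q x + N *\<^sub>R curl p x"
      "curl (\<lambda>x. q' x + N *\<^sub>R p' x) x = curl q' x + N *\<^sub>R curl p' x"
      using diff by (simp_all add: curl_add curl_cmult)
    have "\<delta> N 0 x \<bullet> curl (\<delta> N 0) x + \<delta> N (pi/2) x \<bullet> curl (\<delta> N (pi/2)) x
      = (q x + N *\<^sub>R p x) \<bullet> (curl q x + N *\<^sub>R curl p x) + (q' x + N *\<^sub>R p' x) \<bullet> (curl q' x + N *\<^sub>R curl p' x)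
        + 2 * ((N *\<^sub>R k) \<bullet> ((q' x + N *\<^sub>R p' x) \<times> (q x + N *\<^sub>R p x)))"
      using rotating_average[OF S x smFG sm(1) FT, of "N *\<^sub>R k"] unfolding U U' curl_U Ux Ux' \<delta>_def \<gamma> .
    then show ?thesis
      by (simp add: f3_def f2_def f1_def f0_def inner_add_left inner_add_right cross_add_left cross_add_right
          cross_mult_left cross_mult_right power2_eq_square power3_eq_cube algebra_simps)
  qed
  have Q: "Q N 0 + Q N (pi/2) = N ^ 3 * integral S f3 + N\<^sup>2 * integral S f2 + N * integral S f1 + integral S f0" for N
  proof -
    have "Q N 0 + Q N (pi/2) = integral S (\<lambda>x. N ^ 3 * f3 x + N\<^sup>2 * f2 x + N * f1 x + f0 x)"
      unfolding Q_def integral_add[OF int_\<delta> int_\<delta>, symmetric] by (rule integral_cong) (rule sum)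
    also have "\<dots> = integral S (\<lambda>x. N ^ 3 * f3 x) + integral S (\<lambda>x. N\<^sup>2 * f2 x) + integral S (\<lambda>x. N * f1 x) + integral S f0"
      by (simp only: integral_add integrable_add integrable_on_mult_right int_f)
    finally show ?thesis by simp
  qed
  \<comment> \<open>Two factors \<tau> come from \<open>p\<close> and \<open>p'\<close>, one from
    \<open>F \<times> G = (\<phi>\<^sup>2 \<tau>) T\<close>, and the last from pairing this with
    \<open>k\<close>. The even power fixes the sign pointwise.\<close>
  have f3: "f3 x = - (2 * (\<tau> x ^ 4 * (\<phi> x)\<^sup>2))" for x
  proof -
    have "(t \<times> a) \<times> (t \<times> b) = (t \<bullet> (a \<times> b)) *\<^sub>R t" for t :: "real^3"
      by (simp add: cross3_simps forall_3)
    then have "F x \<times> G x = ((\<phi> x)\<^sup>2 * \<tau> x) *\<^sub>R T x"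
      by (simp add: F_def G_def cross_mult_left cross_mult_right \<tau>_def k_def inner_commute power2_eq_square)
    then show ?thesis
      by (simp add: f3_def p_def p'_def cross_mult_left cross_mult_right)
        (simp add: \<tau>_def[symmetric] power2_eq_square power4_eq_xxxx)
  qed
  have "integral S (\<lambda>x. - f3 x) > 0"
  proof (rule integral_pos_compact_support[OF S _ K(1,2) _ _ x0(1)])
    show "continuous_on S (\<lambda>x. - f3 x)"
      by (rule continuous_on_minus[OF smooth_on_imp_continuous_on[OF smf(1)]])
    show "- f3 x = 0" if "x \<in> S - K" for x
      using zf(1)[OF that] by simp
    show "- f3 x0 > 0"
      using x0 by (simp add: f3 \<tau>_def k_def)
  qed (simp add: f3)
  then have "s * integral S f3 \<noteq> 0" using s by simp
  then obtain N where "0 < N ^ 3 * (s * integral S f3) + N\<^sup>2 * (s * integral S f2) + N * (s * integral S f1) + s * integral S f0"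
    by (rule cubic_positive_value)
  also have "\<dots> = s * (Q N 0 + Q N (pi/2))" unfolding Q by (simp add: algebra_simps)
  \<comment> \<open>Only the sum over the two phases is controlled, but one summand must be positive
    with it.\<close>
  finally have "s * Q N 0 > 0 \<or> s * Q N (pi/2) > 0" by (simp add: distrib_left) linarith
  then show ?thesis by blast
qed

lemma exists_cross_inner_nonzero:
  fixes t :: "real^3"
  assumes "t \<noteq> 0"
  obtains a b where "(a \<times> b) \<bullet> t \<noteq> 0"
proof -
  obtain i where "t $ i \<noteq> 0" using assms by (auto simp: vec_eq_iff)
  then consider "(axis 2 1 \<times> axis 3 1) \<bullet> t \<noteq> 0" | "(axis 3 1 \<times> axis 1 1) \<bullet> t \<noteq> 0" | "(axis 1 1 \<times> axis 2 1) \<bullet> t \<noteq> 0"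
    using exhaust_3[of i] by (auto simp: cross_basis inner_axis')
  then show thesis using that by cases
qed

lemma local_min_at_quadratic:
  fixes p q :: real
  assumes "local_min_at f 0" "\<And>t. f t = r + (t * p + t\<^sup>2 * q)"
  shows "q \<ge> 0"
proof -
  obtain d where d: "d > 0" "\<And>t. \<bar>t\<bar> < d \<Longrightarrow> 0 \<le> t * p + t\<^sup>2 * q"
    using assms by (auto simp: local_min_at_def eventually_nhds_metric dist_real_def)
  \<comment> \<open>Adding the inequalities at d / 2 and - d / 2 cancels the linear term.\<close>
  have "0 \<le> (d / 2)\<^sup>2 * q"
    using d(2)[of "d / 2"] d(2)[of "- (d / 2)"] d(1) by simp
  then show ?thesis using d(1) by (simp add: zero_le_mult_iff)
qed

lemma local_max_at_quadratic:
  fixes p q :: real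
  assumes "local_max_at f 0" "\<And>t. f t = r + (t * p + t\<^sup>2 * q)"
  shows "q \<le> 0"
proof -
  have "local_min_at (\<lambda>t. - f t) 0"
    using assms(1) by (simp add: local_min_at_def local_max_at_def)
  moreover have "- f t = - r + (t * - p + t\<^sup>2 * - q)" for t
    using assms(2)[of t] by simp
  ultimately have "- q \<ge> 0" by (rule local_min_at_quadratic)
  then show ?thesis by simp
qed

section \<open>Conclusions for an integrable pair\<close>

context closed_manifold
begin

context
  fixes D T
  assumes D: "plane_field A D" and int: "integrable_planes A D" and T: "vector_field A T" and tr: "transverse A T D"
begin

abbreviation (input) "w \<equiv> dual_form D T"
abbreviation (input) "L \<equiv> iota_d T (iota_d T (iota_d T w))"

text \<open>The linear coefficient is the first variation formula applied with velocity \<beta> of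
  \<omega> and velocity zero of T.\<close>

lemma gv_dual_line:
  assumes \<beta>: "one_form A \<beta>" and \<beta>T: "\<And>c x. c \<in> A \<Longrightarrow> x \<in> chart_img c \<Longrightarrow> \<beta> c x \<bullet> T c x = 0"
  shows "gv A (ker_form (\<lambda>c x. w c x + t *\<^sub>R \<beta> c x)) T
    = integral_wedge_d (iota_d T w)
      + (t * (- 2 * integral_M (\<lambda>c x. \<beta> c x \<bullet> (w c x \<times> L c x)))
      + t\<^sup>2 * integral_wedge_d (iota_d T \<beta>))"
proof -
  note w = one_form_dual_form[OF D T tr] and wT = dual_form_props(1)[OF D T tr]
  have zero: "vector_field A (\<lambda>_ _. 0)"
    unfolding vector_field_def
    using linear_0[OF has_derivative_linear[OF Dtransition_has_derivative]] by (simp add: smooth_on_const)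
  have b: "iota_d T \<beta> = (\<lambda>c x. iota_d (\<lambda>_ _. 0) w c x + iota_d T \<beta> c x)"
    by (simp add: fun_eq_iff iota_d_def)
  have "integral_M (\<lambda>c x. iota_d T w c x \<bullet> curl (iota_d T \<beta> c) x + iota_d T \<beta> c x \<bullet> curl (iota_d T w c) x)
      = - 2 * integral_M (\<lambda>c x. \<beta> c x \<bullet> (w c x \<times> L c x))"
    using integral_first_variation[OF w T \<beta> zero wT dual_form_integrable[OF D T tr int] _ b] \<beta>T
    by (simp add: add.commute)
  then show ?thesis
    using gv_line[OF T w \<beta> wT \<beta>T, of t] by simp
qed

text \<open>The rotating waves are planted in a single chart, where T is nonzero because \<omega>
  (T) = 1; localisation turns the global integral into the one whose sign is already under
  control.\<close>

lemma exists_second_variation_sign: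
  assumes s: "s \<noteq> 0"
  obtains \<beta> where "one_form A \<beta>" "\<And>c x. c \<in> A \<Longrightarrow> x \<in> chart_img c \<Longrightarrow> \<beta> c x \<bullet> T c x = 0"
    "s * integral_wedge_d (iota_d T \<beta>) > 0"
proof -
  \<comment> \<open>Types are nonempty, so the manifold has a point.\<close>
  fix p0 :: 'a
  obtain c where c: "c \<in> A" "p0 \<in> fst c" using charts_cover by blast
  note O = chartD(2)[OF c(1)]
  define x0 where "x0 = snd c p0"
  have x0: "x0 \<in> chart_img c" unfolding x0_def by (rule chart_in[OF c])
  have "T c x0 \<noteq> 0" using dual_form_props(1)[OF D T tr c(1) x0] by auto
  then obtain a b where ab: "(a \<times> b) \<bullet> T c x0 \<noteq> 0"
    by (rule exists_cross_inner_nonzero)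
  obtain g where g: "smooth_function A g" "\<And>q. g q \<ge> 0" "g p0 > 0" and supp: "closure {q. g q \<noteq> 0} \<subseteq> fst c"
    using bump_function_manifold[OF c] by metis
  define \<phi> where "\<phi> x = g (chart_inv c x)" for x
  define K where "K = snd c ` closure {q. g q \<noteq> 0}"
  have sm\<phi>: "smooth_on \<phi> (chart_img c)"
    unfolding \<phi>_def by (rule smooth_functionD[OF g(1) c(1)])
  have K: "compact K" "K \<subseteq> chart_img c"
    unfolding K_def using compact_chart_image[OF c(1) closed_closure supp] .
  have zero: "\<phi> x = 0" if "x \<in> chart_img c - K" for x
  proof -
    have "chart_inv c x \<notin> closure {q. g q \<noteq> 0}"
      using that chart_inverse[OF c(1), of x] unfolding K_def by (metis DiffE image_eqI)
    then show ?thesis unfolding \<phi>_def using closure_subset[of "{q. g q \<noteq> 0}"] by blast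
  qed
  have \<phi>0: "\<phi> x0 \<noteq> 0"
    using g(3) by (simp add: \<phi>_def x0_def chart_inv_inverse[OF c])
  \<comment> \<open>\<mu> omits the cut-off because \<open>local_form\<close> multiplies by
    \<open>g\<close>; \<gamma> below carries it as \<phi>, the form that the sign lemma expects. In
    chart \<open>c\<close> the two descriptions agree.\<close>
  define \<mu> where "\<mu> N \<theta> = rotating (N *\<^sub>R (a \<times> b)) \<theta> (\<lambda>x. T c x \<times> a) (\<lambda>x. T c x \<times> b)" for N \<theta>
  define \<gamma> where "\<gamma> N \<theta> = rotating (N *\<^sub>R (a \<times> b)) \<theta> (\<lambda>x. \<phi> x *\<^sub>R (T c x \<times> a)) (\<lambda>x. \<phi> x *\<^sub>R (T c x \<times> b))" for N \<theta>
  define \<delta> where "\<delta> N \<theta> x = curl (\<gamma> N \<theta>) x \<times> T c x" for N \<theta> x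
  define \<beta> where "\<beta> N \<theta> = local_form c g (\<mu> N \<theta>)" for N \<theta>
  have sm\<mu>: "smooth_on (\<mu> N \<theta>) (chart_img c)" for N \<theta>
    unfolding \<mu>_def by (intro smooth_on_rotating smooth_on_cross smooth_on_const O vector_field_smooth[OF T c(1)])
  note local = c(1) g(1) supp sm\<mu>
  have \<beta>: "one_form A (\<beta> N \<theta>)" for N \<theta>
    unfolding \<beta>_def by (rule one_form_local_form[OF local])
  have \<beta>T: "\<beta> N \<theta> d y \<bullet> T d y = 0" if "d \<in> A" for N \<theta> d y
    unfolding \<beta>_def
    by (rule local_form_vector_field[OF local T _ that]) (simp add: \<mu>_def rotating_def inner_add_left dot_cross_self)
  have \<beta>c: "\<beta> N \<theta> c y = \<gamma> N \<theta> y" if "y \<in> chart_img c" for N \<theta> y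
    unfolding \<beta>_def local_form_self[OF local that] by (simp add: \<mu>_def \<gamma>_def rotating_def \<phi>_def algebra_simps)
  have \<delta>c: "iota_d T (\<beta> N \<theta>) c y = \<delta> N \<theta> y" if "y \<in> chart_img c" for N \<theta> y
    unfolding iota_d_def \<delta>_def using curl_cong[OF O that \<beta>c] by simp
  have Q: "integral_wedge_d (iota_d T (\<beta> N \<theta>))
      = integral (chart_img c) (\<lambda>x. \<delta> N \<theta> x \<bullet> curl (\<delta> N \<theta>) x)" for N \<theta>
  proof -
    have b: "one_form A (iota_d T (\<beta> N \<theta>))" by (rule one_form_iota_d[OF T \<beta>])
    have z: "iota_d T (\<beta> N \<theta>) d x \<bullet> curl (iota_d T (\<beta> N \<theta>) d) x = 0"
      if dx: "d \<in> A" "x \<in> chart_img d" "chart_inv d x \<notin> closure {q. g q \<noteq> 0}" for d x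
    proof -
      obtain U where U: "open U" "x \<in> U" "\<And>y. y \<in> U \<Longrightarrow> \<beta> N \<theta> d y = 0"
        unfolding \<beta>_def using local_form_near_0[OF c(1) g(1) supp sm\<mu>[of N \<theta>] dx] by blast
      have "curl (\<beta> N \<theta> d) x = curl (\<lambda>_. 0) x" by (rule curl_cong[OF U])
      then show ?thesis by (simp add: iota_d_def curl_def)
    qed
    have "integral_wedge_d (iota_d T (\<beta> N \<theta>))
        = integral (chart_img c) (\<lambda>x. iota_d T (\<beta> N \<theta>) c x \<bullet> curl (iota_d T (\<beta> N \<theta>) c) x)"
      by (rule integral_M_local[OF density_one_form_curl[OF b b] c(1) closed_closure supp]) (rule z)
    also have "\<dots> = integral (chart_img c) (\<lambda>x. \<delta> N \<theta> x \<bullet> curl (\<delta> N \<theta>) x)"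
    proof (rule integral_cong)
      fix x assume x: "x \<in> chart_img c"
      show "iota_d T (\<beta> N \<theta>) c x \<bullet> curl (iota_d T (\<beta> N \<theta>) c) x = \<delta> N \<theta> x \<bullet> curl (\<delta> N \<theta>) x"
        using curl_cong[OF O x \<delta>c] \<delta>c[OF x] by simp
    qed
    finally show ?thesis .
  qed
  obtain N \<theta> where "s * integral (chart_img c) (\<lambda>x. \<delta> N \<theta> x \<bullet> curl (\<delta> N \<theta>) x) > 0"
    using rotating_integral_sign[OF O vector_field_smooth[OF T c(1)] sm\<phi> K zero x0 \<phi>0 ab s]
    unfolding \<delta>_def[abs_def] \<gamma>_def by blast
  then show thesis
    using \<beta>[of N \<theta>] \<beta>T[of _ N \<theta>] Q[of N \<theta>] by (intro that[of "\<beta> N \<theta>"]) simp_all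
qed

text \<open>A negative quadratic coefficient along some line excludes a minimum and a positive one
  excludes a maximum, whatever the linear coefficient is.\<close>

lemma not_local_extremum: "\<not> local_extremum A D T"
proof
  assume "local_extremum A D T"
  then consider "\<And>\<epsilon> \<omega>t Tt. variation A D T \<epsilon> \<omega>t Tt \<Longrightarrow> local_min_at (\<lambda>t. gv A (ker_form (\<omega>t t)) (Tt t)) 0"
    | "\<And>\<epsilon> \<omega>t Tt. variation A D T \<epsilon> \<omega>t Tt \<Longrightarrow> local_max_at (\<lambda>t. gv A (ker_form (\<omega>t t)) (Tt t)) 0"
    unfolding local_extremum_def by blast
  then show False
  proof cases
    case 1
    obtain \<beta> where \<beta>: "one_form A \<beta>" "\<And>c x. c \<in> A \<Longrightarrow> x \<in> chart_img c \<Longrightarrow> \<beta> c x \<bullet> T c x = 0"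
      and neg: "- 1 * integral_wedge_d (iota_d T \<beta>) > 0"
      by (rule exists_second_variation_sign[of "- 1"]) simp_all
    show False
      using local_min_at_quadratic[OF 1[OF variation_line[OF D T tr \<beta>]] gv_dual_line[OF \<beta>]] neg by simp
  next
    case 2
    obtain \<beta> where \<beta>: "one_form A \<beta>" "\<And>c x. c \<in> A \<Longrightarrow> x \<in> chart_img c \<Longrightarrow> \<beta> c x \<bullet> T c x = 0"
      and pos: "1 * integral_wedge_d (iota_d T \<beta>) > 0"
      by (rule exists_second_variation_sign[of "1"]) simp_all
    show False
      using local_max_at_quadratic[OF 2[OF variation_line[OF D T tr \<beta>]] gv_dual_line[OF \<beta>]] pos by simp
  qed
qed

lemma variation_has_derivative:
  assumes "variation A D T \<epsilon> \<omega>t Tt"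
  obtains a where "((\<lambda>t. gv A (ker_form (\<omega>t t)) (Tt t)) has_real_derivative
    - 2 * integral_M (\<lambda>c x. a c x \<bullet> (w c x \<times> L c x))) (at 0)"
proof -
  have \<epsilon>: "\<epsilon> > 0"
    and forms: "\<And>t. \<bar>t\<bar> < \<epsilon> \<Longrightarrow> one_form A (\<omega>t t)" "\<And>t. \<bar>t\<bar> < \<epsilon> \<Longrightarrow> vector_field A (Tt t)"
    and fam: "smooth_family A \<epsilon> \<omega>t" "smooth_family A \<epsilon> Tt"
    and pairing: "\<And>t c x. \<bar>t\<bar> < \<epsilon> \<Longrightarrow> c \<in> A \<Longrightarrow> x \<in> chart_img c \<Longrightarrow> \<omega>t t c x \<bullet> Tt t c x = 1"
    and eq: "\<And>c x. c \<in> A \<Longrightarrow> x \<in> chart_img c \<Longrightarrow> \<omega>t 0 c x = w c x" "\<And>c x. c \<in> A \<Longrightarrow> x \<in> chart_img c \<Longrightarrow> Tt 0 c x = T c x"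
    using assms by (auto simp: variation_def)
  note ctx = \<epsilon> forms fam pairing
  have 0: "\<bar>0\<bar> < \<epsilon>" using \<epsilon> by simp
  let ?a = "\<lambda>c. time_deriv (\<lambda>t. \<omega>t t c)" and ?X = "\<lambda>c. time_deriv (\<lambda>t. Tt t c)"
  have int0: "\<omega>t 0 c x \<bullet> curl (\<omega>t 0 c) x = 0" if "c \<in> A" "x \<in> chart_img c" for c x
    using curl_cong[OF chartD(2)[OF that(1)] that(2) eq(1)[OF that(1)]] eq(1)[OF that]
      dual_form_integrable[OF D T tr int that] by simp
  \<comment> \<open>A variation starts at \<omega> and T only in the sense of equal values on chart
    images, so the operators are compared there.\<close>
  have L0: "iota_d (Tt 0) (iota_d (Tt 0) (iota_d (Tt 0) (\<omega>t 0))) c x = L c x"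
    if cx: "c \<in> A" "x \<in> chart_img c" for c x
    by (intro iota_d_cong eq cx; simp add: cx)
  have "((\<lambda>t. gv A (ker_form (\<omega>t t)) (Tt t)) has_real_derivative
    - 2 * integral_M (\<lambda>c x. ?a c x \<bullet> (\<omega>t 0 c x \<times>
        iota_d (Tt 0) (iota_d (Tt 0) (iota_d (Tt 0) (\<omega>t 0))) c x))) (at 0)"
    using gv_family_has_derivative[OF ctx]
      integral_first_variation[OF forms(1)[OF 0] forms(2)[OF 0] time_deriv_one_form[OF ctx]
        time_deriv_vector_field[OF ctx] pairing[OF 0] int0 time_deriv_pairing[OF ctx] eta_deriv_def[OF ctx]]
    by simp
  also have "integral_M (\<lambda>c x. ?a c x \<bullet> (\<omega>t 0 c x \<times>
        iota_d (Tt 0) (iota_d (Tt 0) (iota_d (Tt 0) (\<omega>t 0))) c x))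
      = integral_M (\<lambda>c x. ?a c x \<bullet> (w c x \<times> L c x))"
    by (rule integral_M_cong) (simp add: eq L0)
  finally show thesis by (rule that)
qed

text \<open>If the third Lie derivative is nonzero at a point, a straight-line variation supported
  near it has first variation of strict sign.\<close>

lemma critical_iff_iota_d:
  "critical A D T \<longleftrightarrow> (\<forall>c\<in>A. \<forall>x\<in>chart_img c. L c x = 0)"
proof
  assume L: "\<forall>c\<in>A. \<forall>x\<in>chart_img c. L c x = 0"
  show "critical A D T"
    unfolding critical_def
  proof (intro allI impI)
    fix \<epsilon> \<omega>t Tt assume "variation A D T \<epsilon> \<omega>t Tt"
    then obtain a where a: "((\<lambda>t. gv A (ker_form (\<omega>t t)) (Tt t)) has_real_derivative
        - 2 * integral_M (\<lambda>c x. a c x \<bullet> (w c x \<times> L c x))) (at 0)"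
      by (rule variation_has_derivative)
    have "integral_M (\<lambda>c x. a c x \<bullet> (w c x \<times> L c x)) = integral_M (\<lambda>c x. 0 * 0)"
      by (rule integral_M_cong) (simp add: L)
    then show "((\<lambda>t. gv A (ker_form (\<omega>t t)) (Tt t)) has_real_derivative 0) (at 0)"
      using a by (simp add: integral_M_def)
  qed
next
  note w = one_form_dual_form[OF D T tr] and wT = dual_form_props(1)[OF D T tr]
  have L: "one_form A L" by (intro one_form_iota_d T w)
  assume crit: "critical A D T"
  show "\<forall>c\<in>A. \<forall>x\<in>chart_img c. L c x = 0"
  proof (rule ccontr)
    assume "\<not> (\<forall>c\<in>A. \<forall>x\<in>chart_img c. L c x = 0)"
    then obtain c x0 where c: "c \<in> A" and x0: "x0 \<in> chart_img c" and L0: "L c x0 \<noteq> 0" by blast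
    note O = chartD(2)[OF c]
    obtain g where g: "smooth_function A g" "\<And>q. g q \<ge> 0" "g (chart_inv c x0) > 0"
      and supp: "closure {q. g q \<noteq> 0} \<subseteq> fst c"
      using bump_function_manifold[OF c chart_inv_in[OF c x0]] by metis
    define n where "n x = w c x \<times> L c x" for x
    \<comment> \<open>\<open>n\<close> represents \<omega> \<and> \<open>L\<close>. Subtracting its
      T-value times \<open>w\<close> makes the test covector annihilate T and leaves its product
      with \<open>n\<close> unchanged, since \<open>n\<close> is orthogonal to \<open>w\<close>; the
      integrand becomes \<open>g\<close> times a square.\<close>
    define \<gamma> where "\<gamma> x = n x - (n x \<bullet> T c x) *\<^sub>R w c x" for x
    define \<beta> where "\<beta> = local_form c g \<gamma>"
    have "smooth_on n (chart_img c)"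
      unfolding n_def by (intro smooth_on_cross O one_form_smooth[OF w c] one_form_smooth[OF L c])
    then have sm\<gamma>: "smooth_on \<gamma> (chart_img c)"
      unfolding \<gamma>_def
      by (intro smooth_on_diff smooth_on_scaleR smooth_on_inner O one_form_smooth[OF w c] vector_field_smooth[OF T c])
    note local = c g(1) supp sm\<gamma>
    have \<beta>: "one_form A \<beta>"
      unfolding \<beta>_def by (rule one_form_local_form[OF local])
    have \<beta>T: "\<beta> d y \<bullet> T d y = 0" if "d \<in> A" for d y
      unfolding \<beta>_def
      by (rule local_form_vector_field[OF local T _ that]) (simp add: \<gamma>_def inner_diff_left wT[OF c])
    define F where "F d x = \<beta> d x \<bullet> (w d x \<times> L d x)" for d x
    have F: "density F"
      unfolding F_def[abs_def] by (rule density_one_forms[OF \<beta> w L])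
    have Fc: "F c x = g (chart_inv c x) * (n x \<bullet> n x)" if "x \<in> chart_img c" for x
    proof -
      have "\<gamma> x \<bullet> n x = n x \<bullet> n x"
        unfolding \<gamma>_def by (simp add: inner_diff_left) (simp add: n_def dot_cross_self)
      then show ?thesis
        unfolding F_def \<beta>_def local_form_self[OF local that] n_def[symmetric] by simp
    qed
    have change: "F d x = det (matrix (Dtransition d c x)) * F c (transition d c x)" if "d \<in> A" "x \<in> overlap d c" for d x
      using F that c by (simp add: density_def)
    have "integral_M F > 0"
    proof (rule integral_M_pos[where p="chart_inv c x0"])
      show "continuous_on (chart_img d) (F d)" if "d \<in> A" for d
        using F that by (simp add: density_def)
      \<comment> \<open>The square is visible only in chart \<open>c\<close>; the positive
        determinants of the transition maps carry its sign to all other charts.\<close>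
      show "F d x \<ge> 0" if dx: "d \<in> A" "x \<in> chart_img d" for d x
      proof (cases "x \<in> overlap d c")
        case True
        then show ?thesis
          using change[OF dx(1) True] Fc[OF transition_in[OF dx(1) c True]] g(2) transition_det[OF dx(1) c True] by simp
      next
        case False
        then show ?thesis by (simp add: F_def \<beta>_def local_form_def)
      qed
      show "F d (snd d (chart_inv c x0)) > 0" if d: "d \<in> A" "chart_inv c x0 \<in> fst d" for d
      proof -
        let ?y = "snd d (chart_inv c x0)"
        have y: "?y \<in> overlap d c"
          using d chart_inv_in[OF c x0] by (auto simp: overlap_def)
        have cy: "transition d c ?y = x0"
          using chart_inv_inverse[OF d] chart_inverse[OF c x0] by (simp add: transition_def)
        \<comment> \<open>\<open>L\<close> is recovered from \<open>n\<close> by a cross product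
          with T, because \<omega> (T) = 1 and \<open>L\<close> vanishes on T.\<close>
        have "n x0 \<noteq> 0"
        proof
          assume "n x0 = 0"
          moreover have "T c x0 \<times> n x0 = - L c x0"
            unfolding n_def cross_triple_expand
            using wT[OF c x0] iota_d_inner_self[of T "iota_d T (iota_d T w)" c x0]
            by (simp add: inner_commute)
          ultimately show False using L0 by simp
        qed
        then show ?thesis
          using change[OF d(1) y] Fc[OF x0] g(3) transition_det[OF d(1) c y] cy by simp
      qed
    qed
    moreover have "integral_M F = 0"
    proof -
      have "((\<lambda>t. gv A (ker_form (\<lambda>c x. w c x + t *\<^sub>R \<beta> c x)) T) has_real_derivative 0) (at 0)"
        using crit variation_line[OF D T tr \<beta> \<beta>T] unfolding critical_def by blast
      moreover have "((\<lambda>t. gv A (ker_form (\<lambda>c x. w c x + t *\<^sub>R \<beta> c x)) T) has_real_derivative - 2 * integral_M F) (at 0)"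
        by (subst gv_dual_line[OF \<beta> \<beta>T]) (auto simp: F_def[abs_def] intro!: derivative_eq_intros)
      ultimately have "0 = - 2 * integral_M F" by (rule DERIV_unique)
      then show ?thesis by simp
    qed
    ultimately show False by simp
  qed
qed

end

end

unbundle no cross3_syntax

theorem theorem1:
  fixes A :: "'a::t2_space chart set"
  assumes "closed_oriented_3manifold A"
  shows
    "(\<forall>D P T. plane_field A D \<and> transverse_orientation A D P \<and> integrable_planes A D
         \<and> vector_field A T \<and> transverse A T D \<longrightarrow>
         (critical A D T \<longleftrightarrow>
           (\<forall>c\<in>A. \<forall>x\<in>chart_img c. (lie_derivative T ^^ 3) (dual_form D T) c x = 0)))
     \<and> \<not> (\<exists>D T. plane_field A D \<and> integrable_planes A D
         \<and> vector_field A T \<and> transverse A T D \<and> local_extremum A D T)"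
proof -
  interpret closed_manifold A
    by unfold_locales (rule assms)
  have "critical A D T \<longleftrightarrow> (\<forall>c\<in>A. \<forall>x\<in>chart_img c. (lie_derivative T ^^ 3) (dual_form D T) c x = 0)"
    if D: "plane_field A D" "integrable_planes A D" "vector_field A T" "transverse A T D" for D T
    using critical_iff_iota_d[OF D]
      lie_derivative_cubed[OF D(3) one_form_dual_form[OF D(1,3,4)] dual_form_props(1)[OF D(1,3,4)]]
    by simp
  moreover have "\<not> local_extremum A D T"
    if D: "plane_field A D" "integrable_planes A D" "vector_field A T" "transverse A T D" for D T
    by (rule not_local_extremum[OF D])
  ultimately show ?thesis by blast
qed

end
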